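(* Let $\Lambda$ be a finite dimensional algebra over an algebraically closed field $k$. Then $\Lambda$ is an Auslander algebra if and only if its global dimension satisfies $\mathrm{gl.d}\,\Lambda\leq 2$ and $$\mathcal{C}(\Lambda)=\{\, I\in \mathrm{mod}\text{-}\Lambda \mid I \text{ is injective and } \mathrm{pd}_{\Lambda}\,\mathrm{soc}\,I\leq 1\,\}.$$
   Context: Standing conventions: $k$ is an algebraically closed field; all algebras are basic finite dimensional $k$-algebras; modules are finitely generated right modules, and $\mathrm{mod}\text{-}\Lambda$ is the category of finitely generated right $\Lambda$-modules. $\mathrm{pd}_\Lambda M$ denotes the projective dimension of $M$ and $\mathrm{soc}\,M$ its socle; $\mathrm{gl.d}\,\Lambda$ is the global dimension of $\Lambda$. A finite dimensional algebra $\Lambda$ is an Auslander algebra if its global dimension is at most two and its dominant dimension is at least two, that is, in the minimal injective resolution $0\to\Lambda\to I_0\to I_1\to I_2\to 0$ of $\Lambda$ (as a right $\Lambda$-module), both $I_0$ and $I_1$ are projective $\Lambda$-modules (terms of the resolution may be zero). $\mathcal{C}(\Lambda)$ is the full subcategory of $\mathrm{mod}\text{-}\Lambda$ whose objects are all the $\Lambda$-modules that are both projective and injective; the displayed equality is an equality of full subcategories (i.e. of classes of objects). *)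

theory Defs
  imports "HOL-Algebra.Algebra" "HOL-Library.Extended_Nat"
begin

section \<open>Right modules\<close>

text \<open>
  Modules are records of type \<^typ>\<open>('a, 'm) module\<close>. The library locale \<^locale>\<open>module\<close> is
  restricted to commutative rings; here \<open>R\<close> is an arbitrary ring, and for a right \<open>R\<close>-module the
  term \<open>a \<odot>\<^bsub>M\<^esub> x\<close> denotes the right action \<open>x \<cdot> a\<close>, which is why the product is reversed
  in \<open>ract_assoc\<close>. The ring multiplication and unit fields of a record that represents a right module are never used.
\<close>

locale right_module = R?: ring R + M?: abelian_group M
  for R :: "('a, 'r) ring_scheme" and M :: "('a, 'm) module" (structure) +
  assumes ract_closed [simp, intro]:
      "\<lbrakk>a \<in> carrier R; x \<in> carrier M\<rbrakk> \<Longrightarrow> a \<odot>\<^bsub>M\<^esub> x \<in> carrier M"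
    and ract_l_distr:
      "\<lbrakk>a \<in> carrier R; b \<in> carrier R; x \<in> carrier M\<rbrakk> \<Longrightarrow>
        (a \<oplus>\<^bsub>R\<^esub> b) \<odot>\<^bsub>M\<^esub> x = a \<odot>\<^bsub>M\<^esub> x \<oplus>\<^bsub>M\<^esub> b \<odot>\<^bsub>M\<^esub> x"
    and ract_r_distr:
      "\<lbrakk>a \<in> carrier R; x \<in> carrier M; y \<in> carrier M\<rbrakk> \<Longrightarrow>
        a \<odot>\<^bsub>M\<^esub> (x \<oplus>\<^bsub>M\<^esub> y) = a \<odot>\<^bsub>M\<^esub> x \<oplus>\<^bsub>M\<^esub> a \<odot>\<^bsub>M\<^esub> y"
    and ract_assoc:
      "\<lbrakk>a \<in> carrier R; b \<in> carrier R; x \<in> carrier M\<rbrakk> \<Longrightarrow>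
        (a \<otimes>\<^bsub>R\<^esub> b) \<odot>\<^bsub>M\<^esub> x = b \<odot>\<^bsub>M\<^esub> (a \<odot>\<^bsub>M\<^esub> x)"
    and ract_one [simp]:
      "x \<in> carrier M \<Longrightarrow> \<one>\<^bsub>R\<^esub> \<odot>\<^bsub>M\<^esub> x = x"

definition module_hom ::
    "('a, 'r) ring_scheme \<Rightarrow> ('a, 'm) module \<Rightarrow> ('a, 'n) module \<Rightarrow> ('m \<Rightarrow> 'n) set" where
  "module_hom R M N = {f. f \<in> carrier M \<rightarrow> carrier N \<and>
     (\<forall>x\<in>carrier M. \<forall>y\<in>carrier M. f (x \<oplus>\<^bsub>M\<^esub> y) = f x \<oplus>\<^bsub>N\<^esub> f y) \<and>
     (\<forall>a\<in>carrier R. \<forall>x\<in>carrier M. f (a \<odot>\<^bsub>M\<^esub> x) = a \<odot>\<^bsub>N\<^esub> f x)}"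

definition module_iso ::
    "('a, 'r) ring_scheme \<Rightarrow> ('a, 'm) module \<Rightarrow> ('a, 'n) module \<Rightarrow> bool" where
  "module_iso R M N \<longleftrightarrow> (\<exists>f\<in>module_hom R M N. bij_betw f (carrier M) (carrier N))"

text \<open>The library predicate \<^term>\<open>submodule H R M\<close> does not assume \<open>R\<close> commutative.\<close>

definition submodule_span ::
    "('a, 'r) ring_scheme \<Rightarrow> ('a, 'm) module \<Rightarrow> 'm set \<Rightarrow> 'm set" where
  "submodule_span R M B = \<Inter>{H. submodule H R M \<and> B \<subseteq> H}"

definition finitely_generated :: "('a, 'r) ring_scheme \<Rightarrow> ('a, 'm) module \<Rightarrow> bool" where
  "finitely_generated R M \<longleftrightarrow>
     (\<exists>B. finite B \<and> B \<subseteq> carrier M \<and> submodule_span R M B = carrier M)"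

definition regular_module :: "('a, 'r) ring_scheme \<Rightarrow> ('a, 'a) module" where
  "regular_module R = \<lparr>carrier = carrier R, monoid.mult = monoid.mult R, one = \<one>\<^bsub>R\<^esub>, ring.zero = \<zero>\<^bsub>R\<^esub>,
     ring.add = ring.add R, smult = (\<lambda>a x. x \<otimes>\<^bsub>R\<^esub> a)\<rparr>"

text \<open>
  The category of finitely generated right modules. HOL cannot quantify over all carrier types, so
  the objects are the modules whose carrier is a subset of the type \<^typ>\<open>'a list\<close>, with arbitrary
  operations. Lemma \<open>ex_iso_mod_cat\<close> below shows that every finitely generated right module, on any
  type, is isomorphic to such an object.
\<close>

definition mod_cat :: "('a, 'r) ring_scheme \<Rightarrow> ('a, 'a list) module set" where
  "mod_cat R = {M. right_module R M \<and> finitely_generated R M}"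

context right_module
begin

lemma ract_zero [simp]: "x \<in> carrier M \<Longrightarrow> \<zero>\<^bsub>R\<^esub> \<odot>\<^bsub>M\<^esub> x = \<zero>\<^bsub>M\<^esub>"
proof -
  assume x: "x \<in> carrier M"
  have "\<zero>\<^bsub>R\<^esub> \<odot>\<^bsub>M\<^esub> x \<oplus>\<^bsub>M\<^esub> \<zero>\<^bsub>R\<^esub> \<odot>\<^bsub>M\<^esub> x = \<zero>\<^bsub>R\<^esub> \<odot>\<^bsub>M\<^esub> x \<oplus>\<^bsub>M\<^esub> \<zero>\<^bsub>M\<^esub>"
    using ract_l_distr[of "\<zero>\<^bsub>R\<^esub>" "\<zero>\<^bsub>R\<^esub>" x] x by simp
  then show ?thesis using x by (simp del: M.r_zero)
qed

lemma ract_r_zero [simp]: "a \<in> carrier R \<Longrightarrow> a \<odot>\<^bsub>M\<^esub> \<zero>\<^bsub>M\<^esub> = \<zero>\<^bsub>M\<^esub>"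
proof -
  assume a: "a \<in> carrier R"
  have "a \<odot>\<^bsub>M\<^esub> \<zero>\<^bsub>M\<^esub> \<oplus>\<^bsub>M\<^esub> a \<odot>\<^bsub>M\<^esub> \<zero>\<^bsub>M\<^esub> = a \<odot>\<^bsub>M\<^esub> \<zero>\<^bsub>M\<^esub> \<oplus>\<^bsub>M\<^esub> \<zero>\<^bsub>M\<^esub>"
    using ract_r_distr[of a "\<zero>\<^bsub>M\<^esub>" "\<zero>\<^bsub>M\<^esub>"] a by simp
  then show ?thesis using a by (simp del: M.r_zero)
qed

lemma ract_minus_one: "x \<in> carrier M \<Longrightarrow> (\<ominus>\<^bsub>R\<^esub> \<one>\<^bsub>R\<^esub>) \<odot>\<^bsub>M\<^esub> x = \<ominus>\<^bsub>M\<^esub> x"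
proof -
  assume x: "x \<in> carrier M"
  have "(\<ominus>\<^bsub>R\<^esub> \<one>\<^bsub>R\<^esub>) \<odot>\<^bsub>M\<^esub> x \<oplus>\<^bsub>M\<^esub> x = \<zero>\<^bsub>M\<^esub>"
    using ract_l_distr[of "\<ominus>\<^bsub>R\<^esub> \<one>\<^bsub>R\<^esub>" "\<one>\<^bsub>R\<^esub>" x] x by (simp add: R.l_neg)
  then show ?thesis using x by (metis M.minus_equality R.a_inv_closed R.one_closed ract_closed)
qed

lemma right_submoduleI:
  assumes "H \<subseteq> carrier M" "\<zero>\<^bsub>M\<^esub> \<in> H"
    and "\<And>x y. x \<in> H \<Longrightarrow> y \<in> H \<Longrightarrow> x \<oplus>\<^bsub>M\<^esub> y \<in> H"
    and act: "\<And>a x. a \<in> carrier R \<Longrightarrow> x \<in> H \<Longrightarrow> a \<odot>\<^bsub>M\<^esub> x \<in> H"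
  shows "submodule H R M"
proof -
  have "\<ominus>\<^bsub>M\<^esub> x \<in> H" if "x \<in> H" for x
    using act[of "\<ominus>\<^bsub>R\<^esub> \<one>\<^bsub>R\<^esub>" x] that assms(1) by (auto simp: ract_minus_one subset_iff)
  then show ?thesis
    using assms by (auto intro!: submodule.intro subgroup.intro submodule_axioms.intro simp: a_inv_def)
qed

end

fun lin_comb :: "('a, 'm) module \<Rightarrow> 'a list \<Rightarrow> 'm list \<Rightarrow> 'm" where
  "lin_comb M (c # cs) (b # bs) = c \<odot>\<^bsub>M\<^esub> b \<oplus>\<^bsub>M\<^esub> lin_comb M cs bs"
| "lin_comb M _ _ = \<zero>\<^bsub>M\<^esub>"

lemma (in right_module) lin_combs_submodule:
  assumes "set bs \<subseteq> carrier M"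
  defines "L \<equiv> {lin_comb M cs bs | cs. length cs = length bs \<and> set cs \<subseteq> carrier R}"
  shows "submodule L R M" "set bs \<subseteq> L"
proof -
  define C where "C bs = {lin_comb M cs bs | cs. length cs = length bs \<and> set cs \<subseteq> carrier R}" for bs
  have C_Nil: "C [] = {\<zero>\<^bsub>M\<^esub>}" by (auto simp: C_def)
  have C_Cons: "C (b # bs) = {c \<odot>\<^bsub>M\<^esub> b \<oplus>\<^bsub>M\<^esub> x | c x. c \<in> carrier R \<and> x \<in> C bs}" for b bs
  proof (intro equalityI subsetI)
    fix x assume "x \<in> C (b # bs)"
    then obtain cs where cs: "x = lin_comb M cs (b # bs)" "length cs = length (b # bs)"
      "set cs \<subseteq> carrier R" by (auto simp: C_def)
    then obtain c cs' where "cs = c # cs'" by (cases cs) auto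
    with cs show "x \<in> {c \<odot>\<^bsub>M\<^esub> b \<oplus>\<^bsub>M\<^esub> x | c x. c \<in> carrier R \<and> x \<in> C bs}"
      by (auto simp: C_def)
  next
    fix x assume "x \<in> {c \<odot>\<^bsub>M\<^esub> b \<oplus>\<^bsub>M\<^esub> x | c x. c \<in> carrier R \<and> x \<in> C bs}"
    then obtain c cs where "c \<in> carrier R" "length cs = length bs" "set cs \<subseteq> carrier R"
      "x = c \<odot>\<^bsub>M\<^esub> b \<oplus>\<^bsub>M\<^esub> lin_comb M cs bs" by (auto simp: C_def)
    then show "x \<in> C (b # bs)" unfolding C_def
      by (intro CollectI exI[of _ "c # cs"]) auto
  qed
  have "C bs \<subseteq> carrier M \<and> \<zero>\<^bsub>M\<^esub> \<in> C bs \<and> (\<forall>x\<in>C bs. \<forall>y\<in>C bs. x \<oplus>\<^bsub>M\<^esub> y \<in> C bs) \<and>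
      (\<forall>a\<in>carrier R. \<forall>x\<in>C bs. a \<odot>\<^bsub>M\<^esub> x \<in> C bs) \<and> set bs \<subseteq> C bs"
    using assms(1)
  proof (induction bs)
    case Nil
    then show ?case by (simp add: C_Nil)
  next
    case (Cons b bs)
    then have b: "b \<in> carrier M"
      and sub: "\<And>x. x \<in> C bs \<Longrightarrow> x \<in> carrier M" and zero: "\<zero>\<^bsub>M\<^esub> \<in> C bs"
      and add: "\<And>x y. x \<in> C bs \<Longrightarrow> y \<in> C bs \<Longrightarrow> x \<oplus>\<^bsub>M\<^esub> y \<in> C bs"
      and act: "\<And>a x. a \<in> carrier R \<Longrightarrow> x \<in> C bs \<Longrightarrow> a \<odot>\<^bsub>M\<^esub> x \<in> C bs"
      and gen: "\<And>x. x \<in> set bs \<Longrightarrow> x \<in> C bs"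
      by auto
    have mem: "c \<odot>\<^bsub>M\<^esub> b \<oplus>\<^bsub>M\<^esub> x \<in> C (b # bs)" if "c \<in> carrier R" "x \<in> C bs" for c x
      using that by (auto simp: C_Cons)
    have old: "x \<in> C (b # bs)" if "x \<in> C bs" for x
      using mem[of "\<zero>\<^bsub>R\<^esub>" x] that b sub by simp
    have "C (b # bs) \<subseteq> carrier M" using b sub by (auto simp: C_Cons)
    moreover have "x \<oplus>\<^bsub>M\<^esub> y \<in> C (b # bs)" if xy: "x \<in> C (b # bs)" "y \<in> C (b # bs)" for x y
    proof -
      from xy obtain c x' e y' where *: "x = c \<odot>\<^bsub>M\<^esub> b \<oplus>\<^bsub>M\<^esub> x'" "y = e \<odot>\<^bsub>M\<^esub> b \<oplus>\<^bsub>M\<^esub> y'"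
        "c \<in> carrier R" "e \<in> carrier R" "x' \<in> C bs" "y' \<in> C bs" by (auto simp: C_Cons)
      then have "x \<oplus>\<^bsub>M\<^esub> y = (c \<oplus>\<^bsub>R\<^esub> e) \<odot>\<^bsub>M\<^esub> b \<oplus>\<^bsub>M\<^esub> (x' \<oplus>\<^bsub>M\<^esub> y')"
        using b sub by (simp add: ract_l_distr M.a_ac)
      then show ?thesis using * add mem by simp
    qed
    moreover have "a \<odot>\<^bsub>M\<^esub> x \<in> C (b # bs)" if ax: "a \<in> carrier R" "x \<in> C (b # bs)" for a x
    proof -
      from ax obtain c x' where *: "x = c \<odot>\<^bsub>M\<^esub> b \<oplus>\<^bsub>M\<^esub> x'" "c \<in> carrier R" "x' \<in> C bs"
        by (auto simp: C_Cons)
      then have "a \<odot>\<^bsub>M\<^esub> x = (c \<otimes>\<^bsub>R\<^esub> a) \<odot>\<^bsub>M\<^esub> b \<oplus>\<^bsub>M\<^esub> a \<odot>\<^bsub>M\<^esub> x'"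
        using b sub ax by (simp add: ract_r_distr ract_assoc)
      then show ?thesis using * act mem ax by simp
    qed
    moreover have "b \<in> C (b # bs)" using mem[of "\<one>\<^bsub>R\<^esub>" "\<zero>\<^bsub>M\<^esub>"] zero b by simp
    ultimately show ?case using old zero gen by auto
  qed
  then show "submodule L R M" "set bs \<subseteq> L"
    unfolding L_def C_def[symmetric] by (blast intro: right_submoduleI)+
qed

lemma (in right_module) ex_iso_mod_cat:
  assumes "finitely_generated R M"
  shows "\<exists>N\<in>mod_cat R. module_iso R M N"
proof -
  obtain bs where bs: "set bs \<subseteq> carrier M" "submodule_span R M (set bs) = carrier M"
    using assms finite_list unfolding finitely_generated_def by metis
  have ex: "\<exists>cs. lin_comb M cs bs = x" if "x \<in> carrier M" for x
  proof -
    let ?L = "{lin_comb M cs bs | cs. length cs = length bs \<and> set cs \<subseteq> carrier R}"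
    have "submodule_span R M (set bs) \<subseteq> ?L"
      unfolding submodule_span_def by (rule Inter_lower) (simp add: lin_combs_submodule[OF bs(1)])
    then show ?thesis using that bs(2) by blast
  qed
  define f where "f x = (SOME cs. lin_comb M cs bs = x)" for x
  define g where "g cs = lin_comb M cs bs" for cs
  have gf [simp]: "g (f x) = x" if "x \<in> carrier M" for x
    using someI_ex[OF ex[OF that]] by (simp add: f_def g_def)
  define N :: "('a, 'a list) module" where
    "N = \<lparr>carrier = f ` carrier M, monoid.mult = undefined, one = undefined, ring.zero = f \<zero>\<^bsub>M\<^esub>,
      ring.add = (\<lambda>u v. f (g u \<oplus>\<^bsub>M\<^esub> g v)), smult = (\<lambda>a u. f (a \<odot>\<^bsub>M\<^esub> g u))\<rparr>"
  have N [simp]: "carrier N = f ` carrier M" "\<zero>\<^bsub>N\<^esub> = f \<zero>\<^bsub>M\<^esub>"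
    "u \<oplus>\<^bsub>N\<^esub> v = f (g u \<oplus>\<^bsub>M\<^esub> g v)" "a \<odot>\<^bsub>N\<^esub> u = f (a \<odot>\<^bsub>M\<^esub> g u)" for a u v
    by (simp_all add: N_def)
  have "abelian_group N"
  proof (rule abelian_groupI)
    fix u assume "u \<in> carrier N"
    then obtain x where x: "x \<in> carrier M" "u = f x" by auto
    then show "\<exists>v\<in>carrier N. v \<oplus>\<^bsub>N\<^esub> u = \<zero>\<^bsub>N\<^esub>"
      by (intro bexI[of _ "f (\<ominus>\<^bsub>M\<^esub> x)"]) (auto simp: M.l_neg)
  qed (auto simp: M.a_ac)
  then have mod: "right_module R N"
    by (intro right_module.intro right_module_axioms.intro R.ring_axioms)
      (auto simp: ract_l_distr ract_r_distr ract_assoc)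
  interpret N: right_module R N by (rule mod)
  have "submodule_span R N (f ` set bs) = carrier N"
  proof
    have "submodule (carrier N) R N" by (intro N.right_submoduleI) auto
    then show "submodule_span R N (f ` set bs) \<subseteq> carrier N"
      using bs(1) unfolding submodule_span_def by (intro Inter_lower) auto
    show "carrier N \<subseteq> submodule_span R N (f ` set bs)"
      unfolding submodule_span_def
    proof safe
      fix u H assume u: "u \<in> carrier N" and H: "submodule H R N" "f ` set bs \<subseteq> H"
      then have sub: "subgroup H (add_monoid N)" by (simp add: submodule_def)
      have "submodule {x \<in> carrier M. f x \<in> H} R M"
      proof (rule right_submoduleI)
        show "\<zero>\<^bsub>M\<^esub> \<in> {x \<in> carrier M. f x \<in> H}"
          using subgroup.one_closed[OF sub] by simp
      next
        fix x y assume "x \<in> {x \<in> carrier M. f x \<in> H}" "y \<in> {x \<in> carrier M. f x \<in> H}"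
        then show "x \<oplus>\<^bsub>M\<^esub> y \<in> {x \<in> carrier M. f x \<in> H}"
          using subgroup.m_closed[OF sub, of "f x" "f y"] by simp
      next
        fix a x assume "a \<in> carrier R" "x \<in> {x \<in> carrier M. f x \<in> H}"
        then show "a \<odot>\<^bsub>M\<^esub> x \<in> {x \<in> carrier M. f x \<in> H}"
          using submodule.smult_closed[OF H(1), of a "f x"] by simp
      qed auto
      then have "carrier M \<subseteq> {x \<in> carrier M. f x \<in> H}"
        using bs H(2) unfolding submodule_span_def by blast
      then show "u \<in> H" using u by auto
    qed
  qed
  then have "N \<in> mod_cat R"
    using mod bs(1) unfolding mod_cat_def finitely_generated_def
    by (auto intro!: exI[of _ "f ` set bs"])
  moreover have "f \<in> module_hom R M N" by (auto simp: module_hom_def)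
  moreover have "bij_betw f (carrier M) (carrier N)"
    by (auto simp: bij_betw_def intro!: inj_on_inverseI[of _ g])
  ultimately show ?thesis unfolding module_iso_def by blast
qed


section \<open>Projective and injective modules, socle\<close>

definition projective_module :: "('a, 'r) ring_scheme \<Rightarrow> ('a, 'm) module \<Rightarrow> bool" where
  "projective_module R P \<longleftrightarrow>
     (\<forall>M\<in>mod_cat R. \<forall>N\<in>mod_cat R. \<forall>g\<in>module_hom R M N. \<forall>f\<in>module_hom R P N.
        g ` carrier M = carrier N \<longrightarrow>
        (\<exists>h\<in>module_hom R P M. \<forall>x\<in>carrier P. g (h x) = f x))"

definition injective_module :: "('a, 'r) ring_scheme \<Rightarrow> ('a, 'm) module \<Rightarrow> bool" where
  "injective_module R I \<longleftrightarrow>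
     (\<forall>M\<in>mod_cat R. \<forall>N\<in>mod_cat R. \<forall>g\<in>module_hom R M N. \<forall>f\<in>module_hom R M I.
        inj_on g (carrier M) \<longrightarrow>
        (\<exists>h\<in>module_hom R N I. \<forall>x\<in>carrier M. h (g x) = f x))"

definition simple_submodule ::
    "('a, 'r) ring_scheme \<Rightarrow> ('a, 'm) module \<Rightarrow> 'm set \<Rightarrow> bool" where
  "simple_submodule R M S \<longleftrightarrow> submodule S R M \<and> S \<noteq> {\<zero>\<^bsub>M\<^esub>} \<and>
     (\<forall>T. submodule T R M \<longrightarrow> T \<subseteq> S \<longrightarrow> T = {\<zero>\<^bsub>M\<^esub>} \<or> T = S)"

definition socle :: "('a, 'r) ring_scheme \<Rightarrow> ('a, 'm) module \<Rightarrow> ('a, 'm) module" where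
  "socle R M = M\<lparr>carrier := submodule_span R M (\<Union>{S. simple_submodule R M S})\<rparr>"

definition essential_submodule ::
    "('a, 'r) ring_scheme \<Rightarrow> ('a, 'm) module \<Rightarrow> 'm set \<Rightarrow> bool" where
  "essential_submodule R M H \<longleftrightarrow> submodule H R M \<and>
     (\<forall>T. submodule T R M \<longrightarrow> H \<inter> T = {\<zero>\<^bsub>M\<^esub>} \<longrightarrow> T = {\<zero>\<^bsub>M\<^esub>})"


section \<open>Resolutions and homological dimensions\<close>

definition module_kernel :: "('a, 'm) module \<Rightarrow> ('a, 'n) module \<Rightarrow> ('m \<Rightarrow> 'n) \<Rightarrow> 'm set" where
  "module_kernel M N f = {x \<in> carrier M. f x = \<zero>\<^bsub>N\<^esub>}"

text \<open>\<open>\<dots> \<rightarrow> P 2 \<rightarrow> P 1 \<rightarrow> P 0 \<rightarrow> M \<rightarrow> 0\<close>, with augmentation \<open>e\<close> and \<open>d i : P (i + 1) \<rightarrow> P i\<close>.\<close>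

definition projective_resolution ::
    "('a, 'r) ring_scheme \<Rightarrow> ('a, 'm) module \<Rightarrow> (nat \<Rightarrow> ('a, 'a list) module) \<Rightarrow>
     ('a list \<Rightarrow> 'm) \<Rightarrow> (nat \<Rightarrow> 'a list \<Rightarrow> 'a list) \<Rightarrow> bool" where
  "projective_resolution R M P e d \<longleftrightarrow>
     (\<forall>i. P i \<in> mod_cat R \<and> projective_module R (P i)) \<and>
     e \<in> module_hom R (P 0) M \<and>
     (\<forall>i. d i \<in> module_hom R (P (Suc i)) (P i)) \<and>
     e ` carrier (P 0) = carrier M \<and>
     module_kernel (P 0) M e = d 0 ` carrier (P 1) \<and>
     (\<forall>i. module_kernel (P (Suc i)) (P i) (d i) = d (Suc i) ` carrier (P (Suc (Suc i))))"

text \<open>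
  The infimum is \<open>\<infinity>\<close> if there is no finite resolution; the zero module gets dimension \<open>0\<close> (rather
  than \<open>- \<infinity>\<close>).
\<close>

definition proj_dim :: "('a, 'r) ring_scheme \<Rightarrow> ('a, 'm) module \<Rightarrow> enat" where
  "proj_dim R M = Inf {enat n | n. \<exists>P e d. projective_resolution R M P e d \<and>
     (\<forall>i>n. carrier (P i) = {\<zero>\<^bsub>P i\<^esub>})}"

definition gl_dim :: "('a, 'r) ring_scheme \<Rightarrow> enat" where
  "gl_dim R = (SUP M\<in>mod_cat R. proj_dim R M)"

text \<open>
  \<open>0 \<rightarrow> M \<rightarrow> I 0 \<rightarrow> I 1 \<rightarrow> I 2 \<rightarrow> \<dots>\<close>, with coaugmentation \<open>e\<close> and \<open>d i : I i \<rightarrow> I (i + 1)\<close>. Minimality: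
  every map has essential image, i.e. \<open>I 0\<close> is an injective envelope of \<open>M\<close> and \<open>I (i + 1)\<close> is an
  injective envelope of the cokernel of the map into \<open>I i\<close>.
\<close>

definition minimal_injective_resolution ::
    "('a, 'r) ring_scheme \<Rightarrow> ('a, 'm) module \<Rightarrow> (nat \<Rightarrow> ('a, 'a list) module) \<Rightarrow>
     ('m \<Rightarrow> 'a list) \<Rightarrow> (nat \<Rightarrow> 'a list \<Rightarrow> 'a list) \<Rightarrow> bool" where
  "minimal_injective_resolution R M I e d \<longleftrightarrow>
     (\<forall>i. I i \<in> mod_cat R \<and> injective_module R (I i)) \<and>
     e \<in> module_hom R M (I 0) \<and>
     (\<forall>i. d i \<in> module_hom R (I i) (I (Suc i))) \<and>
     inj_on e (carrier M) \<and>
     module_kernel (I 0) (I 1) (d 0) = e ` carrier M \<and>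
     (\<forall>i. module_kernel (I (Suc i)) (I (Suc (Suc i))) (d (Suc i)) = d i ` carrier (I i)) \<and>
     essential_submodule R (I 0) (e ` carrier M) \<and>
     (\<forall>i. essential_submodule R (I (Suc i)) (d i ` carrier (I i)))"

definition dom_dim :: "('a, 'r) ring_scheme \<Rightarrow> enat" where
  "dom_dim R = Sup {enat n | n. \<exists>I e d. minimal_injective_resolution R (regular_module R) I e d \<and>
     (\<forall>i<n. projective_module R (I i))}"

text \<open>
  When the global dimension is at most two, the minimal injective resolution of the regular module
  ends in degree two, so the second conjunct speaks about \<open>0 \<rightarrow> R \<rightarrow> I 0 \<rightarrow> I 1 \<rightarrow> I 2 \<rightarrow> 0\<close>.
\<close>

definition auslander_algebra :: "('a, 'r) ring_scheme \<Rightarrow> bool" where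
  "auslander_algebra R \<longleftrightarrow> gl_dim R \<le> 2 \<and> dom_dim R \<ge> 2"

definition proj_inj_modules :: "('a, 'r) ring_scheme \<Rightarrow> ('a, 'a list) module set" where
  "proj_inj_modules R = {M \<in> mod_cat R. projective_module R M \<and> injective_module R M}"


section \<open>Basic finite-dimensional algebras\<close>

text \<open>
  The library locale \<^locale>\<open>algebra\<close> is for commutative algebras. The zero algebra is allowed.
  In the record \<open>A\<close>, \<open>\<otimes>\<^bsub>A\<^esub>\<close> is the product of the algebra and \<open>\<odot>\<^bsub>A\<^esub>\<close> the scalar action of the field
  \<open>K\<close>, so \<^term>\<open>finitely_generated K A\<close> says that \<open>A\<close> has finite dimension over \<open>K\<close>; the right
  action of \<open>A\<close> on itself is the one of \<^term>\<open>regular_module A\<close>.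
\<close>

locale finite_dimensional_algebra = module K A + A?: ring A + K?: field K
  for K :: "'k ring" and A :: "('k, 'a) module" (structure) +
  assumes smult_mult_left:
      "\<lbrakk>c \<in> carrier K; x \<in> carrier A; y \<in> carrier A\<rbrakk> \<Longrightarrow>
        (c \<odot>\<^bsub>A\<^esub> x) \<otimes>\<^bsub>A\<^esub> y = c \<odot>\<^bsub>A\<^esub> (x \<otimes>\<^bsub>A\<^esub> y)"
    and smult_mult_right:
      "\<lbrakk>c \<in> carrier K; x \<in> carrier A; y \<in> carrier A\<rbrakk> \<Longrightarrow>
        x \<otimes>\<^bsub>A\<^esub> (c \<odot>\<^bsub>A\<^esub> y) = c \<odot>\<^bsub>A\<^esub> (x \<otimes>\<^bsub>A\<^esub> y)"
    and fin_dim: "finitely_generated K A"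

definition idempotent :: "('a, 'r) ring_scheme \<Rightarrow> 'a \<Rightarrow> bool" where
  "idempotent R e \<longleftrightarrow> e \<in> carrier R \<and> e \<otimes>\<^bsub>R\<^esub> e = e"

definition orthogonal :: "('a, 'r) ring_scheme \<Rightarrow> 'a \<Rightarrow> 'a \<Rightarrow> bool" where
  "orthogonal R e f \<longleftrightarrow> e \<otimes>\<^bsub>R\<^esub> f = \<zero>\<^bsub>R\<^esub> \<and> f \<otimes>\<^bsub>R\<^esub> e = \<zero>\<^bsub>R\<^esub>"

definition primitive_idempotent :: "('a, 'r) ring_scheme \<Rightarrow> 'a \<Rightarrow> bool" where
  "primitive_idempotent R e \<longleftrightarrow> idempotent R e \<and> e \<noteq> \<zero>\<^bsub>R\<^esub> \<and>
     (\<forall>f g. idempotent R f \<longrightarrow> idempotent R g \<longrightarrow> orthogonal R f g \<longrightarrow> e = f \<oplus>\<^bsub>R\<^esub> g \<longrightarrow>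
        f = \<zero>\<^bsub>R\<^esub> \<or> g = \<zero>\<^bsub>R\<^esub>)"

definition principal_right_module :: "('a, 'r) ring_scheme \<Rightarrow> 'a \<Rightarrow> ('a, 'a) module" where
  "principal_right_module R e =
     (regular_module R)\<lparr>carrier := {e \<otimes>\<^bsub>R\<^esub> x | x. x \<in> carrier R}\<rparr>"

definition basic_algebra :: "('a, 'r) ring_scheme \<Rightarrow> bool" where
  "basic_algebra R \<longleftrightarrow> (\<exists>E. finite E \<and> (\<forall>e\<in>E. primitive_idempotent R e) \<and>
     (\<forall>e\<in>E. \<forall>f\<in>E. e \<noteq> f \<longrightarrow> orthogonal R e f) \<and>
     (\<Oplus>\<^bsub>R\<^esub>e\<in>E. e) = \<one>\<^bsub>R\<^esub> \<and>
     (\<forall>e\<in>E. \<forall>f\<in>E. e \<noteq> f \<longrightarrow>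
        \<not> module_iso R (principal_right_module R e) (principal_right_module R f)))"

end

theory Submission
  imports Defs
begin

text \<open>
  Write \<open>pd\<close> for projective dimension, let \<open>gl.d A \<le> 2\<close>, and let \<open>0 \<rightarrow> A \<rightarrow> I\<^sub>0 \<rightarrow> I\<^sub>1 \<rightarrow> \<dots>\<close> be a minimal
  injective resolution of the regular module. Both implications rest on one consequence of
  \<open>gl.d A \<le> 2\<close>: a submodule \<open>T\<close> of a module \<open>C\<close> with \<open>pd C \<le> 1\<close> again has \<open>pd T \<le> 1\<close>, because
  \<open>pd T \<le> max (pd C) (pd (C/T) - 1)\<close> (lemma \<open>short_projective_resolution_submod\<close>). Hence the socle of
  a projective module always has projective dimension at most one, and the equality of classes in
  the theorem amounts to the statement that an injective \<open>J\<close> with \<open>pd (soc J) \<le> 1\<close> is projective.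

  Suppose that this holds. An essential submodule contains the socle, so \<open>soc I\<^sub>0 \<subseteq> A\<close> and
  \<open>soc I\<^sub>1 \<subseteq> I\<^sub>0/A\<close>. The first inclusion gives \<open>pd (soc I\<^sub>0) \<le> 1\<close>, so \<open>I\<^sub>0\<close> is projective. Then
  \<open>0 \<rightarrow> A \<rightarrow> I\<^sub>0 \<rightarrow> I\<^sub>0/A \<rightarrow> 0\<close> shows \<open>pd (I\<^sub>0/A) \<le> 1\<close>, and the second inclusion makes \<open>I\<^sub>1\<close> projective.

  Suppose conversely that \<open>I\<^sub>0\<close> and \<open>I\<^sub>1\<close> are projective, and let \<open>J\<close> be injective with
  \<open>pd (soc J) \<le> 1\<close>. A simple module \<open>S\<close> with \<open>pd S = n\<close> finite has \<open>Ext\<^sup>n(S, A) \<noteq> 0\<close>, hence a nonzero map to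
  \<open>I\<^sub>n\<close>; for the simple summands of \<open>soc J\<close> this happens with \<open>n \<le> 1\<close>. Lemma
  \<open>hom_into_copresentation\<close> is this argument, carried out by hand for an arbitrary nonzero submodule
  of a module of projective dimension at most one. So every nonzero submodule of \<open>J\<close> is detected by
  a map from \<open>J\<close> to \<open>I\<^sub>0\<close> or \<open>I\<^sub>1\<close>, finitely many such maps embed \<open>J\<close> into a projective-injective module
  (lemma \<open>embed_by_cogeneration\<close>), and the embedding splits.

  Three ingredients have to be supplied first. Finiteness arguments use a bounded rank on submodules,
  which replaces dimension and length (\<open>finite_rank\<close>). Minimal injective resolutions by finitely
  generated modules come from the injective cogenerator \<open>Hom\<^sub>K(A, K)\<close> (\<open>injective_dual\<close>,
  \<open>ex_injective_envelope\<close>). Finally, projectivity and injectivity are defined by test modules whose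
  elements are lists; \<open>projective_lift\<close> and \<open>injective_extend\<close> make the lifting properties
  available for finitely generated modules on any type, so that direct sums, kernels and
  quotients can be used freely.
\<close>

section \<open>Homomorphisms and submodules\<close>

lemma (in right_module) ract_minus:
  assumes "a \<in> carrier R" "x \<in> carrier M"
  shows "a \<odot>\<^bsub>M\<^esub> (\<ominus>\<^bsub>M\<^esub> x) = \<ominus>\<^bsub>M\<^esub> (a \<odot>\<^bsub>M\<^esub> x)"
proof -
  have "a \<odot>\<^bsub>M\<^esub> ((\<ominus>\<^bsub>R\<^esub> \<one>\<^bsub>R\<^esub>) \<odot>\<^bsub>M\<^esub> x) = (\<ominus>\<^bsub>R\<^esub> \<one>\<^bsub>R\<^esub>) \<odot>\<^bsub>M\<^esub> (a \<odot>\<^bsub>M\<^esub> x)"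
    using assms by (simp flip: ract_assoc add: R.l_minus R.r_minus)
  then show ?thesis using assms by (simp add: ract_minus_one)
qed

lemma (in right_module) diff_eq_zero [simp]:
  assumes "x \<in> carrier M" "y \<in> carrier M"
  shows "x \<ominus>\<^bsub>M\<^esub> y = \<zero>\<^bsub>M\<^esub> \<longleftrightarrow> x = y"
  using assms M.add.inv_solve_right[of "\<zero>\<^bsub>M\<^esub>" x y] by (auto simp: M.minus_eq M.r_neg)

lemma (in right_module) add_diff_cancel:
  assumes "x \<in> carrier M" "y \<in> carrier M"
  shows "y \<oplus>\<^bsub>M\<^esub> (x \<ominus>\<^bsub>M\<^esub> y) = x"
  using assms by (simp add: M.minus_eq M.a_lcomm[of y x] M.r_neg)

lemma module_homI:
  assumes "\<And>x. x \<in> carrier M \<Longrightarrow> f x \<in> carrier N"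
    and "\<And>x y. x \<in> carrier M \<Longrightarrow> y \<in> carrier M \<Longrightarrow> f (x \<oplus>\<^bsub>M\<^esub> y) = f x \<oplus>\<^bsub>N\<^esub> f y"
    and "\<And>a x. a \<in> carrier R \<Longrightarrow> x \<in> carrier M \<Longrightarrow> f (a \<odot>\<^bsub>M\<^esub> x) = a \<odot>\<^bsub>N\<^esub> f x"
  shows "f \<in> module_hom R M N"
  using assms by (auto simp: module_hom_def)

lemma hom_closed: "f \<in> module_hom R M N \<Longrightarrow> x \<in> carrier M \<Longrightarrow> f x \<in> carrier N"
  by (auto simp: module_hom_def)

lemma hom_add: "f \<in> module_hom R M N \<Longrightarrow> x \<in> carrier M \<Longrightarrow> y \<in> carrier M \<Longrightarrow>
    f (x \<oplus>\<^bsub>M\<^esub> y) = f x \<oplus>\<^bsub>N\<^esub> f y"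
  by (auto simp: module_hom_def)

lemma hom_smult: "f \<in> module_hom R M N \<Longrightarrow> a \<in> carrier R \<Longrightarrow> x \<in> carrier M \<Longrightarrow>
    f (a \<odot>\<^bsub>M\<^esub> x) = a \<odot>\<^bsub>N\<^esub> f x"
  by (auto simp: module_hom_def)

lemma hom_zero:
  assumes "right_module R M" "right_module R N" "f \<in> module_hom R M N"
  shows "f \<zero>\<^bsub>M\<^esub> = \<zero>\<^bsub>N\<^esub>"
proof -
  interpret M: right_module R M by fact
  interpret N: right_module R N by fact
  have "f (\<zero>\<^bsub>R\<^esub> \<odot>\<^bsub>M\<^esub> \<zero>\<^bsub>M\<^esub>) = \<zero>\<^bsub>R\<^esub> \<odot>\<^bsub>N\<^esub> f \<zero>\<^bsub>M\<^esub>"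
    using assms(3) by (intro hom_smult[of f R M N]) auto
  then show ?thesis using hom_closed[OF assms(3)] by simp
qed

lemma hom_minus:
  assumes "right_module R M" "right_module R N" "f \<in> module_hom R M N" "x \<in> carrier M"
  shows "f (\<ominus>\<^bsub>M\<^esub> x) = \<ominus>\<^bsub>N\<^esub> f x"
proof -
  interpret M: right_module R M by fact
  interpret N: right_module R N by fact
  have "f ((\<ominus>\<^bsub>R\<^esub> \<one>\<^bsub>R\<^esub>) \<odot>\<^bsub>M\<^esub> x) = (\<ominus>\<^bsub>R\<^esub> \<one>\<^bsub>R\<^esub>) \<odot>\<^bsub>N\<^esub> f x"
    using assms(3,4) by (intro hom_smult[of f R M N]) auto
  then show ?thesis using hom_closed[OF assms(3)] assms(4)
    by (simp add: M.ract_minus_one N.ract_minus_one)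
qed

lemma hom_diff:
  assumes "right_module R M" "right_module R N" "f \<in> module_hom R M N"
    "x \<in> carrier M" "y \<in> carrier M"
  shows "f (x \<ominus>\<^bsub>M\<^esub> y) = f x \<ominus>\<^bsub>N\<^esub> f y"
proof -
  interpret M: right_module R M by fact
  interpret N: right_module R N by fact
  show ?thesis using assms hom_minus[OF assms(1-3)] by (simp add: a_minus_def hom_add[of f R])
qed

lemma hom_comp:
  "f \<in> module_hom R M N \<Longrightarrow> g \<in> module_hom R N L \<Longrightarrow> (\<lambda>x. g (f x)) \<in> module_hom R M L"
  by (intro module_homI) (auto simp: hom_closed hom_add[of _ R] hom_smult[of _ R])

lemma hom_id: "(\<lambda>x. x) \<in> module_hom R M M"
  by (auto simp: module_hom_def)

lemma hom_cong:
  assumes "f \<in> module_hom R M N" "right_module R M" "\<And>x. x \<in> carrier M \<Longrightarrow> f x = g x"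
  shows "g \<in> module_hom R M N"
proof -
  interpret M: right_module R M by fact
  show ?thesis
    using assms(1) by (intro module_homI) (auto simp: assms(3)[symmetric] hom_closed hom_add[of f R] hom_smult[of f R])
qed

lemma hom_const_zero:
  assumes "right_module R N" shows "(\<lambda>x. \<zero>\<^bsub>N\<^esub>) \<in> module_hom R M N"
proof -
  interpret N: right_module R N by fact
  show ?thesis by (intro module_homI) auto
qed

lemma hom_plus:
  assumes "right_module R N" "f \<in> module_hom R M N" "g \<in> module_hom R M N"
  shows "(\<lambda>x. f x \<oplus>\<^bsub>N\<^esub> g x) \<in> module_hom R M N"
proof -
  interpret N: right_module R N by fact
  show ?thesis using assms(2,3)
    by (intro module_homI)
      (auto simp: hom_closed hom_add[of _ R] hom_smult[of _ R] N.ract_r_distr N.a_ac)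
qed

lemma hom_sub:
  assumes "right_module R M" "right_module R N" "f \<in> module_hom R M N" "g \<in> module_hom R M N"
  shows "(\<lambda>x. f x \<ominus>\<^bsub>N\<^esub> g x) \<in> module_hom R M N"
proof -
  interpret M: right_module R M by fact
  interpret N: right_module R N by fact
  have "(\<lambda>x. f x \<oplus>\<^bsub>N\<^esub> (\<ominus>\<^bsub>R\<^esub> \<one>\<^bsub>R\<^esub>) \<odot>\<^bsub>N\<^esub> g x) \<in> module_hom R M N"
  proof (rule hom_plus[OF assms(2,3)], rule module_homI)
    fix a x assume ax: "a \<in> carrier R" "x \<in> carrier M"
    then have "a \<odot>\<^bsub>N\<^esub> ((\<ominus>\<^bsub>R\<^esub> \<one>\<^bsub>R\<^esub>) \<odot>\<^bsub>N\<^esub> g x) = (\<ominus>\<^bsub>R\<^esub> \<one>\<^bsub>R\<^esub>) \<odot>\<^bsub>N\<^esub> (a \<odot>\<^bsub>N\<^esub> g x)"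
      using hom_closed[OF assms(4)]
      by (simp flip: N.ract_assoc add: M.R.l_minus M.R.r_minus)
    then show "(\<ominus>\<^bsub>R\<^esub> \<one>\<^bsub>R\<^esub>) \<odot>\<^bsub>N\<^esub> g (a \<odot>\<^bsub>M\<^esub> x) = a \<odot>\<^bsub>N\<^esub> ((\<ominus>\<^bsub>R\<^esub> \<one>\<^bsub>R\<^esub>) \<odot>\<^bsub>N\<^esub> g x)"
      using assms(4) ax by (simp add: hom_smult[of _ R])
  qed (use assms(4) in \<open>auto simp: hom_closed hom_add[of _ R] N.ract_r_distr\<close>)
  then show ?thesis
    by (rule hom_cong[OF _ assms(1)]) (use hom_closed[OF assms(4)] in \<open>simp add: N.ract_minus_one a_minus_def\<close>)
qed

lemma hom_inv:
  assumes "right_module R M" "f \<in> module_hom R M N" "bij_betw f (carrier M) (carrier N)"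
  shows "inv_into (carrier M) f \<in> module_hom R N M"
proof -
  interpret M: right_module R M by fact
  let ?g = "inv_into (carrier M) f"
  have g: "?g y \<in> carrier M" "f (?g y) = y" if "y \<in> carrier N" for y
    using that assms(3) by (auto simp: bij_betw_def inv_into_into f_inv_into_f)
  have gI: "?g y = x" if "x \<in> carrier M" "f x = y" for x y
    using that assms(3) by (auto simp: bij_betw_def inv_into_f_f)
  show ?thesis
    by (rule module_homI)
      (auto intro!: gI simp: g hom_add[OF assms(2)] hom_smult[OF assms(2)])
qed

lemma hom_inj_onI:
  assumes "right_module R M" "right_module R N" "f \<in> module_hom R M N"
    and "\<And>x. x \<in> carrier M \<Longrightarrow> f x = \<zero>\<^bsub>N\<^esub> \<Longrightarrow> x = \<zero>\<^bsub>M\<^esub>"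
  shows "inj_on f (carrier M)"
proof (rule inj_onI)
  interpret M: right_module R M by fact
  interpret N: right_module R N by fact
  fix x y assume xy: "x \<in> carrier M" "y \<in> carrier M" "f x = f y"
  then have "f (x \<ominus>\<^bsub>M\<^esub> y) = \<zero>\<^bsub>N\<^esub>"
    using hom_closed[OF assms(3)] by (simp add: hom_diff[OF assms(1-3)])
  then have "x \<ominus>\<^bsub>M\<^esub> y = \<zero>\<^bsub>M\<^esub>" using assms(4) xy by simp
  then show "x = y" using xy by simp
qed

lemma hom_inj_zero:
  assumes "right_module R M" "right_module R N" "f \<in> module_hom R M N"
    and "inj_on f (carrier M)" "x \<in> carrier M" "f x = \<zero>\<^bsub>N\<^esub>"
  shows "x = \<zero>\<^bsub>M\<^esub>"
proof -
  interpret M: right_module R M by fact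
  show ?thesis using assms(4-6) hom_zero[OF assms(1-3)] by (auto dest: inj_onD[of _ _ x "\<zero>\<^bsub>M\<^esub>"])
qed

lemma submodule_subset: "submodule H R M \<Longrightarrow> x \<in> H \<Longrightarrow> x \<in> carrier M"
  using subgroup.mem_carrier[of H "add_monoid M"] by (auto simp: submodule_def)

lemma submodule_zero: "submodule H R M \<Longrightarrow> \<zero>\<^bsub>M\<^esub> \<in> H"
  using subgroup.one_closed[of H "add_monoid M"] by (auto simp: submodule_def)

lemma submodule_add: "submodule H R M \<Longrightarrow> x \<in> H \<Longrightarrow> y \<in> H \<Longrightarrow> x \<oplus>\<^bsub>M\<^esub> y \<in> H"
  using subgroup.m_closed[of H "add_monoid M"] by (auto simp: submodule_def)

lemma submodule_smult: "submodule H R M \<Longrightarrow> a \<in> carrier R \<Longrightarrow> x \<in> H \<Longrightarrow> a \<odot>\<^bsub>M\<^esub> x \<in> H"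
  by (rule submodule.smult_closed)

lemma submodule_minus: "submodule H R M \<Longrightarrow> x \<in> H \<Longrightarrow> \<ominus>\<^bsub>M\<^esub> x \<in> H"
  using subgroup.m_inv_closed[of H "add_monoid M" x] by (auto simp: submodule_def a_inv_def)

lemma submodule_diff: "submodule H R M \<Longrightarrow> x \<in> H \<Longrightarrow> y \<in> H \<Longrightarrow> x \<ominus>\<^bsub>M\<^esub> y \<in> H"
  by (simp add: a_minus_def submodule_add submodule_minus)

lemma submodule_iff:
  assumes "right_module R M"
  shows "submodule H R M \<longleftrightarrow> H \<subseteq> carrier M \<and> \<zero>\<^bsub>M\<^esub> \<in> H \<and> (\<forall>x\<in>H. \<forall>y\<in>H. x \<oplus>\<^bsub>M\<^esub> y \<in> H) \<and>
    (\<forall>a\<in>carrier R. \<forall>x\<in>H. a \<odot>\<^bsub>M\<^esub> x \<in> H)"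
  using right_module.right_submoduleI[OF assms, of H]
  by (auto dest: submodule_subset submodule_zero submodule_add submodule_smult)

abbreviation submod :: "('a, 'm) module \<Rightarrow> 'm set \<Rightarrow> ('a, 'm) module" where
  "submod M H \<equiv> M\<lparr>carrier := H\<rparr>"

lemma right_module_submod:
  assumes "right_module R M" "submodule H R M"
  shows "right_module R (submod M H)"
proof -
  interpret M: right_module R M by fact
  note H = submodule_subset[OF assms(2)] submodule_zero[OF assms(2)] submodule_add[OF assms(2)]
    submodule_smult[OF assms(2)] submodule_minus[OF assms(2)]
  have "abelian_group (submod M H)"
  proof (rule abelian_groupI)
    fix x assume "x \<in> carrier (submod M H)"
    then show "\<exists>y\<in>carrier (submod M H). y \<oplus>\<^bsub>submod M H\<^esub> x = \<zero>\<^bsub>submod M H\<^esub>"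
      by (intro bexI[of _ "\<ominus>\<^bsub>M\<^esub> x"]) (auto simp: H M.l_neg)
  qed (auto simp: H M.a_ac)
  then show ?thesis
    by (intro right_module.intro right_module_axioms.intro M.R.ring_axioms)
      (auto simp: H M.ract_l_distr M.ract_r_distr M.ract_assoc)
qed

lemma submodule_of_submod:
  assumes "right_module R M" "submodule H R M"
  shows "submodule T R (submod M H) \<longleftrightarrow> submodule T R M \<and> T \<subseteq> H"
proof -
  have "H \<subseteq> carrier M" using assms(2) by (auto dest: submodule_subset)
  then show ?thesis
    unfolding submodule_iff[OF right_module_submod[OF assms]] submodule_iff[OF assms(1)] by auto
qed

lemma submodule_carrier: "right_module R M \<Longrightarrow> submodule (carrier M) R M"
proof -
  assume "right_module R M"
  then interpret M: right_module R M .
  show ?thesis by (intro M.right_submoduleI) auto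
qed

lemma submodule_trivial: "right_module R M \<Longrightarrow> submodule {\<zero>\<^bsub>M\<^esub>} R M"
proof -
  assume "right_module R M"
  then interpret M: right_module R M .
  show ?thesis by (intro M.right_submoduleI) auto
qed

lemma submodule_inter:
  assumes "right_module R M" "submodule H R M" "submodule T R M"
  shows "submodule (H \<inter> T) R M"
  using assms(2,3) unfolding submodule_iff[OF assms(1)] by blast

lemma hom_submod_incl: "submodule H R M \<Longrightarrow> (\<lambda>x. x) \<in> module_hom R (submod M H) M"
  by (auto simp: module_hom_def dest: submodule_subset)

lemma hom_restrict:
  "f \<in> module_hom R M N \<Longrightarrow> submodule H R M \<Longrightarrow> f \<in> module_hom R (submod M H) N"
  by (intro module_homI) (auto simp: submodule_subset hom_closed hom_add[of _ R] hom_smult[of _ R])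

lemma hom_corestrict:
  "f \<in> module_hom R M N \<Longrightarrow> (\<And>x. x \<in> carrier M \<Longrightarrow> f x \<in> H) \<Longrightarrow> f \<in> module_hom R M (submod N H)"
  by (auto simp: module_hom_def)

lemma submodule_image:
  assumes "right_module R M" "right_module R N" "f \<in> module_hom R M N" "submodule H R M"
  shows "submodule (f ` H) R N"
proof -
  interpret M: right_module R M by fact
  interpret N: right_module R N by fact
  note H = submodule_subset[OF assms(4)]
  show ?thesis
  proof (rule N.right_submoduleI)
    show "f ` H \<subseteq> carrier N" using hom_closed[OF assms(3)] H by auto
    show "\<zero>\<^bsub>N\<^esub> \<in> f ` H"
      using submodule_zero[OF assms(4)] hom_zero[OF assms(1-3)] by (metis image_eqI)
    show "x \<oplus>\<^bsub>N\<^esub> y \<in> f ` H" if xy: "x \<in> f ` H" "y \<in> f ` H" for x y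
    proof -
      from xy obtain u v where uv: "u \<in> H" "v \<in> H" "x = f u" "y = f v" by auto
      then have "f (u \<oplus>\<^bsub>M\<^esub> v) = x \<oplus>\<^bsub>N\<^esub> y" by (simp add: hom_add[OF assms(3)] H)
      then show ?thesis using submodule_add[OF assms(4) uv(1,2)] by (metis image_eqI)
    qed
    show "a \<odot>\<^bsub>N\<^esub> x \<in> f ` H" if ax: "a \<in> carrier R" "x \<in> f ` H" for a x
    proof -
      from ax obtain u where u: "u \<in> H" "x = f u" by auto
      then have "f (a \<odot>\<^bsub>M\<^esub> u) = a \<odot>\<^bsub>N\<^esub> x" using ax by (simp add: hom_smult[OF assms(3)] H)
      then show ?thesis using submodule_smult[OF assms(4) ax(1) u(1)] by (metis image_eqI)
    qed
  qed
qed

lemma submodule_vimage: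
  assumes "right_module R M" "right_module R N" "f \<in> module_hom R M N" "submodule H R N"
  shows "submodule {x \<in> carrier M. f x \<in> H} R M"
proof -
  interpret M: right_module R M by fact
  show ?thesis
    using submodule_zero[OF assms(4)] submodule_add[OF assms(4)] submodule_smult[OF assms(4)]
    by (intro M.right_submoduleI)
      (auto simp: hom_zero[OF assms(1-3)] hom_add[OF assms(3)] hom_smult[OF assms(3)])
qed

lemma submodule_kernel:
  assumes "right_module R M" "right_module R N" "f \<in> module_hom R M N"
  shows "submodule (module_kernel M N f) R M"
  using submodule_vimage[OF assms submodule_trivial[OF assms(2)]] by (simp add: module_kernel_def)

lemma in_module_kernel: "x \<in> module_kernel M N f \<longleftrightarrow> x \<in> carrier M \<and> f x = \<zero>\<^bsub>N\<^esub>"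
  by (simp add: module_kernel_def)

text \<open>
  The homomorphism theorem. It speaks about an arbitrary surjection \<open>q\<close>, so that no particular
  model of the quotient module enters.
\<close>

lemma hom_factor:
  assumes M: "right_module R M" and N: "right_module R N" and L: "right_module R L"
    and q: "q \<in> module_hom R M N" and surj: "q ` carrier M = carrier N"
    and f: "f \<in> module_hom R M L"
    and ker: "\<And>x. x \<in> carrier M \<Longrightarrow> q x = \<zero>\<^bsub>N\<^esub> \<Longrightarrow> f x = \<zero>\<^bsub>L\<^esub>"
  obtains u where "u \<in> module_hom R N L" "\<And>x. x \<in> carrier M \<Longrightarrow> u (q x) = f x"
proof -
  interpret M: right_module R M by fact
  interpret N: right_module R N by fact
  interpret L: right_module R L by fact
  have eq: "f x = f y" if xy: "x \<in> carrier M" "y \<in> carrier M" "q x = q y" for x y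
  proof -
    have "q (x \<ominus>\<^bsub>M\<^esub> y) = \<zero>\<^bsub>N\<^esub>"
      using xy hom_closed[OF q] by (simp add: hom_diff[OF M N q])
    then have "f x \<ominus>\<^bsub>L\<^esub> f y = \<zero>\<^bsub>L\<^esub>" using ker xy by (simp flip: hom_diff[OF M L f])
    then show ?thesis using xy hom_closed[OF f] by simp
  qed
  define g where "g = inv_into (carrier M) q"
  have g: "g z \<in> carrier M" "q (g z) = z" if "z \<in> carrier N" for z
    using that by (auto simp: g_def inv_into_into f_inv_into_f surj)
  have u: "f (g (q x)) = f x" if "x \<in> carrier M" for x
    using that hom_closed[OF q] by (intro eq) (auto simp: g)
  have "(\<lambda>z. f (g z)) \<in> module_hom R N L"
  proof (rule module_homI)
    fix x y assume xy: "x \<in> carrier N" "y \<in> carrier N"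
    have "f (g (x \<oplus>\<^bsub>N\<^esub> y)) = f (g (q (g x \<oplus>\<^bsub>M\<^esub> g y)))" using xy by (simp add: g hom_add[OF q])
    then show "f (g (x \<oplus>\<^bsub>N\<^esub> y)) = f (g x) \<oplus>\<^bsub>L\<^esub> f (g y)" using xy by (simp add: g u hom_add[OF f])
  next
    fix a x assume ax: "a \<in> carrier R" "x \<in> carrier N"
    have "f (g (a \<odot>\<^bsub>N\<^esub> x)) = f (g (q (a \<odot>\<^bsub>M\<^esub> g x)))" using ax by (simp add: g hom_smult[OF q])
    then show "f (g (a \<odot>\<^bsub>N\<^esub> x)) = a \<odot>\<^bsub>L\<^esub> f (g x)" using ax by (simp add: g u hom_smult[OF f])
  qed (auto simp: g hom_closed[OF f])
  then show ?thesis using u that by blast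
qed

section \<open>Finitely generated modules\<close>

definition fg_module :: "('a, 'r) ring_scheme \<Rightarrow> ('a, 'm) module \<Rightarrow> bool" where
  "fg_module R M \<longleftrightarrow> right_module R M \<and> finitely_generated R M"

lemma mod_cat_iff: "M \<in> mod_cat R \<longleftrightarrow> fg_module R M"
  by (simp add: mod_cat_def fg_module_def)

lemma fg_right_module: "fg_module R M \<Longrightarrow> right_module R M"
  by (simp add: fg_module_def)

lemma span_submodule:
  assumes "right_module R M" "B \<subseteq> carrier M"
  shows "submodule (submodule_span R M B) R M"
  unfolding submodule_iff[OF assms(1)] submodule_span_def
  using submodule_carrier[OF assms(1)] assms(2)
  by (auto intro: submodule_zero submodule_add submodule_smult)

lemma span_incl: "B \<subseteq> submodule_span R M B"
  by (auto simp: submodule_span_def)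

lemma span_least: "submodule H R M \<Longrightarrow> B \<subseteq> H \<Longrightarrow> submodule_span R M B \<subseteq> H"
  by (auto simp: submodule_span_def)

lemma fg_moduleI:
  assumes "right_module R M" "finite B" "B \<subseteq> carrier M"
    and "\<And>H. submodule H R M \<Longrightarrow> B \<subseteq> H \<Longrightarrow> carrier M \<subseteq> H"
  shows "fg_module R M"
proof -
  have "submodule_span R M B = carrier M"
  proof
    show "submodule_span R M B \<subseteq> carrier M"
      using assms(1,3) by (intro span_least submodule_carrier)
    show "carrier M \<subseteq> submodule_span R M B"
      using assms by (intro assms(4) span_submodule span_incl)
  qed
  then show ?thesis using assms unfolding fg_module_def finitely_generated_def by blast
qed

lemma fg_moduleE:
  assumes "fg_module R M"
  obtains B where "finite B" "B \<subseteq> carrier M"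
    "\<And>H. submodule H R M \<Longrightarrow> B \<subseteq> H \<Longrightarrow> carrier M \<subseteq> H"
proof -
  obtain B where B: "finite B" "B \<subseteq> carrier M" "submodule_span R M B = carrier M"
    using assms unfolding fg_module_def finitely_generated_def by blast
  show ?thesis using span_least[of _ R M B] by (intro that[OF B(1,2)]) (simp add: B(3))
qed

lemma fg_surj:
  assumes M: "fg_module R M" and N: "right_module R N"
    and f: "f \<in> module_hom R M N" and surj: "f ` carrier M = carrier N"
  shows "fg_module R N"
proof -
  obtain B where B: "finite B" "B \<subseteq> carrier M"
    "\<And>H. submodule H R M \<Longrightarrow> B \<subseteq> H \<Longrightarrow> carrier M \<subseteq> H"
    using fg_moduleE[OF M] by blast
  show ?thesis
  proof (rule fg_moduleI[OF N, of "f ` B"])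
    fix H assume H: "submodule H R N" "f ` B \<subseteq> H"
    have "carrier M \<subseteq> {x \<in> carrier M. f x \<in> H}"
      using B H by (intro B(3) submodule_vimage[OF fg_right_module[OF M] N f]) auto
    then show "carrier N \<subseteq> H" unfolding surj[symmetric] by blast
  qed (use B f in \<open>auto simp: hom_closed\<close>)
qed

text \<open>
  Mutually inverse isomorphisms, named explicitly because almost every use moves elements and maps
  back and forth between a module and its copy in \<^const>\<open>mod_cat\<close>.
\<close>

definition inverse_homs ::
    "('a, 'r) ring_scheme \<Rightarrow> ('a, 'm) module \<Rightarrow> ('a, 'n) module \<Rightarrow> ('m \<Rightarrow> 'n) \<Rightarrow> ('n \<Rightarrow> 'm) \<Rightarrow> bool" where
  "inverse_homs R M N i j \<longleftrightarrow> i \<in> module_hom R M N \<and> j \<in> module_hom R N M \<and>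
     (\<forall>x\<in>carrier M. j (i x) = x) \<and> (\<forall>y\<in>carrier N. i (j y) = y)"

lemma inverse_homsD:
  assumes "inverse_homs R M N i j"
  shows "i \<in> module_hom R M N" "j \<in> module_hom R N M"
    "x \<in> carrier M \<Longrightarrow> j (i x) = x" "y \<in> carrier N \<Longrightarrow> i (j y) = y"
  using assms by (auto simp: inverse_homs_def)

lemma inverse_homs_inv:
  assumes "right_module R M" "f \<in> module_hom R M N" "bij_betw f (carrier M) (carrier N)"
  shows "inverse_homs R M N f (inv_into (carrier M) f)"
  using assms hom_inv[OF assms] by (auto simp: inverse_homs_def bij_betw_def f_inv_into_f)

lemma fg_ex_iso:
  assumes "fg_module R M"
  obtains N i j where "N \<in> mod_cat R" "inverse_homs R M N i j"
proof -
  have "\<exists>N\<in>mod_cat R. module_iso R M N"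
    using assms by (intro right_module.ex_iso_mod_cat) (auto simp: fg_module_def)
  then obtain N i where N: "N \<in> mod_cat R" "i \<in> module_hom R M N" "bij_betw i (carrier M) (carrier N)"
    unfolding module_iso_def by blast
  show ?thesis
    by (rule that[OF N(1) inverse_homs_inv[OF fg_right_module[OF assms] N(2,3)]])
qed

section \<open>Quotients and direct sums\<close>

text \<open>
  The cosets form a module on the type of sets; its copy in \<^const>\<open>mod_cat\<close> hides this choice, and only
  the projection and its kernel are used later.
\<close>

lemma ex_quotient:
  fixes M :: "('a, 'm) module"
  assumes fg: "fg_module R M" and H: "submodule H R M"
  obtains Q q where "Q \<in> mod_cat R" "q \<in> module_hom R M Q" "q ` carrier M = carrier Q"
    "module_kernel M Q q = H"
proof -
  have M: "right_module R M" using fg by (rule fg_right_module)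
  interpret M: right_module R M by fact
  note Hs = submodule_subset[OF H]
  define f where "f x = {y \<in> carrier M. y \<ominus>\<^bsub>M\<^esub> x \<in> H}" for x
  have f_eq: "f x = f y \<longleftrightarrow> x \<ominus>\<^bsub>M\<^esub> y \<in> H" if xy: "x \<in> carrier M" "y \<in> carrier M" for x y
  proof
    assume "f x = f y"
    moreover have "x \<ominus>\<^bsub>M\<^esub> x = \<zero>\<^bsub>M\<^esub>" using xy by simp
    then have "x \<in> f x"
      using xy submodule_zero[OF H] by (simp add: f_def del: M.diff_eq_zero)
    ultimately show "x \<ominus>\<^bsub>M\<^esub> y \<in> H" by (simp add: f_def)
  next
    assume d: "x \<ominus>\<^bsub>M\<^esub> y \<in> H"
    have le: "f u \<subseteq> f v"
      if uv: "u \<in> carrier M" "v \<in> carrier M" "u \<ominus>\<^bsub>M\<^esub> v \<in> H" for u v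
    proof
      fix z assume "z \<in> f u"
      then have z: "z \<in> carrier M" "z \<ominus>\<^bsub>M\<^esub> u \<in> H" by (auto simp: f_def)
      have "z \<ominus>\<^bsub>M\<^esub> v = (z \<ominus>\<^bsub>M\<^esub> u) \<oplus>\<^bsub>M\<^esub> (u \<ominus>\<^bsub>M\<^esub> v)"
        using uv z by (simp add: a_minus_def M.a_assoc M.r_neg1)
      then show "z \<in> f v" using z uv submodule_add[OF H z(2) uv(3)] by (simp add: f_def)
    qed
    have "y \<ominus>\<^bsub>M\<^esub> x = \<ominus>\<^bsub>M\<^esub> (x \<ominus>\<^bsub>M\<^esub> y)"
      using xy by (simp add: a_minus_def M.minus_add M.a_comm)
    then have "y \<ominus>\<^bsub>M\<^esub> x \<in> H" using submodule_minus[OF H d] by simp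
    then show "f x = f y" using le xy d by (intro equalityI) auto
  qed
  define g where "g = inv_into (carrier M) f"
  define N :: "('a, 'm set) module" where
    "N = \<lparr>carrier = f ` carrier M, monoid.mult = undefined, one = undefined, ring.zero = f \<zero>\<^bsub>M\<^esub>,
      ring.add = (\<lambda>u v. f (g u \<oplus>\<^bsub>M\<^esub> g v)), smult = (\<lambda>a u. f (a \<odot>\<^bsub>M\<^esub> g u))\<rparr>"
  have g: "g (f x) \<in> carrier M" "f (g (f x)) = f x" if "x \<in> carrier M" for x
    using that by (auto simp: g_def inv_into_into f_inv_into_f)
  have gd: "g (f x) \<ominus>\<^bsub>M\<^esub> x \<in> H" if "x \<in> carrier M" for x
    using f_eq[of "g (f x)" x] g that by simp
  have add: "f (g (f x) \<oplus>\<^bsub>M\<^esub> g (f y)) = f (x \<oplus>\<^bsub>M\<^esub> y)" if xy: "x \<in> carrier M" "y \<in> carrier M" for x y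
  proof -
    have "(g (f x) \<oplus>\<^bsub>M\<^esub> g (f y)) \<ominus>\<^bsub>M\<^esub> (x \<oplus>\<^bsub>M\<^esub> y) = (g (f x) \<ominus>\<^bsub>M\<^esub> x) \<oplus>\<^bsub>M\<^esub> (g (f y) \<ominus>\<^bsub>M\<^esub> y)"
      using xy g by (simp add: a_minus_def M.minus_add M.a_ac)
    then show ?thesis using xy gd submodule_add[OF H] by (subst f_eq) (auto simp: g)
  qed
  have smult: "f (a \<odot>\<^bsub>M\<^esub> g (f x)) = f (a \<odot>\<^bsub>M\<^esub> x)" if ax: "a \<in> carrier R" "x \<in> carrier M" for a x
  proof -
    have "a \<odot>\<^bsub>M\<^esub> (g (f x) \<ominus>\<^bsub>M\<^esub> x) = a \<odot>\<^bsub>M\<^esub> g (f x) \<oplus>\<^bsub>M\<^esub> a \<odot>\<^bsub>M\<^esub> (\<ominus>\<^bsub>M\<^esub> x)"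
      using ax g by (simp add: a_minus_def M.ract_r_distr)
    also have "a \<odot>\<^bsub>M\<^esub> (\<ominus>\<^bsub>M\<^esub> x) = \<ominus>\<^bsub>M\<^esub> (a \<odot>\<^bsub>M\<^esub> x)" using ax by (rule M.ract_minus)
    finally have "(a \<odot>\<^bsub>M\<^esub> g (f x)) \<ominus>\<^bsub>M\<^esub> (a \<odot>\<^bsub>M\<^esub> x) = a \<odot>\<^bsub>M\<^esub> (g (f x) \<ominus>\<^bsub>M\<^esub> x)"
      by (simp add: a_minus_def)
    then show ?thesis using ax gd submodule_smult[OF H] by (subst f_eq) (auto simp: g)
  qed
  have N [simp]: "carrier N = f ` carrier M" "\<zero>\<^bsub>N\<^esub> = f \<zero>\<^bsub>M\<^esub>"
    by (simp_all add: N_def)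
  have N_add [simp]: "f x \<oplus>\<^bsub>N\<^esub> f y = f (x \<oplus>\<^bsub>M\<^esub> y)" if "x \<in> carrier M" "y \<in> carrier M" for x y
    using add[OF that] by (simp add: N_def)
  have N_smult [simp]: "a \<odot>\<^bsub>N\<^esub> f x = f (a \<odot>\<^bsub>M\<^esub> x)" if "a \<in> carrier R" "x \<in> carrier M" for a x
    using smult[OF that] by (simp add: N_def)
  have "abelian_group N"
  proof (rule abelian_groupI)
    fix u assume "u \<in> carrier N"
    then obtain x where x: "x \<in> carrier M" "u = f x" by auto
    then show "\<exists>v\<in>carrier N. v \<oplus>\<^bsub>N\<^esub> u = \<zero>\<^bsub>N\<^esub>"
      by (intro bexI[of _ "f (\<ominus>\<^bsub>M\<^esub> x)"]) (auto simp: M.l_neg)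
  qed (auto simp: M.a_ac)
  then have Nm: "right_module R N"
    by (intro right_module.intro right_module_axioms.intro M.R.ring_axioms)
      (auto simp: M.ract_l_distr M.ract_r_distr M.ract_assoc)
  have fh: "f \<in> module_hom R M N" by (intro module_homI) auto
  have "fg_module R N" by (rule fg_surj[OF fg Nm fh]) simp
  then obtain Q i j where Q0: "Q \<in> mod_cat R" "inverse_homs R N Q i j"
    using fg_ex_iso by blast
  note Q = Q0(1) inverse_homsD[OF Q0(2)]
  have Qm: "right_module R Q" using Q(1) by (simp add: mod_cat_def)
  have "i (f x) = \<zero>\<^bsub>Q\<^esub> \<longleftrightarrow> x \<in> H" if x: "x \<in> carrier M" for x
  proof -
    have "i (f x) = \<zero>\<^bsub>Q\<^esub> \<longleftrightarrow> f x = \<zero>\<^bsub>N\<^esub>"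
      using hom_zero[OF Nm Qm Q(2)] hom_zero[OF Qm Nm Q(3)] Q(4)[OF hom_closed[OF fh x]] by metis
    also have "\<dots> \<longleftrightarrow> x \<in> H"
      using x M.ract_minus_one[of "\<zero>\<^bsub>M\<^esub>"] by (simp add: f_eq a_minus_def)
    finally show ?thesis .
  qed
  then have ker: "module_kernel M Q (\<lambda>x. i (f x)) = H"
    using Hs by (auto simp: module_kernel_def)
  have surj: "(\<lambda>x. i (f x)) ` carrier M = carrier Q"
  proof
    show "(\<lambda>x. i (f x)) ` carrier M \<subseteq> carrier Q" using hom_closed[OF hom_comp[OF fh Q(2)]] by auto
    show "carrier Q \<subseteq> (\<lambda>x. i (f x)) ` carrier M"
    proof
      fix y assume y: "y \<in> carrier Q"
      obtain x where "x \<in> carrier M" "j y = f x" using hom_closed[OF Q(3) y] by auto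
      then show "y \<in> (\<lambda>x. i (f x)) ` carrier M" using Q(5)[OF y] by (metis image_eqI)
    qed
  qed
  show ?thesis by (rule that[OF Q(1) hom_comp[OF fh Q(2)] surj ker])
qed

definition direct_sum :: "('a, 'm) module \<Rightarrow> ('a, 'n) module \<Rightarrow> ('a, 'm \<times> 'n) module" where
  "direct_sum M N = \<lparr>carrier = carrier M \<times> carrier N, monoid.mult = undefined, one = undefined,
     ring.zero = (\<zero>\<^bsub>M\<^esub>, \<zero>\<^bsub>N\<^esub>), ring.add = (\<lambda>x y. (fst x \<oplus>\<^bsub>M\<^esub> fst y, snd x \<oplus>\<^bsub>N\<^esub> snd y)),
     smult = (\<lambda>a x. (a \<odot>\<^bsub>M\<^esub> fst x, a \<odot>\<^bsub>N\<^esub> snd x))\<rparr>"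

lemma direct_sum_simps [simp]:
  "carrier (direct_sum M N) = carrier M \<times> carrier N" "\<zero>\<^bsub>direct_sum M N\<^esub> = (\<zero>\<^bsub>M\<^esub>, \<zero>\<^bsub>N\<^esub>)"
  "x \<oplus>\<^bsub>direct_sum M N\<^esub> y = (fst x \<oplus>\<^bsub>M\<^esub> fst y, snd x \<oplus>\<^bsub>N\<^esub> snd y)"
  "a \<odot>\<^bsub>direct_sum M N\<^esub> x = (a \<odot>\<^bsub>M\<^esub> fst x, a \<odot>\<^bsub>N\<^esub> snd x)"
  by (simp_all add: direct_sum_def)

lemma right_module_direct_sum:
  assumes "right_module R M" "right_module R N"
  shows "right_module R (direct_sum M N)"
proof -
  interpret M: right_module R M by fact
  interpret N: right_module R N by fact
  have "abelian_group (direct_sum M N)"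
  proof (rule abelian_groupI)
    fix x assume "x \<in> carrier (direct_sum M N)"
    then show "\<exists>y\<in>carrier (direct_sum M N). y \<oplus>\<^bsub>direct_sum M N\<^esub> x = \<zero>\<^bsub>direct_sum M N\<^esub>"
      by (intro bexI[of _ "(\<ominus>\<^bsub>M\<^esub> fst x, \<ominus>\<^bsub>N\<^esub> snd x)"]) (auto simp: M.l_neg N.l_neg)
  qed (auto simp: M.a_ac N.a_ac)
  then show ?thesis
    by (intro right_module.intro right_module_axioms.intro M.R.ring_axioms)
      (auto simp: M.ract_l_distr M.ract_r_distr M.ract_assoc N.ract_l_distr N.ract_r_distr N.ract_assoc)
qed

lemma hom_fst: "fst \<in> module_hom R (direct_sum M N) M" and hom_snd: "snd \<in> module_hom R (direct_sum M N) N"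
  by (auto intro!: module_homI)

lemma hom_pair: "f \<in> module_hom R L M \<Longrightarrow> g \<in> module_hom R L N \<Longrightarrow>
    (\<lambda>x. (f x, g x)) \<in> module_hom R L (direct_sum M N)"
  by (auto intro!: module_homI simp: hom_closed hom_add[of _ R] hom_smult[of _ R])

lemma hom_copair:
  assumes "right_module R L" "f \<in> module_hom R M L" "g \<in> module_hom R N L"
  shows "(\<lambda>x. f (fst x) \<oplus>\<^bsub>L\<^esub> g (snd x)) \<in> module_hom R (direct_sum M N) L"
  by (intro hom_plus assms hom_comp[OF hom_fst] hom_comp[OF hom_snd])

lemma fg_direct_sum:
  assumes M: "fg_module R M" and N: "fg_module R N"
  shows "fg_module R (direct_sum M N)"
proof -
  interpret M: right_module R M using M by (rule fg_right_module)
  interpret N: right_module R N using N by (rule fg_right_module)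
  note mods = M.right_module_axioms N.right_module_axioms
  have D: "right_module R (direct_sum M N)" by (intro right_module_direct_sum mods)
  obtain B where B: "finite B" "B \<subseteq> carrier M"
    "\<And>H. submodule H R M \<Longrightarrow> B \<subseteq> H \<Longrightarrow> carrier M \<subseteq> H"
    using fg_moduleE[OF M] by blast
  obtain C where C: "finite C" "C \<subseteq> carrier N"
    "\<And>H. submodule H R N \<Longrightarrow> C \<subseteq> H \<Longrightarrow> carrier N \<subseteq> H"
    using fg_moduleE[OF N] by blast
  have i: "(\<lambda>x. (x, \<zero>\<^bsub>N\<^esub>)) \<in> module_hom R M (direct_sum M N)"
    by (intro hom_pair hom_id hom_const_zero mods)
  have j: "(\<lambda>y. (\<zero>\<^bsub>M\<^esub>, y)) \<in> module_hom R N (direct_sum M N)"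
    by (intro hom_pair hom_id hom_const_zero mods)
  show ?thesis
  proof (rule fg_moduleI[OF D, of "(\<lambda>x. (x, \<zero>\<^bsub>N\<^esub>)) ` B \<union> (\<lambda>y. (\<zero>\<^bsub>M\<^esub>, y)) ` C"])
    fix H assume H: "submodule H R (direct_sum M N)" "(\<lambda>x. (x, \<zero>\<^bsub>N\<^esub>)) ` B \<union> (\<lambda>y. (\<zero>\<^bsub>M\<^esub>, y)) ` C \<subseteq> H"
    have 1: "carrier M \<subseteq> {x \<in> carrier M. (x, \<zero>\<^bsub>N\<^esub>) \<in> H}"
      using B H by (intro B(3) submodule_vimage[OF mods(1) D i]) auto
    have 2: "carrier N \<subseteq> {y \<in> carrier N. (\<zero>\<^bsub>M\<^esub>, y) \<in> H}"
      using C H by (intro C(3) submodule_vimage[OF mods(2) D j]) auto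
    show "carrier (direct_sum M N) \<subseteq> H"
    proof
      fix z assume z: "z \<in> carrier (direct_sum M N)"
      then have "(fst z, \<zero>\<^bsub>N\<^esub>) \<oplus>\<^bsub>direct_sum M N\<^esub> (\<zero>\<^bsub>M\<^esub>, snd z) \<in> H"
        using 1 2 by (intro submodule_add[OF H(1)]) auto
      then show "z \<in> H" using z by auto
    qed
  qed (use B C in auto)
qed

section \<open>Projective and injective modules\<close>

lemma projective_lift:
  assumes P: "projective_module R P" and M: "fg_module R M" and N: "right_module R N"
    and g: "g \<in> module_hom R M N" "g ` carrier M = carrier N" and f: "f \<in> module_hom R P N"
  obtains h where "h \<in> module_hom R P M" "\<And>x. x \<in> carrier P \<Longrightarrow> g (h x) = f x"
proof -
  have N': "fg_module R N" using M N g by (rule fg_surj)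
  obtain M1 i j where M10: "M1 \<in> mod_cat R" "inverse_homs R M M1 i j"
    using fg_ex_iso[OF M] by blast
  note M1 = M10(1) inverse_homsD[OF M10(2)]
  obtain N1 k l where N10: "N1 \<in> mod_cat R" "inverse_homs R N N1 k l"
    using fg_ex_iso[OF N'] by blast
  note N1 = N10(1) inverse_homsD[OF N10(2)]
  have kgj: "(\<lambda>x. k (g (j x))) \<in> module_hom R M1 N1"
    by (rule hom_comp[OF hom_comp[OF M1(3) g(1)] N1(2)])
  have "(\<lambda>x. k (g (j x))) ` carrier M1 = carrier N1"
  proof
    show "(\<lambda>x. k (g (j x))) ` carrier M1 \<subseteq> carrier N1" using hom_closed[OF kgj] by auto
    show "carrier N1 \<subseteq> (\<lambda>x. k (g (j x))) ` carrier M1"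
    proof
      fix y assume y: "y \<in> carrier N1"
      then obtain x where x: "x \<in> carrier M" "l y = g x" using hom_closed[OF N1(3)] g(2) by blast
      then have "y = k (g (j (i x)))" using N1(5)[OF y] M1(4) by simp
      then show "y \<in> (\<lambda>x. k (g (j x))) ` carrier M1" using hom_closed[OF M1(2) x(1)] by blast
    qed
  qed
  then obtain h where h: "h \<in> module_hom R P M1" "\<forall>x\<in>carrier P. k (g (j (h x))) = k (f x)"
    using P[unfolded projective_module_def, rule_format, OF M1(1) N1(1) kgj hom_comp[OF f N1(2)]] by auto
  have "g (j (h x)) = f x" if x: "x \<in> carrier P" for x
    using h(2) x N1(4)[OF hom_closed[OF f x]]
      N1(4)[OF hom_closed[OF g(1) hom_closed[OF M1(3) hom_closed[OF h(1) x]]]] by metis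
  then show ?thesis using that[OF hom_comp[OF h(1) M1(3)]] by simp
qed

lemma injective_extend:
  assumes I: "injective_module R I" and M: "fg_module R M" and N: "fg_module R N"
    and g: "g \<in> module_hom R M N" "inj_on g (carrier M)" and f: "f \<in> module_hom R M I"
  obtains h where "h \<in> module_hom R N I" "\<And>x. x \<in> carrier M \<Longrightarrow> h (g x) = f x"
proof -
  obtain M1 i j where M10: "M1 \<in> mod_cat R" "inverse_homs R M M1 i j"
    using fg_ex_iso[OF M] by blast
  note M1 = M10(1) inverse_homsD[OF M10(2)]
  obtain N1 k l where N10: "N1 \<in> mod_cat R" "inverse_homs R N N1 k l"
    using fg_ex_iso[OF N] by blast
  note N1 = N10(1) inverse_homsD[OF N10(2)]
  have kgj: "(\<lambda>x. k (g (j x))) \<in> module_hom R M1 N1"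
    by (rule hom_comp[OF hom_comp[OF M1(3) g(1)] N1(2)])
  have "inj_on (\<lambda>x. k (g (j x))) (carrier M1)"
  proof (rule inj_onI)
    fix x y assume xy: "x \<in> carrier M1" "y \<in> carrier M1" "k (g (j x)) = k (g (j y))"
    have "g (j x) = g (j y)"
      using xy(3) N1(4) hom_closed[OF g(1) hom_closed[OF M1(3) xy(1)]]
        hom_closed[OF g(1) hom_closed[OF M1(3) xy(2)]] by metis
    then have "j x = j y" by (rule inj_onD[OF g(2) _ hom_closed[OF M1(3) xy(1)] hom_closed[OF M1(3) xy(2)]])
    then show "x = y" using M1(5) xy by metis
  qed
  then obtain h where h: "h \<in> module_hom R N1 I" "\<forall>x\<in>carrier M1. h (k (g (j x))) = f (j x)"
    using I[unfolded injective_module_def, rule_format, OF M1(1) N1(1) kgj hom_comp[OF M1(3) f]] by auto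
  have "h (k (g x)) = f x" if x: "x \<in> carrier M" for x
    using h(2) hom_closed[OF M1(2) x] M1(4)[OF x] by metis
  then show ?thesis using that[OF hom_comp[OF N1(2) h(1)]] by simp
qed

lemma projective_retract:
  assumes P: "projective_module R P" and s: "s \<in> module_hom R Q P" and r: "r \<in> module_hom R P Q"
    and rs: "\<And>x. x \<in> carrier Q \<Longrightarrow> r (s x) = x"
  shows "projective_module R Q"
  unfolding projective_module_def
proof (intro ballI impI)
  fix M N g f
  assume *: "M \<in> mod_cat R" "N \<in> mod_cat R" "g \<in> module_hom R M N" "f \<in> module_hom R Q N"
    "g ` carrier M = carrier N"
  then obtain h where h: "h \<in> module_hom R P M" "\<forall>x\<in>carrier P. g (h x) = f (r x)"
    using P[unfolded projective_module_def, rule_format, OF *(1,2,3) hom_comp[OF r *(4)] *(5)] by auto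
  show "\<exists>h\<in>module_hom R Q M. \<forall>x\<in>carrier Q. g (h x) = f x"
    using h(2) rs hom_closed[OF s] by (intro bexI[OF _ hom_comp[OF s h(1)]]) auto
qed

lemma injective_retract:
  assumes I: "injective_module R I" and s: "s \<in> module_hom R J I" and r: "r \<in> module_hom R I J"
    and rs: "\<And>x. x \<in> carrier J \<Longrightarrow> r (s x) = x"
  shows "injective_module R J"
  unfolding injective_module_def
proof (intro ballI impI)
  fix M N g f
  assume *: "M \<in> mod_cat R" "N \<in> mod_cat R" "g \<in> module_hom R M N" "f \<in> module_hom R M J"
    "inj_on g (carrier M)"
  then obtain h where h: "h \<in> module_hom R N I" "\<forall>x\<in>carrier M. h (g x) = s (f x)"
    using I[unfolded injective_module_def, rule_format, OF *(1,2,3) hom_comp[OF *(4) s] *(5)] by auto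
  show "\<exists>h\<in>module_hom R N J. \<forall>x\<in>carrier M. h (g x) = f x"
    using h(2) rs hom_closed[OF *(4)] by (intro bexI[OF _ hom_comp[OF h(1) r]]) auto
qed

lemma injective_split:
  assumes I: "injective_module R I" and fg: "fg_module R I" "fg_module R N"
    and g: "g \<in> module_hom R I N" "inj_on g (carrier I)"
  obtains r where "r \<in> module_hom R N I" "\<And>x. x \<in> carrier I \<Longrightarrow> r (g x) = x"
  using injective_extend[OF I fg g hom_id] by blast

lemma projective_direct_sum:
  assumes mods: "right_module R P" "right_module R Q"
    and P: "projective_module R P" and Q: "projective_module R Q"
  shows "projective_module R (direct_sum P Q)"
  unfolding projective_module_def
proof (intro ballI impI)
  fix M N g f
  assume *: "M \<in> mod_cat R" "N \<in> mod_cat R" "g \<in> module_hom R M N" "f \<in> module_hom R (direct_sum P Q) N"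
    "g ` carrier M = carrier N"
  interpret P: right_module R P by fact
  interpret Q: right_module R Q by fact
  interpret M: right_module R M using *(1) by (simp add: mod_cat_def)
  have i: "(\<lambda>x. (x, \<zero>\<^bsub>Q\<^esub>)) \<in> module_hom R P (direct_sum P Q)"
    by (intro hom_pair hom_id hom_const_zero mods)
  have j: "(\<lambda>y. (\<zero>\<^bsub>P\<^esub>, y)) \<in> module_hom R Q (direct_sum P Q)"
    by (intro hom_pair hom_id hom_const_zero mods)
  obtain h where h: "h \<in> module_hom R P M" "\<forall>x\<in>carrier P. g (h x) = f (x, \<zero>\<^bsub>Q\<^esub>)"
    using P[unfolded projective_module_def, rule_format, OF *(1,2,3) hom_comp[OF i *(4)] *(5)] by auto
  obtain k where k: "k \<in> module_hom R Q M" "\<forall>x\<in>carrier Q. g (k x) = f (\<zero>\<^bsub>P\<^esub>, x)"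
    using Q[unfolded projective_module_def, rule_format, OF *(1,2,3) hom_comp[OF j *(4)] *(5)] by auto
  have "g (h (fst z) \<oplus>\<^bsub>M\<^esub> k (snd z)) = f z" if z: "z \<in> carrier (direct_sum P Q)" for z
  proof -
    have "g (h (fst z) \<oplus>\<^bsub>M\<^esub> k (snd z)) = f ((fst z, \<zero>\<^bsub>Q\<^esub>) \<oplus>\<^bsub>direct_sum P Q\<^esub> (\<zero>\<^bsub>P\<^esub>, snd z))"
      using z h k by (subst hom_add[OF *(4)]) (auto simp: hom_add[OF *(3)] hom_closed)
    then show ?thesis using z by auto
  qed
  then show "\<exists>h\<in>module_hom R (direct_sum P Q) M. \<forall>x\<in>carrier (direct_sum P Q). g (h x) = f x"
    by (intro bexI[OF _ hom_copair[OF M.right_module_axioms h(1) k(1)]]) auto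
qed

lemma injective_direct_sum:
  assumes I: "injective_module R I" and J: "injective_module R J"
  shows "injective_module R (direct_sum I J)"
  unfolding injective_module_def
proof (intro ballI impI)
  fix M N g f
  assume *: "M \<in> mod_cat R" "N \<in> mod_cat R" "g \<in> module_hom R M N" "f \<in> module_hom R M (direct_sum I J)"
    "inj_on g (carrier M)"
  obtain h where h: "h \<in> module_hom R N I" "\<forall>x\<in>carrier M. h (g x) = fst (f x)"
    using I[unfolded injective_module_def, rule_format, OF *(1,2,3) hom_comp[OF *(4) hom_fst] *(5)] by auto
  obtain k where k: "k \<in> module_hom R N J" "\<forall>x\<in>carrier M. k (g x) = snd (f x)"
    using J[unfolded injective_module_def, rule_format, OF *(1,2,3) hom_comp[OF *(4) hom_snd] *(5)] by auto
  show "\<exists>h\<in>module_hom R N (direct_sum I J). \<forall>x\<in>carrier M. h (g x) = f x"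
    using h k by (intro bexI[OF _ hom_pair[OF h(1) k(1)]]) auto
qed

text \<open>
  The quotient \<open>P\<close> is projective, so \<open>L\<close> is the direct sum of \<open>P\<close> and the kernel. A lift on \<open>L\<close> is
  assembled from lifts on the two summands, with \<open>x - s (p x)\<close> as the projection to the kernel.
\<close>

lemma projective_extension:
  assumes L: "fg_module R L" and P: "right_module R P" "projective_module R P"
    and p: "p \<in> module_hom R L P" "p ` carrier L = carrier P"
    and K: "projective_module R (submod L (module_kernel L P p))"
  shows "projective_module R L"
  unfolding projective_module_def
proof (intro ballI impI)
  let ?K = "module_kernel L P p"
  have Lm: "right_module R L" using L by (rule fg_right_module)
  interpret L: right_module R L by fact
  interpret P: right_module R P by fact
  have sub: "submodule ?K R L" by (rule submodule_kernel[OF Lm P(1) p(1)])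
  obtain s where s: "s \<in> module_hom R P L" "\<And>x. x \<in> carrier P \<Longrightarrow> p (s x) = x"
    using projective_lift[OF P(2) L P(1) p hom_id] by blast
  have sp: "(\<lambda>x. s (p x)) \<in> module_hom R L L" using p(1) s(1) by (rule hom_comp)
  have c: "(\<lambda>x. x \<ominus>\<^bsub>L\<^esub> s (p x)) \<in> module_hom R L L" by (rule hom_sub[OF Lm Lm hom_id sp])
  have ck: "x \<ominus>\<^bsub>L\<^esub> s (p x) \<in> ?K" if "x \<in> carrier L" for x
    using that s hom_closed[OF p(1)] hom_closed[OF sp]
    by (auto simp: module_kernel_def hom_diff[OF Lm P(1) p(1)])
  fix M N g f
  assume *: "M \<in> mod_cat R" "N \<in> mod_cat R" "g \<in> module_hom R M N" "f \<in> module_hom R L N"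
    "g ` carrier M = carrier N"
  interpret M: right_module R M using *(1) by (simp add: mod_cat_def)
  obtain h where h: "h \<in> module_hom R P M" "\<forall>x\<in>carrier P. g (h x) = f (s x)"
    using P(2)[unfolded projective_module_def, rule_format, OF *(1,2,3) hom_comp[OF s(1) *(4)] *(5)] by auto
  obtain k where k: "k \<in> module_hom R (submod L ?K) M" "\<forall>x\<in>?K. g (k x) = f x"
    using K[unfolded projective_module_def, rule_format, OF *(1,2,3) hom_restrict[OF *(4) sub] *(5)] by auto
  have kc: "(\<lambda>x. k (x \<ominus>\<^bsub>L\<^esub> s (p x))) \<in> module_hom R L M"
    by (rule hom_comp[OF hom_corestrict[OF c ck] k(1)])
  have hp: "(\<lambda>x. h (p x)) \<in> module_hom R L M" by (rule hom_comp[OF p(1) h(1)])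
  have "g (h (p x) \<oplus>\<^bsub>M\<^esub> k (x \<ominus>\<^bsub>L\<^esub> s (p x))) = f x" if x: "x \<in> carrier L" for x
  proof -
    have "g (h (p x) \<oplus>\<^bsub>M\<^esub> k (x \<ominus>\<^bsub>L\<^esub> s (p x))) = f (s (p x) \<oplus>\<^bsub>L\<^esub> (x \<ominus>\<^bsub>L\<^esub> s (p x)))"
      using x h k ck hom_closed[OF kc x] hom_closed[OF hp x] hom_closed[OF sp x] hom_closed[OF p(1) x]
      by (simp add: hom_add[OF *(3)] hom_add[OF *(4)])
    also have "s (p x) \<oplus>\<^bsub>L\<^esub> (x \<ominus>\<^bsub>L\<^esub> s (p x)) = x"
      using x hom_closed[OF sp x] by (simp add: L.add_diff_cancel)
    finally show ?thesis .
  qed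
  then show "\<exists>h\<in>module_hom R L M. \<forall>x\<in>carrier L. g (h x) = f x"
    by (intro bexI[OF _ hom_plus[OF M.right_module_axioms hp kc]]) auto
qed


lemma projective_zero_submodule:
  assumes "right_module R P" "projective_module R P"
  shows "projective_module R (submod P {\<zero>\<^bsub>P\<^esub>})"
proof -
  have sub: "submodule {\<zero>\<^bsub>P\<^esub>} R P" by (rule submodule_trivial[OF assms(1)])
  have "(\<lambda>x. \<zero>\<^bsub>P\<^esub>) \<in> module_hom R P (submod P {\<zero>\<^bsub>P\<^esub>})"
    using hom_const_zero[OF right_module_submod[OF assms(1) sub], of P] by simp
  then show ?thesis by (rule projective_retract[OF assms(2) hom_submod_incl[OF sub]]) simp
qed

lemma projective_image_of_monic:
  assumes P: "right_module R P" "projective_module R P" and Q: "right_module R Q"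
    and d: "d \<in> module_hom R P Q" "inj_on d (carrier P)"
  shows "projective_module R (submod Q (d ` carrier P))"
proof -
  have "d \<in> module_hom R P (submod Q (d ` carrier P))" by (rule hom_corestrict[OF d(1)]) blast
  moreover have "bij_betw d (carrier P) (carrier (submod Q (d ` carrier P)))"
    using d(2) by (simp add: bij_betw_def)
  ultimately have "inverse_homs R P (submod Q (d ` carrier P)) d (inv_into (carrier P) d)"
    by (rule inverse_homs_inv[OF P(1)])
  note i = inverse_homsD[OF this]
  show ?thesis by (rule projective_retract[OF P(2) i(2,1)]) (rule i(4))
qed

section \<open>Finite projective resolutions\<close>

lemma finite_projective_resolution:
  assumes "proj_dim R M \<le> enat n"
  obtains P e d where "projective_resolution R M P e d" "\<forall>i>n. carrier (P i) = {\<zero>\<^bsub>P i\<^esub>}"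
proof -
  let ?S = "{enat n | n. \<exists>P e d. projective_resolution R M P e d \<and>
     (\<forall>i>n. carrier (P i) = {\<zero>\<^bsub>P i\<^esub>})}"
  have "Inf ?S < enat (Suc n)" using assms unfolding proj_dim_def
    by (rule le_less_trans) simp
  then obtain s where s: "s \<in> ?S" "s < enat (Suc n)" unfolding Inf_less_iff by blast
  then obtain m P e d where m: "s = enat m" "projective_resolution R M P e d"
    "\<forall>i>m. carrier (P i) = {\<zero>\<^bsub>P i\<^esub>}" by blast
  then have "m \<le> n" using s(2) by simp
  then show ?thesis using that[OF m(2)] m(3) by simp
qed

lemma resolution_monic:
  assumes res: "projective_resolution R M P e d" and zero: "carrier (P (Suc (Suc i))) = {\<zero>\<^bsub>P (Suc (Suc i))\<^esub>}"
  shows "inj_on (d i) (carrier (P (Suc i)))"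
proof -
  have P: "right_module R (P i)" for i
    using res by (simp add: projective_resolution_def mod_cat_def)
  have d: "d i \<in> module_hom R (P (Suc i)) (P i)" for i
    using res by (simp add: projective_resolution_def)
  have "module_kernel (P (Suc i)) (P i) (d i) = d (Suc i) ` carrier (P (Suc (Suc i)))"
    using res by (simp add: projective_resolution_def)
  then have "module_kernel (P (Suc i)) (P i) (d i) = {\<zero>\<^bsub>P (Suc i)\<^esub>}"
    using zero hom_zero[OF P P d] by simp
  then show ?thesis by (intro hom_inj_onI[OF P P d]) (auto simp: module_kernel_def)
qed

lemma gl_dim_le_2_resolution:
  assumes gl: "gl_dim R \<le> 2" and Q: "Q \<in> mod_cat R"
  shows "\<exists>P0\<in>mod_cat R. \<exists>P1\<in>mod_cat R. \<exists>P2\<in>mod_cat R. \<exists>e d0 d1.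
    projective_module R P0 \<and> projective_module R P1 \<and> projective_module R P2 \<and>
    e \<in> module_hom R P0 Q \<and> e ` carrier P0 = carrier Q \<and> module_kernel P0 Q e = d0 ` carrier P1 \<and>
    d0 \<in> module_hom R P1 P0 \<and> module_kernel P1 P0 d0 = d1 ` carrier P2 \<and>
    d1 \<in> module_hom R P2 P1 \<and> inj_on d1 (carrier P2)"
proof -
  have "proj_dim R Q \<le> gl_dim R" unfolding gl_dim_def using Q by (rule SUP_upper)
  also have "\<dots> \<le> enat 2" using gl by (simp add: numeral_eq_enat)
  finally obtain P e d where res: "projective_resolution R Q P e d"
    and zero: "\<forall>i>2. carrier (P i) = {\<zero>\<^bsub>P i\<^esub>}" by (rule finite_projective_resolution)
  have P: "P i \<in> mod_cat R" "projective_module R (P i)" for i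
    using res by (simp_all add: projective_resolution_def)
  have "e \<in> module_hom R (P 0) Q" "e ` carrier (P 0) = carrier Q"
    "module_kernel (P 0) Q e = d 0 ` carrier (P 1)"
    "d 0 \<in> module_hom R (P 1) (P 0)" "d 1 \<in> module_hom R (P 2) (P 1)"
    "module_kernel (P 1) (P 0) (d 0) = d 1 ` carrier (P 2)"
    using res by (simp_all add: projective_resolution_def numeral_2_eq_2)
  moreover have "inj_on (d 1) (carrier (P 2))"
    using resolution_monic[OF res, of 1] zero by (simp add: numeral_2_eq_2)
  ultimately show ?thesis using P
    by (intro bexI[OF _ P(1)] exI[of _ e] exI[of _ "d 0"] exI[of _ "d 1"] conjI) assumption+
qed

section \<open>Modules of finite rank\<close>

text \<open>
  A substitute for dimension and length: strict monotonicity and a bound yield the ascending and the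
  descending chain condition together, in the form of maximal and minimal elements.
\<close>

definition finite_rank :: "('a, 'r) ring_scheme \<Rightarrow> ('a, 'm) module \<Rightarrow> bool" where
  "finite_rank R M \<longleftrightarrow> (\<exists>\<rho> :: 'm set \<Rightarrow> nat. \<exists>n. (\<forall>H. \<rho> H \<le> n) \<and>
     (\<forall>H H'. submodule H R M \<longrightarrow> submodule H' R M \<longrightarrow> H \<subset> H' \<longrightarrow> \<rho> H < \<rho> H'))"

lemma finite_rank_minimal:
  assumes rk: "finite_rank R M" and F: "F \<noteq> {}" "\<forall>H\<in>F. submodule H R M"
  shows "\<exists>H\<in>F. \<forall>T\<in>F. T \<subseteq> H \<longrightarrow> T = H"
proof -
  obtain \<rho> :: "_ set \<Rightarrow> nat" and n where \<rho>: "\<forall>H. \<rho> H \<le> n"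
    "\<forall>H H'. submodule H R M \<longrightarrow> submodule H' R M \<longrightarrow> H \<subset> H' \<longrightarrow> \<rho> H < \<rho> H'"
    using rk unfolding finite_rank_def by blast
  obtain H where H: "H \<in> F" "\<forall>T. \<rho> T < \<rho> H \<longrightarrow> T \<notin> F"
    using wf_eq_minimal[THEN iffD1, OF wf_measure[of \<rho>]] F(1) by (auto simp: in_measure)
  have "T = H" if T: "T \<in> F" "T \<subseteq> H" for T
  proof (rule ccontr)
    assume "T \<noteq> H"
    then have "\<rho> T < \<rho> H" using \<rho>(2) F(2) T H(1) by blast
    then show False using H(2) T(1) by blast
  qed
  then show ?thesis using H(1) by blast
qed

lemma finite_rank_maximal:
  assumes rk: "finite_rank R M" and F: "F \<noteq> {}" "\<forall>H\<in>F. submodule H R M"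
  shows "\<exists>H\<in>F. \<forall>T\<in>F. H \<subseteq> T \<longrightarrow> T = H"
proof -
  obtain \<rho> :: "_ set \<Rightarrow> nat" and n where \<rho>: "\<forall>H. \<rho> H \<le> n"
    "\<forall>H H'. submodule H R M \<longrightarrow> submodule H' R M \<longrightarrow> H \<subset> H' \<longrightarrow> \<rho> H < \<rho> H'"
    using rk unfolding finite_rank_def by blast
  obtain H where H: "H \<in> F" "\<forall>T. n - \<rho> T < n - \<rho> H \<longrightarrow> T \<notin> F"
    using wf_eq_minimal[THEN iffD1, OF wf_measure[of "\<lambda>T. n - \<rho> T"]] F(1) by (auto simp: in_measure)
  have "T = H" if T: "T \<in> F" "H \<subseteq> T" for T
  proof (rule ccontr)
    assume "T \<noteq> H"
    then have "\<rho> H < \<rho> T" using \<rho>(2) F(2) T H(1) by blast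
    then have "n - \<rho> T < n - \<rho> H" using \<rho>(1) by (metis diff_less_mono2 le_trans less_le_trans)
    then show False using H(2) T(1) by blast
  qed
  then show ?thesis using H(1) by blast
qed

lemma finite_rank_zero:
  assumes "carrier M = {\<zero>\<^bsub>M\<^esub>}"
  shows "finite_rank R M"
proof -
  have sub: "H = {\<zero>\<^bsub>M\<^esub>}" if "submodule H R M" for H
    using submodule_subset[OF that] submodule_zero[OF that] unfolding assms by blast
  have "\<not> H \<subset> H'" if "submodule H R M" "submodule H' R M" for H H'
    using sub[OF that(1)] sub[OF that(2)] by simp
  then show ?thesis unfolding finite_rank_def by (intro exI[of _ "\<lambda>_. 0"] exI[of _ 0]) simp
qed

text \<open>
  A maximal element among the finitely generated submodules of \<open>H\<close> cannot be enlarged by a further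
  generator, so it is \<open>H\<close>.
\<close>

lemma finite_rank_noetherian:
  assumes M: "right_module R M" and rk: "finite_rank R M" and H: "submodule H R M"
  shows "fg_module R (submod M H)"
proof -
  define F where "F = {submodule_span R M B | B. finite B \<and> B \<subseteq> H}"
  have Hc: "H \<subseteq> carrier M" using submodule_subset[OF H] by auto
  have "\<exists>T\<in>F. \<forall>T'\<in>F. T \<subseteq> T' \<longrightarrow> T' = T"
  proof (rule finite_rank_maximal[OF rk])
    show "F \<noteq> {}" unfolding F_def by (auto intro!: exI[of _ "{}"])
    show "\<forall>T\<in>F. submodule T R M" unfolding F_def using span_submodule[OF M] Hc by blast
  qed
  then obtain B where B: "finite B" "B \<subseteq> H"
    and max: "\<forall>T\<in>F. submodule_span R M B \<subseteq> T \<longrightarrow> T = submodule_span R M B"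
    unfolding F_def by blast
  have "x \<in> submodule_span R M B" if x: "x \<in> H" for x
  proof -
    have "submodule_span R M (insert x B) \<in> F" unfolding F_def using B x by blast
    moreover have "submodule_span R M B \<subseteq> submodule_span R M (insert x B)"
      unfolding submodule_span_def by blast
    ultimately have "submodule_span R M (insert x B) = submodule_span R M B" using max by blast
    then show ?thesis using span_incl[of "insert x B" R M] by blast
  qed
  then have Hs: "H \<subseteq> submodule_span R M B" by blast
  show ?thesis
  proof (rule fg_moduleI[OF right_module_submod[OF M H] B(1)])
    show "B \<subseteq> carrier (submod M H)" using B(2) by simp
    fix T assume "submodule T R (submod M H)" "B \<subseteq> T"
    then show "carrier (submod M H) \<subseteq> T"
      using Hs span_least[of T R M B] by (auto simp: submodule_of_submod[OF M H])
  qed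
qed

lemma finite_rank_fg:
  assumes "right_module R M" "finite_rank R M"
  shows "fg_module R M"
  using finite_rank_noetherian[OF assms submodule_carrier[OF assms(1)]] by simp

text \<open>
  The rank of \<open>H\<close> is the old rank of \<open>H \<inter> U\<close>, plus one if \<open>H\<close> leaves \<open>U\<close>. If \<open>H \<subset> H'\<close> have the same
  intersection with \<open>U\<close>, then \<open>H\<close> stays inside \<open>U\<close>: an element of \<open>H\<close> outside \<open>U\<close> would generate
  \<open>H'\<close> modulo \<open>H' \<inter> U = H \<inter> U\<close> and force \<open>H = H'\<close>. Ranks of vector spaces are built from this step
  alone.
\<close>

lemma finite_rank_codim_one:
  assumes M: "right_module R M" and U: "submodule U R M" and rk: "finite_rank R (submod M U)"
    and codim: "\<And>x y. x \<in> carrier M \<Longrightarrow> x \<notin> U \<Longrightarrow> y \<in> carrier M \<Longrightarrow>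
      \<exists>c\<in>carrier R. y \<ominus>\<^bsub>M\<^esub> c \<odot>\<^bsub>M\<^esub> x \<in> U"
  shows "finite_rank R M"
proof -
  interpret M: right_module R M by fact
  obtain \<rho> :: "_ set \<Rightarrow> nat" and n where \<rho>: "\<forall>H. \<rho> H \<le> n"
    "\<forall>H H'. submodule H R (submod M U) \<longrightarrow> submodule H' R (submod M U) \<longrightarrow> H \<subset> H' \<longrightarrow> \<rho> H < \<rho> H'"
    using rk unfolding finite_rank_def by blast
  define \<sigma> where "\<sigma> H = \<rho> (H \<inter> U) + (if H \<subseteq> U then 0 else 1)" for H
  have "\<sigma> H < \<sigma> H'" if H: "submodule H R M" "submodule H' R M" "H \<subset> H'" for H H'
  proof (cases "H \<inter> U = H' \<inter> U")
    case False
    have "submodule (H \<inter> U) R (submod M U)" "submodule (H' \<inter> U) R (submod M U)"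
      using submodule_inter[OF M _ U] H by (auto simp: submodule_of_submod[OF M U])
    moreover have "H \<inter> U \<subset> H' \<inter> U" using False H(3) by blast
    ultimately have "\<rho> (H \<inter> U) < \<rho> (H' \<inter> U)" using \<rho>(2) by blast
    then show ?thesis using H(3) by (auto simp: \<sigma>_def)
  next
    case True
    have "H \<subseteq> U"
    proof (rule ccontr)
      assume "\<not> H \<subseteq> U"
      then obtain x where x: "x \<in> H" "x \<notin> U" by blast
      have "y \<in> H" if y: "y \<in> H'" for y
      proof -
        have xy: "x \<in> carrier M" "y \<in> carrier M" using submodule_subset[OF H(2)] H(3) x(1) y by auto
        then obtain c where c: "c \<in> carrier R" "y \<ominus>\<^bsub>M\<^esub> c \<odot>\<^bsub>M\<^esub> x \<in> U" using codim x(2) by blast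
        have cx: "c \<odot>\<^bsub>M\<^esub> x \<in> H" using submodule_smult[OF H(1) c(1) x(1)] .
        then have "y \<ominus>\<^bsub>M\<^esub> c \<odot>\<^bsub>M\<^esub> x \<in> H'" using submodule_diff[OF H(2) y] H(3) by blast
        then have "y \<ominus>\<^bsub>M\<^esub> c \<odot>\<^bsub>M\<^esub> x \<in> H" using c(2) True by blast
        then have "c \<odot>\<^bsub>M\<^esub> x \<oplus>\<^bsub>M\<^esub> (y \<ominus>\<^bsub>M\<^esub> c \<odot>\<^bsub>M\<^esub> x) \<in> H" using submodule_add[OF H(1) cx] by blast
        then show "y \<in> H" using M.add_diff_cancel[OF xy(2), of "c \<odot>\<^bsub>M\<^esub> x"] c(1) xy(1) by simp
      qed
      then show False using H(3) by blast
    qed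
    moreover have "\<not> H' \<subseteq> U" using True \<open>H \<subseteq> U\<close> H(3) by blast
    ultimately show ?thesis using True by (simp add: \<sigma>_def)
  qed
  moreover have "\<sigma> H \<le> n + 1" for H
    using \<rho>(1) by (simp add: \<sigma>_def) (meson le_SucI)
  ultimately show ?thesis unfolding finite_rank_def by blast
qed

text \<open>
  The images of the powers of \<open>t\<close> stabilise, and injectivity of a power cancels it from
  \<open>t\<^sup>n(M) = t\<^sup>n(t(M))\<close>.
\<close>

lemma finite_rank_surj_endo:
  assumes M: "right_module R M" and rk: "finite_rank R M"
    and t: "t \<in> module_hom R M M" and inj: "inj_on t (carrier M)"
  shows "t ` carrier M = carrier M"
proof -
  have tc: "t x \<in> carrier M" if "x \<in> carrier M" for x using hom_closed[OF t that] .
  have pow: "(t ^^ n) \<in> module_hom R M M \<and> inj_on (t ^^ n) (carrier M)" for n :: nat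
  proof (induction n)
    case 0
    have "(t ^^ 0) = (\<lambda>x. x)" by auto
    then show ?case using hom_id[of R M] by (metis inj_on_id2)
  next
    case (Suc n)
    then have IH: "(t ^^ n) \<in> module_hom R M M" "inj_on (t ^^ n) (carrier M)" by auto
    have "t ^^ Suc n = (\<lambda>x. t ((t ^^ n) x))" by (auto simp: comp_def)
    then have "t ^^ Suc n \<in> module_hom R M M" using hom_comp[OF IH(1) t] by metis
    moreover have "inj_on (t \<circ> (t ^^ n)) (carrier M)"
    proof (rule comp_inj_on)
      show "inj_on (t ^^ n) (carrier M)" by (rule IH(2))
      have "(t ^^ n) ` carrier M \<subseteq> carrier M" using hom_closed[OF IH(1)] by blast
      then show "inj_on t ((t ^^ n) ` carrier M)" using inj by (rule inj_on_subset[rotated])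
    qed
    ultimately show ?case by (metis funpow.simps(2))
  qed
  define F where "F = range (\<lambda>n. (t ^^ n) ` carrier M)"
  have "\<exists>H\<in>F. \<forall>T\<in>F. T \<subseteq> H \<longrightarrow> T = H"
  proof (rule finite_rank_minimal[OF rk])
    show "\<forall>H\<in>F. submodule H R M" unfolding F_def
      using submodule_image[OF M M _ submodule_carrier[OF M]] pow by blast
  qed (simp add: F_def)
  then obtain n where min: "\<forall>T\<in>F. T \<subseteq> (t ^^ n) ` carrier M \<longrightarrow> T = (t ^^ n) ` carrier M"
    unfolding F_def by blast
  have shift: "(t ^^ Suc n) x = (t ^^ n) (t x)" for x by (simp add: funpow_swap1)
  have "(t ^^ Suc n) ` carrier M \<subseteq> (t ^^ n) ` carrier M" unfolding shift using tc by blast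
  then have eq: "(t ^^ Suc n) ` carrier M = (t ^^ n) ` carrier M" using min unfolding F_def by blast
  have "x \<in> t ` carrier M" if x: "x \<in> carrier M" for x
  proof -
    have "(t ^^ n) x \<in> (t ^^ Suc n) ` carrier M" unfolding eq using x by blast
    then obtain y where y: "y \<in> carrier M" "(t ^^ n) x = (t ^^ n) (t y)" unfolding shift by blast
    then have "x = t y" using inj_onD[of "t ^^ n" "carrier M" x "t y"] pow[of n] x tc by blast
    then show ?thesis using y by blast
  qed
  then show ?thesis using tc by blast
qed

lemma finite_rank_ex_simple:
  assumes M: "right_module R M" and rk: "finite_rank R M"
    and H: "submodule H R M" "H \<noteq> {\<zero>\<^bsub>M\<^esub>}"
  shows "\<exists>S. simple_submodule R M S \<and> S \<subseteq> H"
proof -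
  define F where "F = {S. submodule S R M \<and> S \<noteq> {\<zero>\<^bsub>M\<^esub>} \<and> S \<subseteq> H}"
  have "\<exists>S\<in>F. \<forall>T\<in>F. T \<subseteq> S \<longrightarrow> T = S"
  proof (rule finite_rank_minimal[OF rk])
    have "H \<in> F" using H by (simp add: F_def)
    then show "F \<noteq> {}" by blast
    show "\<forall>S\<in>F. submodule S R M" by (simp add: F_def)
  qed
  then obtain S where S: "S \<in> F" "\<forall>T\<in>F. T \<subseteq> S \<longrightarrow> T = S" by blast
  have "simple_submodule R M S" unfolding simple_submodule_def
    using S unfolding F_def by blast
  then show ?thesis using S(1) unfolding F_def by blast
qed

text \<open>
  Embedding by cogeneration: the kernel of a map into a module of the class can be made smaller
  by adding a further component, and finite rank stops this only at the zero kernel.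
\<close>

lemma embed_by_cogeneration:
  fixes M :: "('a, 'm) module" and \<Phi> :: "('a, 'a list) module \<Rightarrow> bool"
  assumes M: "right_module R M" and rk: "finite_rank R M"
    and sum: "\<And>I J L i j. \<lbrakk>I \<in> mod_cat R; J \<in> mod_cat R; L \<in> mod_cat R; \<Phi> I; \<Phi> J;
      inverse_homs R (direct_sum I J) L i j\<rbrakk> \<Longrightarrow> \<Phi> L"
    and ex: "J0 \<in> mod_cat R" "\<Phi> J0"
    and cogen: "\<And>H. \<lbrakk>submodule H R M; H \<noteq> {\<zero>\<^bsub>M\<^esub>}\<rbrakk> \<Longrightarrow>
      \<exists>J\<in>mod_cat R. \<Phi> J \<and> (\<exists>f\<in>module_hom R M J. \<exists>x\<in>H. f x \<noteq> \<zero>\<^bsub>J\<^esub>)"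
  shows "\<exists>J\<in>mod_cat R. \<Phi> J \<and> (\<exists>f\<in>module_hom R M J. inj_on f (carrier M))"
proof -
  have rm: "right_module R J" if "J \<in> mod_cat R" for J :: "('a, 'a list) module"
    using that by (simp add: mod_cat_def)
  define F where "F = {module_kernel M J f | J f. J \<in> mod_cat R \<and> \<Phi> J \<and> f \<in> module_hom R M J}"
  have "\<exists>H\<in>F. \<forall>T\<in>F. T \<subseteq> H \<longrightarrow> T = H"
  proof (rule finite_rank_minimal[OF rk])
    show "F \<noteq> {}" using ex hom_const_zero[OF rm[OF ex(1)], of M] unfolding F_def by blast
    show "\<forall>H\<in>F. submodule H R M" unfolding F_def using submodule_kernel[OF M rm] by blast
  qed
  then obtain J f where J: "J \<in> mod_cat R" "\<Phi> J" "f \<in> module_hom R M J"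
    and min: "\<forall>T\<in>F. T \<subseteq> module_kernel M J f \<longrightarrow> T = module_kernel M J f"
    unfolding F_def by blast
  have "module_kernel M J f = {\<zero>\<^bsub>M\<^esub>}"
  proof (rule ccontr)
    assume "module_kernel M J f \<noteq> {\<zero>\<^bsub>M\<^esub>}"
    then obtain J' g x where J': "J' \<in> mod_cat R" "\<Phi> J'" "g \<in> module_hom R M J'"
      and x: "x \<in> module_kernel M J f" "g x \<noteq> \<zero>\<^bsub>J'\<^esub>"
      using cogen submodule_kernel[OF M rm[OF J(1)] J(3)] by blast
    have D: "fg_module R (direct_sum J J')" using J(1) J'(1) by (intro fg_direct_sum) (auto simp: mod_cat_iff)
    obtain L i j where L: "L \<in> mod_cat R" "inverse_homs R (direct_sum J J') L i j"
      using fg_ex_iso[OF D] by blast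
    note ij = inverse_homsD[OF L(2)]
    (* The kernel of the pair (f, g) is strictly smaller than the kernel of f. *)
    let ?h = "\<lambda>y. i (f y, g y)"
    have h: "?h \<in> module_hom R M L" by (rule hom_comp[OF hom_pair[OF J(3) J'(3)] ij(1)])
    have ker: "f y = \<zero>\<^bsub>J\<^esub> \<and> g y = \<zero>\<^bsub>J'\<^esub>" if y: "y \<in> carrier M" "?h y = \<zero>\<^bsub>L\<^esub>" for y
    proof -
      have "j (i (f y, g y)) = (\<zero>\<^bsub>J\<^esub>, \<zero>\<^bsub>J'\<^esub>)"
        using y(2) hom_zero[OF rm[OF L(1)] fg_right_module[OF D] ij(2)] by simp
      then show ?thesis using ij(3) hom_closed[OF J(3) y(1)] hom_closed[OF J'(3) y(1)] by simp
    qed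
    have "module_kernel M L ?h \<in> F" unfolding F_def
      using L(1) sum[OF J(1) J'(1) L(1) J(2) J'(2) L(2)] h by blast
    moreover have "module_kernel M L ?h \<subseteq> module_kernel M J f"
      using ker by (auto simp: module_kernel_def)
    ultimately have "module_kernel M L ?h = module_kernel M J f" using min by blast
    then have "x \<in> module_kernel M L ?h" using x(1) by simp
    then have "?h x = \<zero>\<^bsub>L\<^esub>" "x \<in> carrier M" unfolding in_module_kernel by blast+
    then show False using ker x(2) by blast
  qed
  then have "inj_on f (carrier M)"
    by (intro hom_inj_onI[OF M rm[OF J(1)] J(3)]) (auto simp: module_kernel_def)
  then show ?thesis using J by blast
qed

section \<open>The regular module\<close>

lemma regular_simps [simp]:
  "carrier (regular_module R) = carrier R" "\<zero>\<^bsub>regular_module R\<^esub> = \<zero>\<^bsub>R\<^esub>"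
  "x \<oplus>\<^bsub>regular_module R\<^esub> y = x \<oplus>\<^bsub>R\<^esub> y" "a \<odot>\<^bsub>regular_module R\<^esub> x = x \<otimes>\<^bsub>R\<^esub> a"
  by (simp_all add: regular_module_def)

lemma right_module_regular:
  assumes "ring R" shows "right_module R (regular_module R)"
proof -
  interpret R: ring R by fact
  have "abelian_group (regular_module R)"
  proof (rule abelian_groupI)
    fix x assume "x \<in> carrier (regular_module R)"
    then show "\<exists>y\<in>carrier (regular_module R). y \<oplus>\<^bsub>regular_module R\<^esub> x = \<zero>\<^bsub>regular_module R\<^esub>"
      by (intro bexI[of _ "\<ominus>\<^bsub>R\<^esub> x"]) (auto simp: R.l_neg)
  qed (auto simp: R.a_ac)
  then show ?thesis
    by (intro right_module.intro right_module_axioms.intro R.ring_axioms)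
      (auto simp: R.l_distr R.r_distr R.m_assoc)
qed

lemma hom_from_regular:
  assumes "right_module R M" "m \<in> carrier M"
  shows "(\<lambda>a. a \<odot>\<^bsub>M\<^esub> m) \<in> module_hom R (regular_module R) M"
proof -
  interpret M: right_module R M by fact
  show ?thesis using assms(2) by (intro module_homI) (auto simp: M.ract_l_distr M.ract_assoc)
qed

lemma fg_regular:
  assumes "ring R" shows "fg_module R (regular_module R)"
proof -
  interpret R: ring R by fact
  show ?thesis
  proof (rule fg_moduleI[OF right_module_regular[OF assms], of "{\<one>\<^bsub>R\<^esub>}"])
    fix H assume H: "submodule H R (regular_module R)" "{\<one>\<^bsub>R\<^esub>} \<subseteq> H"
    show "carrier (regular_module R) \<subseteq> H"
    proof
      fix a assume "a \<in> carrier (regular_module R)"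
      then show "a \<in> H" using submodule_smult[OF H(1), of a "\<one>\<^bsub>R\<^esub>"] H(2) by simp
    qed
  qed auto
qed

lemma projective_regular:
  assumes "ring R" shows "projective_module R (regular_module R)"
  unfolding projective_module_def
proof (intro ballI impI)
  interpret R: ring R by fact
  fix M N g f
  assume *: "M \<in> mod_cat R" "N \<in> mod_cat R" "g \<in> module_hom R M N"
    "f \<in> module_hom R (regular_module R) N" "g ` carrier M = carrier N"
  have M: "right_module R M" using *(1) by (simp add: mod_cat_def)
  have "f \<one>\<^bsub>R\<^esub> \<in> carrier N" using hom_closed[OF *(4)] by simp
  then obtain m where m: "m \<in> carrier M" "g m = f \<one>\<^bsub>R\<^esub>" using *(5) by (metis imageE)
  have "g (a \<odot>\<^bsub>M\<^esub> m) = f a" if a: "a \<in> carrier R" for a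
    using hom_smult[OF *(3) a m(1)] hom_smult[OF *(4) a, of "\<one>\<^bsub>R\<^esub>"] a m(2) by simp
  then show "\<exists>h\<in>module_hom R (regular_module R) M. \<forall>x\<in>carrier (regular_module R). g (h x) = f x"
    by (intro bexI[OF _ hom_from_regular[OF M m(1)]]) auto
qed

text \<open>
  Every finitely generated projective module is a retract of a finite direct sum of copies of the
  regular module. The sum is not constructed: among the images in \<open>P\<close> of modules satisfying \<open>\<Phi>\<close> a
  maximal one is all of \<open>P\<close>, since a missed element \<open>m\<close> is reached by adding one more copy of the
  regular module, mapped by \<open>a \<mapsto> m a\<close>.
\<close>

lemma projective_induct:
  fixes P :: "('a, 'a list) module" and \<Phi> :: "('a, 'a list) module \<Rightarrow> bool"
  assumes P: "P \<in> mod_cat R" "projective_module R P" and rk: "finite_rank R P"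
    and regular: "\<And>Y i j. Y \<in> mod_cat R \<Longrightarrow> inverse_homs R (regular_module R) Y i j \<Longrightarrow> \<Phi> Y"
    and sum: "\<And>Y Z L i j. \<lbrakk>Y \<in> mod_cat R; Z \<in> mod_cat R; L \<in> mod_cat R; \<Phi> Y; \<Phi> Z;
      inverse_homs R (direct_sum Y Z) L i j\<rbrakk> \<Longrightarrow> \<Phi> L"
    and retract: "\<And>Y Z s r. \<lbrakk>Y \<in> mod_cat R; Z \<in> mod_cat R; \<Phi> Y; s \<in> module_hom R Z Y;
      r \<in> module_hom R Y Z; \<And>z. z \<in> carrier Z \<Longrightarrow> r (s z) = z\<rbrakk> \<Longrightarrow> \<Phi> Z"
  shows "\<Phi> P"
proof -
  have rm: "right_module R J" if "J \<in> mod_cat R" for J :: "('a, 'a list) module"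
    using that by (simp add: mod_cat_def)
  have Pm: "right_module R P" using rm[OF P(1)] .
  interpret P: right_module R P by (rule Pm)
  have R: "ring R" by (rule P.R.ring_axioms)
  obtain Y0 i0 j0 where Y0: "Y0 \<in> mod_cat R" "inverse_homs R (regular_module R) Y0 i0 j0"
    using fg_ex_iso[OF fg_regular[OF R]] by blast
  have \<Phi>0: "\<Phi> Y0" using regular[OF Y0] .
  define F where "F = {f ` carrier Y | Y f. Y \<in> mod_cat R \<and> \<Phi> Y \<and> f \<in> module_hom R Y P}"
  have "\<exists>H\<in>F. \<forall>T\<in>F. H \<subseteq> T \<longrightarrow> T = H"
  proof (rule finite_rank_maximal[OF rk])
    show "F \<noteq> {}" using Y0 \<Phi>0 hom_const_zero[OF Pm] unfolding F_def by blast
    show "\<forall>H\<in>F. submodule H R P" unfolding F_def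
      using submodule_image[OF rm Pm _ submodule_carrier[OF rm]] by blast
  qed
  then obtain Y f where Y: "Y \<in> mod_cat R" "\<Phi> Y" "f \<in> module_hom R Y P"
    and max: "\<forall>T\<in>F. f ` carrier Y \<subseteq> T \<longrightarrow> T = f ` carrier Y"
    unfolding F_def by blast
  have D: "fg_module R (direct_sum Y Y0)" using Y(1) Y0(1) by (intro fg_direct_sum) (auto simp: mod_cat_iff)
  obtain L i j where L: "L \<in> mod_cat R" "inverse_homs R (direct_sum Y Y0) L i j"
    using fg_ex_iso[OF D] by blast
  note ij = inverse_homsD[OF L(2)] and ij0 = inverse_homsD[OF Y0(2)]
  have "m \<in> f ` carrier Y" if m: "m \<in> carrier P" for m
  proof -
    let ?g = "\<lambda>y. j0 y \<odot>\<^bsub>P\<^esub> m"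
    have g: "?g \<in> module_hom R Y0 P" by (rule hom_comp[OF ij0(2) hom_from_regular[OF Pm m]])
    let ?h = "\<lambda>z. f (fst (j z)) \<oplus>\<^bsub>P\<^esub> ?g (snd (j z))"
    have h: "?h \<in> module_hom R L P" by (rule hom_comp[OF ij(2) hom_copair[OF Pm Y(3) g]])
    have "f y \<oplus>\<^bsub>P\<^esub> ?g z \<in> ?h ` carrier L" if "y \<in> carrier Y" "z \<in> carrier Y0" for y z
      using ij(3)[of "(y, z)"] hom_closed[OF ij(1), of "(y, z)"] that
      by (intro image_eqI[of _ _ "i (y, z)"]) auto
    note im = this
    interpret Y: right_module R Y by (rule rm[OF Y(1)])
    interpret Y0: right_module R Y0 by (rule rm[OF Y0(1)])
    have "f y \<in> ?h ` carrier L" if y: "y \<in> carrier Y" for y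
      using im[OF y Y0.zero_closed] hom_zero[OF rm[OF Y0(1)] Pm g] hom_closed[OF Y(3) y] by simp
    then have "f ` carrier Y \<subseteq> ?h ` carrier L" by blast
    moreover have "?h ` carrier L \<in> F" unfolding F_def
      using L(1) sum[OF Y(1) Y0(1) L(1) Y(2) \<Phi>0 L(2)] h by blast
    ultimately have eq: "?h ` carrier L = f ` carrier Y" using max by blast
    have "i0 \<one>\<^bsub>R\<^esub> \<in> carrier Y0" "j0 (i0 \<one>\<^bsub>R\<^esub>) = \<one>\<^bsub>R\<^esub>" using ij0(3) hom_closed[OF ij0(1)] by auto
    then have "m \<in> ?h ` carrier L"
      using im[OF Y.zero_closed, of "i0 \<one>\<^bsub>R\<^esub>"] hom_zero[OF rm[OF Y(1)] Pm Y(3)] m by simp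
    then show ?thesis unfolding eq .
  qed
  then have surj: "f ` carrier Y = carrier P" using hom_closed[OF Y(3)] by blast
  have "fg_module R Y" using Y(1) by (simp add: mod_cat_iff)
  then obtain s where "s \<in> module_hom R P Y" "\<And>x. x \<in> carrier P \<Longrightarrow> f (s x) = x"
    using projective_lift[OF P(2) _ Pm Y(3) surj hom_id] by blast
  then show ?thesis using retract[OF Y(1) P(1) Y(2) _ Y(3)] by blast
qed

section \<open>Vector spaces\<close>

lemma submodule_adjoin:
  assumes M: "right_module R M" and W: "submodule W R M" and x: "x \<in> carrier M"
  defines "T \<equiv> {w \<oplus>\<^bsub>M\<^esub> c \<odot>\<^bsub>M\<^esub> x | w c. w \<in> W \<and> c \<in> carrier R}"
  shows "submodule T R M" "W \<subseteq> T" "x \<in> T"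
proof -
  interpret M: right_module R M by fact
  have Wc: "w \<in> carrier M" if "w \<in> W" for w using submodule_subset[OF W that] .
  have mem: "w \<oplus>\<^bsub>M\<^esub> c \<odot>\<^bsub>M\<^esub> x \<in> T" if "w \<in> W" "c \<in> carrier R" for w c using that unfolding T_def by blast
  show "W \<subseteq> T"
  proof
    fix w assume "w \<in> W"
    then show "w \<in> T" using mem[of w "\<zero>\<^bsub>R\<^esub>"] x Wc by simp
  qed
  then have "\<zero>\<^bsub>M\<^esub> \<in> T" using submodule_zero[OF W] by blast
  show "x \<in> T" using mem[of "\<zero>\<^bsub>M\<^esub>" "\<one>\<^bsub>R\<^esub>"] x submodule_zero[OF W] by simp
  show "submodule T R M"
  proof (rule M.right_submoduleI)
    show "T \<subseteq> carrier M" using Wc x by (auto simp: T_def)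
    show "\<zero>\<^bsub>M\<^esub> \<in> T" by fact
    fix y z assume "y \<in> T" "z \<in> T"
    then obtain v c w e where yz: "y = v \<oplus>\<^bsub>M\<^esub> c \<odot>\<^bsub>M\<^esub> x" "z = w \<oplus>\<^bsub>M\<^esub> e \<odot>\<^bsub>M\<^esub> x"
      "v \<in> W" "w \<in> W" "c \<in> carrier R" "e \<in> carrier R" unfolding T_def by blast
    then have "y \<oplus>\<^bsub>M\<^esub> z = (v \<oplus>\<^bsub>M\<^esub> w) \<oplus>\<^bsub>M\<^esub> (c \<oplus>\<^bsub>R\<^esub> e) \<odot>\<^bsub>M\<^esub> x"
      using x Wc by (simp add: M.ract_l_distr M.a_ac)
    then show "y \<oplus>\<^bsub>M\<^esub> z \<in> T" using mem submodule_add[OF W] yz by simp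
  next
    fix a y assume ay: "a \<in> carrier R" "y \<in> T"
    then obtain v c where y: "y = v \<oplus>\<^bsub>M\<^esub> c \<odot>\<^bsub>M\<^esub> x" "v \<in> W" "c \<in> carrier R" unfolding T_def by blast
    then have "a \<odot>\<^bsub>M\<^esub> y = a \<odot>\<^bsub>M\<^esub> v \<oplus>\<^bsub>M\<^esub> (c \<otimes>\<^bsub>R\<^esub> a) \<odot>\<^bsub>M\<^esub> x"
      using x Wc ay(1) by (simp add: M.ract_r_distr M.ract_assoc)
    then show "a \<odot>\<^bsub>M\<^esub> y \<in> T" using mem submodule_smult[OF W ay(1)] y ay(1) by simp
  qed
qed

text \<open>
  Adjoining one generator raises the dimension by at most one.
\<close>

lemma finite_rank_vector_space:
  assumes K: "field K" and fg: "fg_module K V"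
  shows "finite_rank K V"
proof -
  interpret K: field K by fact
  interpret V: right_module K V using fg by (rule fg_right_module)
  have V: "right_module K V" by (rule V.right_module_axioms)
  have "finite_rank K (submod V (submodule_span K V B))" if "finite B" "B \<subseteq> carrier V" for B
    using that
  proof (induction B rule: finite_induct)
    case empty
    have "submodule_span K V {} = {\<zero>\<^bsub>V\<^esub>}"
      using span_least[OF submodule_trivial[OF V], of "{}"]
        submodule_zero[OF span_submodule[OF V, of "{}"]] by auto
    then show ?case by (intro finite_rank_zero) simp
  next
    case (insert b B)
    let ?U = "submodule_span K V B" and ?W = "submodule_span K V (insert b B)"
    have b: "b \<in> carrier V" using insert by simp
    have U: "submodule ?U K V" and W: "submodule ?W K V"
      using insert.prems by (auto intro!: span_submodule[OF V])
    have UW: "?U \<subseteq> ?W" unfolding submodule_span_def by blast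
    have Uc: "u \<in> carrier V" if "u \<in> ?U" for u using submodule_subset[OF U that] .
    have WV: "w \<in> carrier V" if "w \<in> ?W" for w using submodule_subset[OF W that] .
    have Wm: "right_module K (submod V ?W)" by (rule right_module_submod[OF V W])
    have decomp: "\<exists>u\<in>?U. \<exists>c\<in>carrier K. w = u \<oplus>\<^bsub>V\<^esub> c \<odot>\<^bsub>V\<^esub> b" if w: "w \<in> ?W" for w
    proof -
      have "?W \<subseteq> {u \<oplus>\<^bsub>V\<^esub> c \<odot>\<^bsub>V\<^esub> b | u c. u \<in> ?U \<and> c \<in> carrier K}"
        using submodule_adjoin[OF V U b] span_incl[of B K V] by (intro span_least) auto
      then show ?thesis using w by blast
    qed
    show ?case
    proof (rule finite_rank_codim_one[OF Wm, of ?U])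
      show "submodule ?U K (submod V ?W)" using U UW by (simp add: submodule_of_submod[OF V W])
      show "finite_rank K (submod (submod V ?W) ?U)" using insert by simp
      fix x y assume x: "x \<in> carrier (submod V ?W)" "x \<notin> ?U" and y: "y \<in> carrier (submod V ?W)"
      obtain u c where u: "u \<in> ?U" "c \<in> carrier K" "x = u \<oplus>\<^bsub>V\<^esub> c \<odot>\<^bsub>V\<^esub> b" using decomp[of x] x(1) by simp blast
      obtain v d where v: "v \<in> ?U" "d \<in> carrier K" "y = v \<oplus>\<^bsub>V\<^esub> d \<odot>\<^bsub>V\<^esub> b" using decomp[of y] y by simp blast
      have "c \<noteq> \<zero>\<^bsub>K\<^esub>" using x(2) u b Uc by auto
      then have c: "inv\<^bsub>K\<^esub> c \<in> carrier K" "c \<otimes>\<^bsub>K\<^esub> inv\<^bsub>K\<^esub> c = \<one>\<^bsub>K\<^esub>"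
        using u(2) K.field_Units by (auto simp: K.Units_r_inv K.Units_inv_closed)
      (* This multiple of x has the same coefficient at b as y. *)
      define e where "e = inv\<^bsub>K\<^esub> c \<otimes>\<^bsub>K\<^esub> d"
      have e: "e \<in> carrier K" "c \<otimes>\<^bsub>K\<^esub> e = d"
        using c v(2) u(2) by (auto simp: e_def simp flip: K.m_assoc)
      have "e \<odot>\<^bsub>V\<^esub> x = e \<odot>\<^bsub>V\<^esub> u \<oplus>\<^bsub>V\<^esub> d \<odot>\<^bsub>V\<^esub> b"
        using u e b Uc by (simp add: V.ract_r_distr flip: V.ract_assoc)
      then have "e \<odot>\<^bsub>V\<^esub> x \<oplus>\<^bsub>V\<^esub> (v \<ominus>\<^bsub>V\<^esub> e \<odot>\<^bsub>V\<^esub> u) = d \<odot>\<^bsub>V\<^esub> b \<oplus>\<^bsub>V\<^esub> (e \<odot>\<^bsub>V\<^esub> u \<oplus>\<^bsub>V\<^esub> (v \<ominus>\<^bsub>V\<^esub> e \<odot>\<^bsub>V\<^esub> u))"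
        using u v e b Uc by (simp add: V.a_ac)
      also have "\<dots> = y" using u v e b Uc by (simp add: V.add_diff_cancel V.a_comm)
      finally have eq: "e \<odot>\<^bsub>V\<^esub> x \<oplus>\<^bsub>V\<^esub> (v \<ominus>\<^bsub>V\<^esub> e \<odot>\<^bsub>V\<^esub> u) = y" .
      have exV: "e \<odot>\<^bsub>V\<^esub> x \<in> carrier V" using e WV x by simp
      have "y \<ominus>\<^bsub>V\<^esub> e \<odot>\<^bsub>V\<^esub> x = v \<ominus>\<^bsub>V\<^esub> e \<odot>\<^bsub>V\<^esub> u"
      proof -
        have "e \<odot>\<^bsub>V\<^esub> x \<oplus>\<^bsub>V\<^esub> (y \<ominus>\<^bsub>V\<^esub> e \<odot>\<^bsub>V\<^esub> x) = y" using exV WV y by (simp add: V.add_diff_cancel)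
        then have "e \<odot>\<^bsub>V\<^esub> x \<oplus>\<^bsub>V\<^esub> (y \<ominus>\<^bsub>V\<^esub> e \<odot>\<^bsub>V\<^esub> x) = e \<odot>\<^bsub>V\<^esub> x \<oplus>\<^bsub>V\<^esub> (v \<ominus>\<^bsub>V\<^esub> e \<odot>\<^bsub>V\<^esub> u)" using eq by simp
        then show ?thesis using exV WV y u v e Uc V.add.l_cancel by simp
      qed
      moreover have "v \<ominus>\<^bsub>V\<^esub> e \<odot>\<^bsub>V\<^esub> u \<in> ?U" using u v e by (intro submodule_diff[OF U] submodule_smult[OF U])
      moreover have "y \<ominus>\<^bsub>submod V ?W\<^esub> e \<odot>\<^bsub>submod V ?W\<^esub> x = y \<ominus>\<^bsub>V\<^esub> e \<odot>\<^bsub>V\<^esub> x"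
        using hom_diff[OF Wm V hom_submod_incl[OF W], of y "e \<odot>\<^bsub>V\<^esub> x"] x y e submodule_smult[OF W] by simp
      ultimately show "\<exists>c\<in>carrier K. y \<ominus>\<^bsub>submod V ?W\<^esub> c \<odot>\<^bsub>submod V ?W\<^esub> x \<in> ?U"
        using e(1) by metis
    qed
  qed
  moreover obtain B where "finite B" "B \<subseteq> carrier V" "submodule_span K V B = carrier V"
    using fg unfolding fg_module_def finitely_generated_def by blast
  ultimately show ?thesis by fastforce
qed

text \<open>
  Choose \<open>W\<close> maximal among the subspaces that contain \<open>H\<close> and avoid \<open>m\<close>; it is a complement of
  the line through \<open>m\<close>, and the coordinate along \<open>m\<close> is the functional.
\<close>

lemma ex_functional:
  assumes K: "field K" and V: "right_module K V" and rk: "finite_rank K V"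
    and H: "submodule H K V" and m: "m \<in> carrier V" "m \<notin> H"
  shows "\<exists>\<mu>\<in>module_hom K V (regular_module K). (\<forall>h\<in>H. \<mu> h = \<zero>\<^bsub>K\<^esub>) \<and> \<mu> m = \<one>\<^bsub>K\<^esub>"
proof -
  interpret K: field K by fact
  interpret V: right_module K V by fact
  define F where "F = {W. submodule W K V \<and> H \<subseteq> W \<and> m \<notin> W}"
  have "\<exists>W\<in>F. \<forall>T\<in>F. W \<subseteq> T \<longrightarrow> T = W"
  proof (rule finite_rank_maximal[OF rk])
    have "H \<in> F" using H m by (simp add: F_def)
    then show "F \<noteq> {}" by blast
    show "\<forall>W\<in>F. submodule W K V" by (simp add: F_def)
  qed
  then obtain W where WF: "W \<in> F" and max: "\<forall>T\<in>F. W \<subseteq> T \<longrightarrow> T = W"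
    by blast
  have W: "submodule W K V" "H \<subseteq> W" "m \<notin> W" using WF by (simp_all add: F_def)
  have Wc: "w \<in> carrier V" if "w \<in> W" for w using submodule_subset[OF W(1) that] .
  have inv: "inv\<^bsub>K\<^esub> c \<in> carrier K" "c \<otimes>\<^bsub>K\<^esub> inv\<^bsub>K\<^esub> c = \<one>\<^bsub>K\<^esub>" if "c \<in> carrier K" "c \<noteq> \<zero>\<^bsub>K\<^esub>" for c
    using that K.field_Units by (auto simp: K.Units_r_inv K.Units_inv_closed)
  have ex: "\<exists>c\<in>carrier K. x \<ominus>\<^bsub>V\<^esub> c \<odot>\<^bsub>V\<^esub> m \<in> W" if x: "x \<in> carrier V" for x
  proof (cases "x \<in> W")
    case True
    then have "x \<ominus>\<^bsub>V\<^esub> \<zero>\<^bsub>K\<^esub> \<odot>\<^bsub>V\<^esub> m \<in> W"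
      using submodule_diff[OF W(1) True submodule_zero[OF W(1)]] m by simp
    then show ?thesis using K.zero_closed by blast
  next
    case False
    let ?T = "{w \<oplus>\<^bsub>V\<^esub> c \<odot>\<^bsub>V\<^esub> x | w c. w \<in> W \<and> c \<in> carrier K}"
    have "?T \<notin> F" using max submodule_adjoin[OF V W(1) x] False by blast
    then have "m \<in> ?T" using submodule_adjoin[OF V W(1) x] W(2) unfolding F_def by blast
    then obtain w c where wc: "m = w \<oplus>\<^bsub>V\<^esub> c \<odot>\<^bsub>V\<^esub> x" "w \<in> W" "c \<in> carrier K" by blast
    have "c \<noteq> \<zero>\<^bsub>K\<^esub>" using W(3) wc x Wc by auto
    note i = inv[OF wc(3) this]
    have "inv\<^bsub>K\<^esub> c \<odot>\<^bsub>V\<^esub> m = inv\<^bsub>K\<^esub> c \<odot>\<^bsub>V\<^esub> w \<oplus>\<^bsub>V\<^esub> x"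
      using wc i x Wc by (simp add: V.ract_r_distr flip: V.ract_assoc)
    then have "x \<ominus>\<^bsub>V\<^esub> inv\<^bsub>K\<^esub> c \<odot>\<^bsub>V\<^esub> m = \<ominus>\<^bsub>V\<^esub> (inv\<^bsub>K\<^esub> c \<odot>\<^bsub>V\<^esub> w)"
      using i x Wc[OF wc(2)] by (simp add: a_minus_def V.minus_add V.a_lcomm[of x] V.r_neg)
    moreover have "\<ominus>\<^bsub>V\<^esub> (inv\<^bsub>K\<^esub> c \<odot>\<^bsub>V\<^esub> w) \<in> W"
      by (intro submodule_minus[OF W(1)] submodule_smult[OF W(1)] i wc)
    ultimately have "x \<ominus>\<^bsub>V\<^esub> inv\<^bsub>K\<^esub> c \<odot>\<^bsub>V\<^esub> m \<in> W" by simp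
    then show ?thesis using i(1) by blast
  qed
  have add: "(x \<oplus>\<^bsub>V\<^esub> y) \<ominus>\<^bsub>V\<^esub> (c \<oplus>\<^bsub>K\<^esub> d) \<odot>\<^bsub>V\<^esub> m = (x \<ominus>\<^bsub>V\<^esub> c \<odot>\<^bsub>V\<^esub> m) \<oplus>\<^bsub>V\<^esub> (y \<ominus>\<^bsub>V\<^esub> d \<odot>\<^bsub>V\<^esub> m)"
    if "x \<in> carrier V" "y \<in> carrier V" "c \<in> carrier K" "d \<in> carrier K" for x y c d
    using that m by (simp add: a_minus_def V.ract_l_distr V.minus_add V.a_ac)
  have smult: "a \<odot>\<^bsub>V\<^esub> x \<ominus>\<^bsub>V\<^esub> (c \<otimes>\<^bsub>K\<^esub> a) \<odot>\<^bsub>V\<^esub> m = a \<odot>\<^bsub>V\<^esub> (x \<ominus>\<^bsub>V\<^esub> c \<odot>\<^bsub>V\<^esub> m)"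
    if "x \<in> carrier V" "a \<in> carrier K" "c \<in> carrier K" for x a c
    using that m by (simp add: a_minus_def V.ract_r_distr V.ract_assoc V.ract_minus)
  have uniq: "c = d" if x: "x \<in> carrier V" and cd: "c \<in> carrier K" "d \<in> carrier K"
    "x \<ominus>\<^bsub>V\<^esub> c \<odot>\<^bsub>V\<^esub> m \<in> W" "x \<ominus>\<^bsub>V\<^esub> d \<odot>\<^bsub>V\<^esub> m \<in> W" for x c d
  proof (rule ccontr)
    assume "c \<noteq> d"
    (* The difference of the two elements of W is (d - c) m, and d - c is invertible. *)
    let ?e = "d \<ominus>\<^bsub>K\<^esub> c"
    have e: "?e \<in> carrier K" "?e \<noteq> \<zero>\<^bsub>K\<^esub>" using cd \<open>c \<noteq> d\<close> by auto
    let ?a = "\<ominus>\<^bsub>K\<^esub> \<one>\<^bsub>K\<^esub>"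
    have "?a \<odot>\<^bsub>V\<^esub> x \<ominus>\<^bsub>V\<^esub> (c \<otimes>\<^bsub>K\<^esub> ?a) \<odot>\<^bsub>V\<^esub> m \<in> W"
      using submodule_smult[OF W(1) _ cd(3), of ?a] smult[OF x _ cd(1), of ?a] by simp
    then have "(x \<oplus>\<^bsub>V\<^esub> ?a \<odot>\<^bsub>V\<^esub> x) \<ominus>\<^bsub>V\<^esub> (d \<oplus>\<^bsub>K\<^esub> c \<otimes>\<^bsub>K\<^esub> ?a) \<odot>\<^bsub>V\<^esub> m \<in> W"
      using submodule_add[OF W(1) cd(4)] x cd by (simp add: add)
    moreover have "x \<oplus>\<^bsub>V\<^esub> ?a \<odot>\<^bsub>V\<^esub> x = \<zero>\<^bsub>V\<^esub>" using x by (simp add: V.ract_minus_one V.r_neg)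
    moreover have "d \<oplus>\<^bsub>K\<^esub> c \<otimes>\<^bsub>K\<^esub> ?a = ?e" using cd by (simp add: K.r_minus K.minus_eq)
    ultimately have "\<ominus>\<^bsub>V\<^esub> (?e \<odot>\<^bsub>V\<^esub> m) \<in> W" using e(1) m(1) by (simp add: V.minus_eq)
    then have "?e \<odot>\<^bsub>V\<^esub> m \<in> W" using submodule_minus[OF W(1)] e(1) m(1) by fastforce
    then have "inv\<^bsub>K\<^esub> ?e \<odot>\<^bsub>V\<^esub> (?e \<odot>\<^bsub>V\<^esub> m) \<in> W" using submodule_smult[OF W(1) inv(1)[OF e]] by blast
    then show False using W(3) inv[OF e] e(1) m by (simp flip: V.ract_assoc)
  qed
  define \<mu> where "\<mu> x = (SOME c. c \<in> carrier K \<and> x \<ominus>\<^bsub>V\<^esub> c \<odot>\<^bsub>V\<^esub> m \<in> W)" for x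
  have \<mu>: "\<mu> x \<in> carrier K" "x \<ominus>\<^bsub>V\<^esub> \<mu> x \<odot>\<^bsub>V\<^esub> m \<in> W" if "x \<in> carrier V" for x
    using someI_ex[of "\<lambda>c. c \<in> carrier K \<and> x \<ominus>\<^bsub>V\<^esub> c \<odot>\<^bsub>V\<^esub> m \<in> W"] ex[OF that] unfolding \<mu>_def by blast+
  have \<mu>I: "\<mu> x = c" if "x \<in> carrier V" "c \<in> carrier K" "x \<ominus>\<^bsub>V\<^esub> c \<odot>\<^bsub>V\<^esub> m \<in> W" for x c
    using uniq[OF that(1) \<mu>(1)[OF that(1)] that(2) \<mu>(2)[OF that(1)] that(3)] .
  have "\<mu> \<in> module_hom K V (regular_module K)"
  proof (rule module_homI)
    fix x y assume xy: "x \<in> carrier V" "y \<in> carrier V"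
    then have "(x \<oplus>\<^bsub>V\<^esub> y) \<ominus>\<^bsub>V\<^esub> (\<mu> x \<oplus>\<^bsub>K\<^esub> \<mu> y) \<odot>\<^bsub>V\<^esub> m \<in> W"
      using submodule_add[OF W(1) \<mu>(2)[OF xy(1)] \<mu>(2)[OF xy(2)]] by (simp add: add \<mu>)
    then show "\<mu> (x \<oplus>\<^bsub>V\<^esub> y) = \<mu> x \<oplus>\<^bsub>regular_module K\<^esub> \<mu> y" using xy \<mu> by (simp add: \<mu>I)
  next
    fix a x assume ax: "a \<in> carrier K" "x \<in> carrier V"
    then have "a \<odot>\<^bsub>V\<^esub> x \<ominus>\<^bsub>V\<^esub> (\<mu> x \<otimes>\<^bsub>K\<^esub> a) \<odot>\<^bsub>V\<^esub> m \<in> W"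
      using submodule_smult[OF W(1) ax(1) \<mu>(2)[OF ax(2)]] by (simp add: smult \<mu>)
    then show "\<mu> (a \<odot>\<^bsub>V\<^esub> x) = a \<odot>\<^bsub>regular_module K\<^esub> \<mu> x" using ax \<mu> by (simp add: \<mu>I)
  qed (use \<mu> in auto)
  moreover have "\<mu> h = \<zero>\<^bsub>K\<^esub>" if "h \<in> H" for h
  proof -
    have h: "h \<in> W" "h \<in> carrier V" using that W(2) Wc by auto
    have "h \<ominus>\<^bsub>V\<^esub> \<zero>\<^bsub>K\<^esub> \<odot>\<^bsub>V\<^esub> m \<in> W"
      using submodule_diff[OF W(1) h(1) submodule_zero[OF W(1)]] m by simp
    then show ?thesis using \<mu>I[OF h(2)] by simp
  qed
  moreover have "\<mu> m = \<one>\<^bsub>K\<^esub>"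
  proof -
    have "m \<ominus>\<^bsub>V\<^esub> \<one>\<^bsub>K\<^esub> \<odot>\<^bsub>V\<^esub> m = \<zero>\<^bsub>V\<^esub>" using m by simp
    then have "m \<ominus>\<^bsub>V\<^esub> \<one>\<^bsub>K\<^esub> \<odot>\<^bsub>V\<^esub> m \<in> W" using submodule_zero[OF W(1)] by metis
    then show ?thesis using \<mu>I[OF m(1)] by simp
  qed
  ultimately show ?thesis by blast
qed


section \<open>Modules over a finite-dimensional algebra\<close>

text \<open>
  A field element \<open>c\<close> acts as the central element \<open>c 1\<close> of \<open>A\<close>.
\<close>

definition restrict_scalars :: "('k, 'a) module \<Rightarrow> ('a, 'm) module \<Rightarrow> ('k, 'm) module" where
  "restrict_scalars A M = \<lparr>carrier = carrier M, monoid.mult = undefined, one = undefined,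
     ring.zero = \<zero>\<^bsub>M\<^esub>, ring.add = ring.add M, smult = (\<lambda>c x. (c \<odot>\<^bsub>A\<^esub> \<one>\<^bsub>A\<^esub>) \<odot>\<^bsub>M\<^esub> x)\<rparr>"

lemma restrict_scalars_simps [simp]:
  "carrier (restrict_scalars A M) = carrier M" "\<zero>\<^bsub>restrict_scalars A M\<^esub> = \<zero>\<^bsub>M\<^esub>"
  "x \<oplus>\<^bsub>restrict_scalars A M\<^esub> y = x \<oplus>\<^bsub>M\<^esub> y"
  "c \<odot>\<^bsub>restrict_scalars A M\<^esub> x = (c \<odot>\<^bsub>A\<^esub> \<one>\<^bsub>A\<^esub>) \<odot>\<^bsub>M\<^esub> x"
  by (simp_all add: restrict_scalars_def)

context finite_dimensional_algebra
begin

lemma field_K: "field K" and ring_A: "ring A" and ring_K: "ring K"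
  by (rule K.field_axioms A.ring_axioms R.ring_axioms)+

lemma scalar_mult_right: "c \<in> carrier K \<Longrightarrow> x \<in> carrier A \<Longrightarrow> x \<otimes>\<^bsub>A\<^esub> (c \<odot>\<^bsub>A\<^esub> \<one>\<^bsub>A\<^esub>) = c \<odot>\<^bsub>A\<^esub> x"
  by (simp add: smult_mult_right)

lemma scalar_mult_left: "c \<in> carrier K \<Longrightarrow> x \<in> carrier A \<Longrightarrow> (c \<odot>\<^bsub>A\<^esub> \<one>\<^bsub>A\<^esub>) \<otimes>\<^bsub>A\<^esub> x = c \<odot>\<^bsub>A\<^esub> x"
  by (simp add: smult_mult_left)

lemma right_module_K_A: "right_module K A"
proof (intro right_module.intro right_module_axioms.intro)
  show "ring K" "abelian_group A" by (rule ring_K M.abelian_group_axioms)+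
  fix a b x assume ab: "a \<in> carrier K" "b \<in> carrier K" "x \<in> carrier A"
  then have "(a \<otimes>\<^bsub>K\<^esub> b) \<odot>\<^bsub>A\<^esub> x = (b \<otimes>\<^bsub>K\<^esub> a) \<odot>\<^bsub>A\<^esub> x" by (simp add: R.m_comm)
  then show "(a \<otimes>\<^bsub>K\<^esub> b) \<odot>\<^bsub>A\<^esub> x = b \<odot>\<^bsub>A\<^esub> (a \<odot>\<^bsub>A\<^esub> x)" using ab by (simp add: smult_assoc1)
qed (auto simp: smult_l_distr smult_r_distr)

lemma fg_K_A: "fg_module K A"
  using right_module_K_A fin_dim by (simp add: fg_module_def)

lemma right_module_restrict_scalars:
  assumes "right_module A M" shows "right_module K (restrict_scalars A M)"
proof -
  interpret N: right_module A M by fact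
  have "abelian_group (restrict_scalars A M)"
  proof (rule abelian_groupI)
    fix x assume "x \<in> carrier (restrict_scalars A M)"
    then show "\<exists>y\<in>carrier (restrict_scalars A M). y \<oplus>\<^bsub>restrict_scalars A M\<^esub> x = \<zero>\<^bsub>restrict_scalars A M\<^esub>"
      by (intro bexI[of _ "\<ominus>\<^bsub>M\<^esub> x"]) (auto simp: N.l_neg)
  qed (auto simp: N.a_ac)
  then show ?thesis
  proof (intro right_module.intro right_module_axioms.intro ring_K)
    fix a b x assume ab: "a \<in> carrier K" "b \<in> carrier K" "x \<in> carrier (restrict_scalars A M)"
    have "(a \<otimes>\<^bsub>K\<^esub> b) \<odot>\<^bsub>A\<^esub> \<one>\<^bsub>A\<^esub> = (a \<odot>\<^bsub>A\<^esub> \<one>\<^bsub>A\<^esub>) \<otimes>\<^bsub>A\<^esub> (b \<odot>\<^bsub>A\<^esub> \<one>\<^bsub>A\<^esub>)"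
      using ab by (simp add: scalar_mult_left smult_assoc1)
    then show "(a \<otimes>\<^bsub>K\<^esub> b) \<odot>\<^bsub>restrict_scalars A M\<^esub> x =
        b \<odot>\<^bsub>restrict_scalars A M\<^esub> (a \<odot>\<^bsub>restrict_scalars A M\<^esub> x)"
      using ab by (simp add: N.ract_assoc)
  next
    fix a b x assume "a \<in> carrier K" "b \<in> carrier K" "x \<in> carrier (restrict_scalars A M)"
    then show "(a \<oplus>\<^bsub>K\<^esub> b) \<odot>\<^bsub>restrict_scalars A M\<^esub> x =
        a \<odot>\<^bsub>restrict_scalars A M\<^esub> x \<oplus>\<^bsub>restrict_scalars A M\<^esub> b \<odot>\<^bsub>restrict_scalars A M\<^esub> x"
      by (simp add: smult_l_distr N.ract_l_distr)
  next
    fix x assume "x \<in> carrier (restrict_scalars A M)"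
    then show "\<one>\<^bsub>K\<^esub> \<odot>\<^bsub>restrict_scalars A M\<^esub> x = x" by simp
  qed (auto simp: N.ract_r_distr)
qed

lemma submodule_restrict_scalars:
  assumes "right_module A M" "submodule H A M"
  shows "submodule H K (restrict_scalars A M)"
  unfolding submodule_iff[OF right_module_restrict_scalars[OF assms(1)]]
  using assms(2)[unfolded submodule_iff[OF assms(1)]] by simp

lemma hom_restrict_scalars:
  "f \<in> module_hom A M N \<Longrightarrow> f \<in> module_hom K (restrict_scalars A M) (restrict_scalars A N)"
  by (intro module_homI) (auto simp: hom_closed hom_add[of f A] hom_smult[of f A])

lemma hom_orbit:
  assumes "right_module A M" "m \<in> carrier M"
  shows "(\<lambda>a. a \<odot>\<^bsub>M\<^esub> m) \<in> module_hom K A (restrict_scalars A M)"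
proof -
  interpret N: right_module A M by fact
  show ?thesis
  proof (rule module_homI)
    fix c a assume ca: "c \<in> carrier K" "a \<in> carrier A"
    then have "(c \<odot>\<^bsub>A\<^esub> a) \<odot>\<^bsub>M\<^esub> m = (a \<otimes>\<^bsub>A\<^esub> (c \<odot>\<^bsub>A\<^esub> \<one>\<^bsub>A\<^esub>)) \<odot>\<^bsub>M\<^esub> m" by (simp add: scalar_mult_right)
    then show "(c \<odot>\<^bsub>A\<^esub> a) \<odot>\<^bsub>M\<^esub> m = c \<odot>\<^bsub>restrict_scalars A M\<^esub> (a \<odot>\<^bsub>M\<^esub> m)"
      using ca assms(2) by (simp add: N.ract_assoc)
  qed (use assms(2) in \<open>auto simp: N.ract_l_distr\<close>)
qed

lemma finite_rank_restrict_scalars: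
  assumes M: "right_module A M" and rk: "finite_rank K (restrict_scalars A M)"
  shows "finite_rank A M"
proof -
  obtain \<rho> :: "_ set \<Rightarrow> nat" and n where \<rho>: "\<forall>H. \<rho> H \<le> n"
    "\<forall>H H'. submodule H K (restrict_scalars A M) \<longrightarrow> submodule H' K (restrict_scalars A M) \<longrightarrow>
      H \<subset> H' \<longrightarrow> \<rho> H < \<rho> H'"
    using rk unfolding finite_rank_def by blast
  have "\<forall>H H'. submodule H A M \<longrightarrow> submodule H' A M \<longrightarrow> H \<subset> H' \<longrightarrow> \<rho> H < \<rho> H'"
    using \<rho>(2) submodule_restrict_scalars[OF M] by simp
  with \<rho>(1) show ?thesis unfolding finite_rank_def by (intro exI[of _ \<rho>] exI[of _ n] conjI)
qed

text \<open>
  The products of generators of \<open>M\<close> over \<open>A\<close> with generators of \<open>A\<close> over \<open>K\<close> span \<open>M\<close>. For a subspace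
  \<open>W\<close> containing them, \<open>Y\<close> is the largest \<open>A\<close>-submodule inside \<open>W\<close>, and it contains the generators
  of \<open>M\<close>.
\<close>

lemma fg_restrict_scalars:
  assumes fg: "fg_module A M" shows "fg_module K (restrict_scalars A M)"
proof -
  have M: "right_module A M" using fg by (rule fg_right_module)
  interpret N: right_module A M by fact
  let ?M = "restrict_scalars A M"
  have MK: "right_module K ?M" by (rule right_module_restrict_scalars[OF M])
  obtain B where B: "finite B" "B \<subseteq> carrier M"
    "\<And>H. submodule H A M \<Longrightarrow> B \<subseteq> H \<Longrightarrow> carrier M \<subseteq> H"
    using fg_moduleE[OF fg] by blast
  obtain C where C: "finite C" "C \<subseteq> carrier A"
    "\<And>H. submodule H K A \<Longrightarrow> C \<subseteq> H \<Longrightarrow> carrier A \<subseteq> H"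
    using fg_moduleE[OF fg_K_A] by blast
  let ?G = "(\<lambda>(c, b). c \<odot>\<^bsub>M\<^esub> b) ` (C \<times> B)"
  show ?thesis
  proof (rule fg_moduleI[OF MK, of ?G])
    show "finite ?G" using B(1) C(1) by simp
    show "?G \<subseteq> carrier ?M" using B(2) C(2) by auto
    fix W assume W: "submodule W K ?M" "?G \<subseteq> W"
    define Y where "Y = {x \<in> carrier M. \<forall>a\<in>carrier A. a \<odot>\<^bsub>M\<^esub> x \<in> W}"
    have "submodule Y A M"
    proof (rule N.right_submoduleI)
      show "Y \<subseteq> carrier M" by (auto simp: Y_def)
      show "\<zero>\<^bsub>M\<^esub> \<in> Y" using submodule_zero[OF W(1)] by (simp add: Y_def)
      show "x \<oplus>\<^bsub>M\<^esub> y \<in> Y" if "x \<in> Y" "y \<in> Y" for x y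
        using that submodule_add[OF W(1)] by (simp add: Y_def N.ract_r_distr)
      show "a \<odot>\<^bsub>M\<^esub> x \<in> Y" if "a \<in> carrier A" "x \<in> Y" for a x
        using that by (simp add: Y_def flip: N.ract_assoc)
    qed
    moreover have "B \<subseteq> Y"
    proof
      fix b assume b: "b \<in> B"
      then have bM: "b \<in> carrier M" using B(2) by blast
      have "submodule {a \<in> carrier A. a \<odot>\<^bsub>M\<^esub> b \<in> W} K A"
        by (rule submodule_vimage[OF right_module_K_A MK hom_orbit[OF M bM] W(1)])
      moreover have "C \<subseteq> {a \<in> carrier A. a \<odot>\<^bsub>M\<^esub> b \<in> W}" using C(2) W(2) b by auto
      ultimately have "carrier A \<subseteq> {a \<in> carrier A. a \<odot>\<^bsub>M\<^esub> b \<in> W}" by (rule C(3))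
      then show "b \<in> Y" using bM by (auto simp: Y_def)
    qed
    ultimately have "carrier M \<subseteq> Y" by (rule B(3))
    then have "x \<in> W" if "x \<in> carrier M" for x
      using that N.ract_one[OF that] unfolding Y_def by (metis (mono_tags, lifting) A.one_closed mem_Collect_eq subsetD)
    then show "carrier ?M \<subseteq> W" by auto
  qed
qed

lemma finite_rank_fg_module:
  assumes "fg_module A M" shows "finite_rank A M"
  using finite_rank_restrict_scalars[OF fg_right_module[OF assms]
      finite_rank_vector_space[OF field_K fg_restrict_scalars[OF assms]]] .

lemma fg_submod:
  assumes "fg_module A M" "submodule H A M" shows "fg_module A (submod M H)"
  by (rule finite_rank_noetherian[OF fg_right_module[OF assms(1)] finite_rank_fg_module[OF assms(1)] assms(2)])

section \<open>The dual of the algebra is an injective cogenerator\<close>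

text \<open>
  The functionals \<open>A \<rightarrow> K\<close> with the right action \<open>(f a)(x) = f (a x)\<close>. They are extensional off the
  carrier of \<open>A\<close>, so that functionals agreeing on \<open>A\<close> are equal.
\<close>

definition dual_module :: "('a, 'a \<Rightarrow> 'k) module" where
  "dual_module = \<lparr>carrier = module_hom K A (regular_module K) \<inter> extensional (carrier A),
     monoid.mult = undefined, one = undefined, ring.zero = (\<lambda>x\<in>carrier A. \<zero>\<^bsub>K\<^esub>),
     ring.add = (\<lambda>f g. \<lambda>x\<in>carrier A. f x \<oplus>\<^bsub>K\<^esub> g x), smult = (\<lambda>a f. \<lambda>x\<in>carrier A. f (a \<otimes>\<^bsub>A\<^esub> x))\<rparr>"

lemma dual_simps [simp]:
  "\<zero>\<^bsub>dual_module\<^esub> = (\<lambda>x\<in>carrier A. \<zero>\<^bsub>K\<^esub>)"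
  "f \<oplus>\<^bsub>dual_module\<^esub> g = (\<lambda>x\<in>carrier A. f x \<oplus>\<^bsub>K\<^esub> g x)"
  "a \<odot>\<^bsub>dual_module\<^esub> f = (\<lambda>x\<in>carrier A. f (a \<otimes>\<^bsub>A\<^esub> x))"
  by (simp_all add: dual_module_def)

lemma dual_hom: "f \<in> carrier dual_module \<Longrightarrow> f \<in> module_hom K A (regular_module K)"
  by (simp add: dual_module_def)

lemma dual_closed: "f \<in> carrier dual_module \<Longrightarrow> x \<in> carrier A \<Longrightarrow> f x \<in> carrier K"
  using hom_closed[OF dual_hom] by simp

lemma dual_add: "f \<in> carrier dual_module \<Longrightarrow> x \<in> carrier A \<Longrightarrow> y \<in> carrier A \<Longrightarrow>
    f (x \<oplus>\<^bsub>A\<^esub> y) = f x \<oplus>\<^bsub>K\<^esub> f y"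
  using hom_add[OF dual_hom] by simp

lemma dual_smult: "f \<in> carrier dual_module \<Longrightarrow> c \<in> carrier K \<Longrightarrow> x \<in> carrier A \<Longrightarrow>
    f (c \<odot>\<^bsub>A\<^esub> x) = f x \<otimes>\<^bsub>K\<^esub> c"
  using hom_smult[OF dual_hom] by simp

lemma dual_eqI: "f \<in> carrier dual_module \<Longrightarrow> g \<in> carrier dual_module \<Longrightarrow>
    (\<And>x. x \<in> carrier A \<Longrightarrow> f x = g x) \<Longrightarrow> f = g"
  by (auto simp: dual_module_def intro: extensionalityI)

lemma dual_memI:
  assumes "\<And>x. x \<in> carrier A \<Longrightarrow> g x \<in> carrier K"
    and "\<And>x y. x \<in> carrier A \<Longrightarrow> y \<in> carrier A \<Longrightarrow> g (x \<oplus>\<^bsub>A\<^esub> y) = g x \<oplus>\<^bsub>K\<^esub> g y"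
    and "\<And>c x. c \<in> carrier K \<Longrightarrow> x \<in> carrier A \<Longrightarrow> g (c \<odot>\<^bsub>A\<^esub> x) = g x \<otimes>\<^bsub>K\<^esub> c"
  shows "(\<lambda>x\<in>carrier A. g x) \<in> carrier dual_module"
  using assms by (auto simp: dual_module_def intro!: module_homI)

lemma right_module_dual: "right_module A dual_module"
proof -
  have zero: "(\<lambda>x\<in>carrier A. \<zero>\<^bsub>K\<^esub>) \<in> carrier dual_module" by (rule dual_memI) auto
  have add: "(\<lambda>x\<in>carrier A. f x \<oplus>\<^bsub>K\<^esub> g x) \<in> carrier dual_module"
    if "f \<in> carrier dual_module" "g \<in> carrier dual_module" for f g
    using that by (intro dual_memI) (auto simp: dual_closed dual_add dual_smult R.l_distr R.a_ac)
  have smult: "(\<lambda>x\<in>carrier A. f (a \<otimes>\<^bsub>A\<^esub> x)) \<in> carrier dual_module"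
    if "f \<in> carrier dual_module" "a \<in> carrier A" for f a
    using that by (intro dual_memI) (auto simp: dual_closed dual_add dual_smult A.r_distr smult_mult_right)
  have neg: "(\<lambda>x\<in>carrier A. \<ominus>\<^bsub>K\<^esub> f x) \<in> carrier dual_module" if "f \<in> carrier dual_module" for f
    using that by (intro dual_memI) (auto simp: dual_closed dual_add dual_smult R.minus_add R.l_minus)
  have "abelian_group dual_module"
  proof (rule abelian_groupI)
    fix f g h assume fgh: "f \<in> carrier dual_module" "g \<in> carrier dual_module" "h \<in> carrier dual_module"
    show "(f \<oplus>\<^bsub>dual_module\<^esub> g) \<oplus>\<^bsub>dual_module\<^esub> h = f \<oplus>\<^bsub>dual_module\<^esub> (g \<oplus>\<^bsub>dual_module\<^esub> h)"
      using fgh by (auto simp: fun_eq_iff restrict_def dual_closed R.a_assoc)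
  next
    fix f g assume fg: "f \<in> carrier dual_module" "g \<in> carrier dual_module"
    show "f \<oplus>\<^bsub>dual_module\<^esub> g = g \<oplus>\<^bsub>dual_module\<^esub> f"
      using fg by (auto simp: fun_eq_iff restrict_def dual_closed R.a_comm)
  next
    fix f assume f: "f \<in> carrier dual_module"
    show "\<zero>\<^bsub>dual_module\<^esub> \<oplus>\<^bsub>dual_module\<^esub> f = f"
      using f add[OF zero f] by (intro dual_eqI) (auto simp: dual_closed)
    show "\<exists>g\<in>carrier dual_module. g \<oplus>\<^bsub>dual_module\<^esub> f = \<zero>\<^bsub>dual_module\<^esub>"
      using f neg[OF f] by (intro bexI[of _ "\<lambda>x\<in>carrier A. \<ominus>\<^bsub>K\<^esub> f x"])
        (auto simp: fun_eq_iff restrict_def dual_closed R.l_neg)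
  qed (use zero add in auto)
  then show ?thesis
  proof (intro right_module.intro right_module_axioms.intro ring_A)
    fix a b f assume *: "a \<in> carrier A" "b \<in> carrier A" "f \<in> carrier dual_module"
    show "(a \<oplus>\<^bsub>A\<^esub> b) \<odot>\<^bsub>dual_module\<^esub> f = a \<odot>\<^bsub>dual_module\<^esub> f \<oplus>\<^bsub>dual_module\<^esub> b \<odot>\<^bsub>dual_module\<^esub> f"
      using * by (auto simp: fun_eq_iff restrict_def A.l_distr dual_add)
    show "(a \<otimes>\<^bsub>A\<^esub> b) \<odot>\<^bsub>dual_module\<^esub> f = b \<odot>\<^bsub>dual_module\<^esub> (a \<odot>\<^bsub>dual_module\<^esub> f)"
      using * by (auto simp: fun_eq_iff restrict_def A.m_assoc)
  next
    fix a f g assume "a \<in> carrier A" "f \<in> carrier dual_module" "g \<in> carrier dual_module"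
    then show "a \<odot>\<^bsub>dual_module\<^esub> (f \<oplus>\<^bsub>dual_module\<^esub> g) = a \<odot>\<^bsub>dual_module\<^esub> f \<oplus>\<^bsub>dual_module\<^esub> a \<odot>\<^bsub>dual_module\<^esub> g"
      by (auto simp: fun_eq_iff restrict_def)
  next
    fix f assume f: "f \<in> carrier dual_module"
    then show "\<one>\<^bsub>A\<^esub> \<odot>\<^bsub>dual_module\<^esub> f = f" using smult[OF f, of "\<one>\<^bsub>A\<^esub>"] by (intro dual_eqI) auto
  qed (use smult in auto)
qed

text \<open>
  Vanishing on one more element of a generating set of \<open>A\<close> cuts the dual down by at most one
  dimension, so the dual has finite rank.
\<close>

lemma fg_dual: "fg_module A dual_module"
proof -
  let ?D = "restrict_scalars A dual_module"
  have D: "right_module K ?D" by (rule right_module_restrict_scalars[OF right_module_dual])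
  obtain C where C: "finite C" "C \<subseteq> carrier A"
    "\<And>H. submodule H K A \<Longrightarrow> C \<subseteq> H \<Longrightarrow> carrier A \<subseteq> H"
    using fg_moduleE[OF fg_K_A] by blast
  have smultD: "(c \<odot>\<^bsub>?D\<^esub> f) x = f x \<otimes>\<^bsub>K\<^esub> c" if "c \<in> carrier K" "f \<in> carrier dual_module" "x \<in> carrier A" for c f x
    using that by (simp add: scalar_mult_left dual_smult)
  have addD: "(f \<oplus>\<^bsub>?D\<^esub> g) x = f x \<oplus>\<^bsub>K\<^esub> g x" if "x \<in> carrier A" for f g x
    using that by simp
  have cancel: "b = \<zero>\<^bsub>K\<^esub>" if "a \<in> carrier K" "b \<in> carrier K" "a \<oplus>\<^bsub>K\<^esub> b = a" for a b
    using R.r_neg1[OF that(1,2)] that by (simp add: R.l_neg)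
  define U where "U Y = {f \<in> carrier dual_module. \<forall>y\<in>Y. f y = \<zero>\<^bsub>K\<^esub>}" for Y
  have U: "submodule (U Y) K ?D" if Y: "Y \<subseteq> carrier A" for Y
  proof -
    interpret D: right_module K ?D by (rule D)
    have Yc: "y \<in> carrier A" if "y \<in> Y" for y using that Y by blast
    show ?thesis
    proof (rule D.right_submoduleI)
      show "U Y \<subseteq> carrier ?D" by (auto simp: U_def)
      show "\<zero>\<^bsub>?D\<^esub> \<in> U Y" using D.zero_closed by (auto simp: U_def Yc)
      show "f \<oplus>\<^bsub>?D\<^esub> g \<in> U Y" if "f \<in> U Y" "g \<in> U Y" for f g
        using that D.a_closed[of f g] by (auto simp: U_def Yc)
      show "c \<odot>\<^bsub>?D\<^esub> f \<in> U Y" if cf: "c \<in> carrier K" "f \<in> U Y" for c f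
      proof -
        have "(c \<odot>\<^bsub>?D\<^esub> f) y = \<zero>\<^bsub>K\<^esub>" if "y \<in> Y" for y
          using smultD[of c f y] cf that Yc by (simp add: U_def del: restrict_scalars_simps)
        moreover have "c \<odot>\<^bsub>?D\<^esub> f \<in> carrier dual_module"
          using D.ract_closed[OF cf(1), of f] cf(2) by (simp add: U_def)
        ultimately show ?thesis unfolding U_def by blast
      qed
    qed
  qed
  (* U Y consists of the functionals vanishing on Y; the conditions in Y are dropped one by one. *)
  have "finite_rank K (submod ?D (U {}))"
    if "finite Y" "Y \<subseteq> carrier A" "finite_rank K (submod ?D (U Y))" for Y
    using that
  proof (induction Y rule: finite_induct)
    case empty
    then show ?case by blast
  next
    case (insert y Y)
    have Y: "Y \<subseteq> carrier A" and y: "y \<in> carrier A" using insert.prems(1) by auto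
    have sub: "submodule (U Y) K ?D" by (rule U[OF Y])
    have DU: "right_module K (submod ?D (U Y))" by (rule right_module_submod[OF D sub])
    have "finite_rank K (submod ?D (U Y))"
    proof (rule finite_rank_codim_one[OF DU, of "U (insert y Y)"])
      have "U (insert y Y) \<subseteq> U Y" by (auto simp: U_def)
      then show "submodule (U (insert y Y)) K (submod ?D (U Y))"
        using U[OF insert.prems(1)] by (simp add: submodule_of_submod[OF D sub])
      show "finite_rank K (submod (submod ?D (U Y)) (U (insert y Y)))" using insert.prems(2) by simp
      fix f g assume f: "f \<in> carrier (submod ?D (U Y))" "f \<notin> U (insert y Y)" and g: "g \<in> carrier (submod ?D (U Y))"
      have fU: "f \<in> U Y" and gU: "g \<in> U Y" using f(1) g by simp_all
      have fD: "f \<in> carrier dual_module" and gD: "g \<in> carrier dual_module" using fU gU by (simp_all add: U_def)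
      have fy: "f y \<in> carrier K" "f y \<noteq> \<zero>\<^bsub>K\<^esub>" using f(2) fU dual_closed[OF fD y] by (auto simp: U_def)
      then have i: "inv\<^bsub>K\<^esub> (f y) \<in> carrier K" "f y \<otimes>\<^bsub>K\<^esub> inv\<^bsub>K\<^esub> (f y) = \<one>\<^bsub>K\<^esub>"
        using K.field_Units by (auto simp: R.Units_r_inv R.Units_inv_closed)
      (* With this factor, g minus the multiple of f vanishes at y as well. *)
      define c where "c = inv\<^bsub>K\<^esub> (f y) \<otimes>\<^bsub>K\<^esub> g y"
      have gy: "g y \<in> carrier K" by (rule dual_closed[OF gD y])
      have c: "c \<in> carrier K" "f y \<otimes>\<^bsub>K\<^esub> c = g y" using i fy gy by (auto simp: c_def simp flip: R.m_assoc)
      have cf: "c \<odot>\<^bsub>?D\<^esub> f \<in> U Y" by (rule submodule_smult[OF sub c(1) fU])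
      let ?h = "g \<ominus>\<^bsub>?D\<^esub> c \<odot>\<^bsub>?D\<^esub> f"
      have hU: "?h \<in> U Y" by (rule submodule_diff[OF sub gU cf])
      have hD: "?h \<in> carrier dual_module" using hU by (simp add: U_def)
      have "c \<odot>\<^bsub>?D\<^esub> f \<oplus>\<^bsub>?D\<^esub> ?h = g"
        using right_module.add_diff_cancel[OF D, of g "c \<odot>\<^bsub>?D\<^esub> f"] gD cf by (simp add: U_def)
      then have "(c \<odot>\<^bsub>?D\<^esub> f) y \<oplus>\<^bsub>K\<^esub> ?h y = g y"
        using addD[OF y, of "c \<odot>\<^bsub>?D\<^esub> f" ?h] by (simp del: restrict_scalars_simps dual_simps)
      then have "g y \<oplus>\<^bsub>K\<^esub> ?h y = g y" using smultD[OF c(1) fD y] c(2) by simp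
      then have "?h y = \<zero>\<^bsub>K\<^esub>" using gy dual_closed[OF hD y] by (rule cancel[rotated -1])
      then have "?h \<in> U (insert y Y)" using hU by (simp add: U_def)
      moreover have "g \<ominus>\<^bsub>submod ?D (U Y)\<^esub> c \<odot>\<^bsub>submod ?D (U Y)\<^esub> f = ?h"
        using hom_diff[OF DU D hom_submod_incl[OF sub], of g "c \<odot>\<^bsub>?D\<^esub> f"] gU cf by simp
      ultimately show "\<exists>c\<in>carrier K. g \<ominus>\<^bsub>submod ?D (U Y)\<^esub> c \<odot>\<^bsub>submod ?D (U Y)\<^esub> f \<in> U (insert y Y)"
        using c(1) by metis
    qed
    then show ?case by (rule insert.IH[OF Y])
  qed
  moreover have "finite_rank K (submod ?D (U C))"
  proof (rule finite_rank_zero)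
    have "f = \<zero>\<^bsub>dual_module\<^esub>" if f: "f \<in> U C" for f
    proof -
      have fD: "f \<in> carrier dual_module" using f by (simp add: U_def)
      have "submodule {x \<in> carrier A. f x \<in> {\<zero>\<^bsub>regular_module K\<^esub>}} K A"
        by (rule submodule_vimage[OF right_module_K_A right_module_regular[OF ring_K] dual_hom[OF fD]
              submodule_trivial[OF right_module_regular[OF ring_K]]])
      moreover have "C \<subseteq> {x \<in> carrier A. f x \<in> {\<zero>\<^bsub>regular_module K\<^esub>}}" using f C(2) by (auto simp: U_def)
      ultimately have "carrier A \<subseteq> {x \<in> carrier A. f x \<in> {\<zero>\<^bsub>regular_module K\<^esub>}}" by (rule C(3))
      then have "f x = \<zero>\<^bsub>K\<^esub>" if "x \<in> carrier A" for x using that by auto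
      then show ?thesis
        using fD abelian_monoid.zero_closed[of dual_module] right_module_dual
        by (intro dual_eqI) (auto simp: right_module_def abelian_group_def)
    qed
    then have "U C \<subseteq> {\<zero>\<^bsub>dual_module\<^esub>}" by blast
    moreover have "\<zero>\<^bsub>dual_module\<^esub> \<in> U C"
      using submodule_zero[OF U[OF C(2)]] by (simp only: restrict_scalars_simps)
    ultimately have "U C = {\<zero>\<^bsub>dual_module\<^esub>}" by blast
    then show "carrier (submod ?D (U C)) = {\<zero>\<^bsub>submod ?D (U C)\<^esub>}" by (simp del: dual_simps)
  qed
  ultimately have "finite_rank K (submod ?D (U {}))" using C(1,2) by blast
  moreover have "U {} = carrier ?D" by (simp add: U_def)
  ultimately have "finite_rank K ?D" by (simp del: restrict_scalars_simps)
  then have "finite_rank A dual_module" by (rule finite_rank_restrict_scalars[OF right_module_dual])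
  then show ?thesis by (rule finite_rank_fg[OF right_module_dual])
qed

text \<open>The adjunction \<open>Hom\<^sub>A(M, Hom\<^sub>K(A, K)) = Hom\<^sub>K(M, K)\<close>, from right to left.\<close>

lemma functional_hom:
  assumes M: "right_module A M"
    and \<mu>: "\<mu> \<in> module_hom K (restrict_scalars A M) (regular_module K)"
  shows "(\<lambda>m. \<lambda>a\<in>carrier A. \<mu> (a \<odot>\<^bsub>M\<^esub> m)) \<in> module_hom A M dual_module"
proof -
  interpret N: right_module A M by fact
  have closed: "\<mu> x \<in> carrier K" if "x \<in> carrier M" for x using hom_closed[OF \<mu>] that by simp
  have add: "\<mu> (x \<oplus>\<^bsub>M\<^esub> y) = \<mu> x \<oplus>\<^bsub>K\<^esub> \<mu> y" if "x \<in> carrier M" "y \<in> carrier M" for x y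
    using hom_add[OF \<mu>] that by simp
  have smult: "\<mu> ((c \<odot>\<^bsub>A\<^esub> \<one>\<^bsub>A\<^esub>) \<odot>\<^bsub>M\<^esub> x) = \<mu> x \<otimes>\<^bsub>K\<^esub> c" if "c \<in> carrier K" "x \<in> carrier M" for c x
    using hom_smult[OF \<mu>] that by simp
  show ?thesis
  proof (rule module_homI)
    fix m assume m: "m \<in> carrier M"
    show "(\<lambda>a\<in>carrier A. \<mu> (a \<odot>\<^bsub>M\<^esub> m)) \<in> carrier dual_module"
    proof (rule dual_memI)
      fix c x assume cx: "c \<in> carrier K" "x \<in> carrier A"
      have "(c \<odot>\<^bsub>A\<^esub> x) \<odot>\<^bsub>M\<^esub> m = (c \<odot>\<^bsub>A\<^esub> \<one>\<^bsub>A\<^esub>) \<odot>\<^bsub>M\<^esub> (x \<odot>\<^bsub>M\<^esub> m)"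
        using hom_smult[OF hom_orbit[OF M m] cx] by simp
      then show "\<mu> ((c \<odot>\<^bsub>A\<^esub> x) \<odot>\<^bsub>M\<^esub> m) = \<mu> (x \<odot>\<^bsub>M\<^esub> m) \<otimes>\<^bsub>K\<^esub> c" using cx m by (simp add: smult)
    qed (use m in \<open>auto simp: closed add N.ract_l_distr\<close>)
  qed (auto simp: fun_eq_iff restrict_def add N.ract_r_distr N.ract_assoc)
qed

text \<open>
  By the adjunction it suffices to extend the functional \<open>l\<close> on \<open>M\<close> with \<open>l m = (f m) 1\<close> along \<open>g\<close>. If \<open>l\<close> is
  not zero, choose \<open>u\<close> with \<open>l u = 1\<close>; a functional on \<open>N\<close> that kills \<open>g (ker l)\<close> and takes the value
  \<open>1\<close> at \<open>g u\<close> restricts to \<open>l\<close>.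
\<close>

lemma injective_dual: "injective_module A dual_module"
  unfolding injective_module_def
proof (intro ballI impI)
  fix M N :: "('a, 'a list) module" and g f
  assume *: "M \<in> mod_cat A" "N \<in> mod_cat A" "g \<in> module_hom A M N" "f \<in> module_hom A M dual_module"
    "inj_on g (carrier M)"
  let ?M = "restrict_scalars A M" and ?N = "restrict_scalars A N"
  have M: "right_module A M" and N: "right_module A N" using *(1,2) by (auto simp: mod_cat_def)
  have MK: "right_module K ?M" and NK: "right_module K ?N"
    by (intro right_module_restrict_scalars M N)+
  interpret M: right_module A M by (rule M)
  interpret MK: right_module K ?M by (rule MK)
  note RK = right_module_regular[OF ring_K]
  have gK: "g \<in> module_hom K ?M ?N" by (rule hom_restrict_scalars[OF *(3)])
  define l where "l m = f m \<one>\<^bsub>A\<^esub>" for m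
  have fD: "f m \<in> carrier dual_module" if "m \<in> carrier M" for m using hom_closed[OF *(4) that] .
  have l_smult: "l (a \<odot>\<^bsub>M\<^esub> m) = f m a" if "a \<in> carrier A" "m \<in> carrier M" for a m
    using hom_smult[OF *(4) that] that by (simp add: l_def)
  have l: "l \<in> module_hom K ?M (regular_module K)"
  proof (rule module_homI)
    fix c m assume cm: "c \<in> carrier K" "m \<in> carrier ?M"
    then have "l (c \<odot>\<^bsub>?M\<^esub> m) = f m (c \<odot>\<^bsub>A\<^esub> \<one>\<^bsub>A\<^esub>)" by (simp add: l_smult)
    then show "l (c \<odot>\<^bsub>?M\<^esub> m) = c \<odot>\<^bsub>regular_module K\<^esub> l m" using cm fD by (simp add: dual_smult l_def)
  qed (use fD in \<open>auto simp: l_def dual_closed hom_add[OF *(4)]\<close>)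
  have lc: "l m \<in> carrier K" if "m \<in> carrier M" for m using hom_closed[OF l] that by simp
  show "\<exists>h\<in>module_hom A N dual_module. \<forall>x\<in>carrier M. h (g x) = f x"
  proof (cases "\<forall>m\<in>carrier M. l m = \<zero>\<^bsub>K\<^esub>")
    case True
    have "\<zero>\<^bsub>dual_module\<^esub> = f x" if x: "x \<in> carrier M" for x
    proof (rule dual_eqI)
      show "\<zero>\<^bsub>dual_module\<^esub> \<in> carrier dual_module"
        using submodule_zero[OF submodule_carrier[OF right_module_dual]] .
      show "f x \<in> carrier dual_module" by (rule fD[OF x])
      show "\<zero>\<^bsub>dual_module\<^esub> a = f x a" if "a \<in> carrier A" for a
        using l_smult[OF that x] True that x by simp
    qed
    then have "\<forall>x\<in>carrier M. \<zero>\<^bsub>dual_module\<^esub> = f x" by blast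
    then show ?thesis by (rule bexI[OF _ hom_const_zero[OF right_module_dual]])
  next
    case False
    then obtain v where v: "v \<in> carrier M" "l v \<noteq> \<zero>\<^bsub>K\<^esub>" by blast
    have i: "inv\<^bsub>K\<^esub> (l v) \<in> carrier K" "l v \<otimes>\<^bsub>K\<^esub> inv\<^bsub>K\<^esub> (l v) = \<one>\<^bsub>K\<^esub>"
      using K.field_Units v lc[OF v(1)] by (auto simp: R.Units_r_inv R.Units_inv_closed)
    define u where "u = inv\<^bsub>K\<^esub> (l v) \<odot>\<^bsub>?M\<^esub> v"
    have u: "u \<in> carrier M" "l u = \<one>\<^bsub>K\<^esub>"
      using MK.ract_closed[OF i(1), of v] v(1) hom_smult[OF l i(1), of v] i(2) by (simp_all add: u_def)
    let ?ker = "module_kernel ?M (regular_module K) l"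
    have ker: "submodule ?ker K ?M" by (rule submodule_kernel[OF MK RK l])
    have gker: "submodule (g ` ?ker) K ?N" by (rule submodule_image[OF MK NK gK ker])
    have gu: "g u \<in> carrier ?N" using hom_closed[OF *(3) u(1)] by simp
    have "g u \<notin> g ` ?ker"
    proof
      assume "g u \<in> g ` ?ker"
      then obtain k where k: "k \<in> ?ker" "g u = g k" by blast
      then have "u = k" using *(5) u(1) by (auto simp: in_module_kernel dest: inj_onD)
      then show False using k(1) u(2) by (simp add: in_module_kernel)
    qed
    moreover have "finite_rank K ?N"
      using *(2) by (intro finite_rank_vector_space[OF field_K] fg_restrict_scalars) (simp add: mod_cat_iff)
    ultimately obtain \<mu> where \<mu>: "\<mu> \<in> module_hom K ?N (regular_module K)"
      "\<forall>h\<in>g ` ?ker. \<mu> h = \<zero>\<^bsub>K\<^esub>" "\<mu> (g u) = \<one>\<^bsub>K\<^esub>"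
      using ex_functional[OF field_K NK _ gker gu] by blast
    have \<mu>g: "\<mu> (g m) = l m" if m: "m \<in> carrier M" for m
    proof -
      let ?k = "m \<ominus>\<^bsub>?M\<^esub> l m \<odot>\<^bsub>?M\<^esub> u"
      have lu: "l m \<odot>\<^bsub>?M\<^esub> u \<in> carrier ?M" using u(1) lc[OF m] MK.ract_closed[of "l m" u] by simp
      have kc: "?k \<in> carrier ?M" using MK.minus_closed[of m "l m \<odot>\<^bsub>?M\<^esub> u"] m lu by simp
      have llu: "l (l m \<odot>\<^bsub>?M\<^esub> u) = l m" using hom_smult[OF l lc[OF m], of u] u lc[OF m] by simp
      have "l ?k = \<zero>\<^bsub>K\<^esub>"
        using hom_diff[OF MK RK l, of m "l m \<odot>\<^bsub>?M\<^esub> u"] m lu llu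
          right_module.diff_eq_zero[OF RK, of "l m" "l m"] lc[OF m] by simp
      then have "?k \<in> ?ker" using kc by (simp add: in_module_kernel)
      then have mk: "\<mu> (g ?k) = \<zero>\<^bsub>K\<^esub>" using \<mu>(2) by blast
      have gm: "g m = g (l m \<odot>\<^bsub>?M\<^esub> u) \<oplus>\<^bsub>?N\<^esub> g ?k"
        using hom_add[OF gK lu kc] MK.add_diff_cancel[of m "l m \<odot>\<^bsub>?M\<^esub> u"] m lu by simp
      have "\<mu> (g m) = \<mu> (g (l m \<odot>\<^bsub>?M\<^esub> u)) \<oplus>\<^bsub>regular_module K\<^esub> \<mu> (g ?k)"
        unfolding gm by (rule hom_add[OF \<mu>(1) hom_closed[OF gK lu] hom_closed[OF gK kc]])
      also have "g (l m \<odot>\<^bsub>?M\<^esub> u) = l m \<odot>\<^bsub>?N\<^esub> g u" by (rule hom_smult[OF gK lc[OF m]]) (simp add: u(1))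
      also have "\<mu> (l m \<odot>\<^bsub>?N\<^esub> g u) = l m \<odot>\<^bsub>regular_module K\<^esub> \<mu> (g u)" by (rule hom_smult[OF \<mu>(1) lc[OF m] gu])
      finally show ?thesis using mk \<mu>(3) lc[OF m] by simp
    qed
    have "(\<lambda>a\<in>carrier A. \<mu> (a \<odot>\<^bsub>N\<^esub> g m)) = f m" if m: "m \<in> carrier M" for m
    proof (rule dual_eqI)
      show "(\<lambda>a\<in>carrier A. \<mu> (a \<odot>\<^bsub>N\<^esub> g m)) \<in> carrier dual_module"
        using hom_closed[OF functional_hom[OF N \<mu>(1)] hom_closed[OF *(3) m]] .
      show "f m \<in> carrier dual_module" by (rule fD[OF m])
      fix a assume a: "a \<in> carrier A"
      have "\<mu> (a \<odot>\<^bsub>N\<^esub> g m) = \<mu> (g (a \<odot>\<^bsub>M\<^esub> m))" using hom_smult[OF *(3) a m] by simp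
      also have "\<dots> = f m a" using a m by (simp add: \<mu>g l_smult)
      finally show "(\<lambda>a\<in>carrier A. \<mu> (a \<odot>\<^bsub>N\<^esub> g m)) a = f m a" using a by simp
    qed
    then show ?thesis by (intro bexI[OF _ functional_hom[OF N \<mu>(1)]] ballI)
  qed
qed

text \<open>
  A functional that does not vanish at \<open>x\<close> induces a map to the dual that does not vanish at \<open>x\<close>.
\<close>

lemma enough_injectives:
  assumes M: "fg_module A M"
  shows "\<exists>J\<in>mod_cat A. injective_module A J \<and> (\<exists>f\<in>module_hom A M J. inj_on f (carrier M))"
proof -
  have Mm: "right_module A M" using M by (rule fg_right_module)
  obtain D i j where D: "D \<in> mod_cat A" "inverse_homs A dual_module D i j" using fg_ex_iso[OF fg_dual] by blast
  note ij = inverse_homsD[OF D(2)]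
  have Dm: "right_module A D" using D(1) by (simp add: mod_cat_def)
  have injD: "injective_module A D" by (rule injective_retract[OF injective_dual ij(2,1)]) (rule ij(4))
  let ?M = "restrict_scalars A M"
  show ?thesis
  proof (rule embed_by_cogeneration[where \<Phi> = "injective_module A", OF Mm finite_rank_fg_module[OF M] _ D(1) injD])
    fix I J L :: "('a, 'a list) module" and i j
    assume *: "injective_module A I" "injective_module A J" "inverse_homs A (direct_sum I J) L i j"
    note ij = inverse_homsD[OF *(3)]
    show "injective_module A L"
      by (rule injective_retract[OF injective_direct_sum[OF *(1,2)] ij(2,1)]) (rule ij(4))
  next
    fix H assume H: "submodule H A M" "H \<noteq> {\<zero>\<^bsub>M\<^esub>}"
    then obtain x where x: "x \<in> H" "x \<noteq> \<zero>\<^bsub>M\<^esub>" using submodule_zero[OF H(1)] by blast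
    have xM: "x \<in> carrier M" by (rule submodule_subset[OF H(1) x(1)])
    have MK: "right_module K ?M" by (rule right_module_restrict_scalars[OF Mm])
    have "finite_rank K ?M" by (rule finite_rank_vector_space[OF field_K fg_restrict_scalars[OF M]])
    then obtain \<mu> where \<mu>: "\<mu> \<in> module_hom K ?M (regular_module K)" "\<mu> x = \<one>\<^bsub>K\<^esub>"
      using ex_functional[OF field_K MK _ submodule_trivial[OF MK], of x] x(2) xM by auto
    let ?f = "\<lambda>m. \<lambda>a\<in>carrier A. \<mu> (a \<odot>\<^bsub>M\<^esub> m)"
    have f: "?f \<in> module_hom A M dual_module" by (rule functional_hom[OF Mm \<mu>(1)])
    have "?f x \<one>\<^bsub>A\<^esub> = \<one>\<^bsub>K\<^esub>" using \<mu>(2) right_module.ract_one[OF Mm xM] by simp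
    moreover have "\<zero>\<^bsub>dual_module\<^esub> \<one>\<^bsub>A\<^esub> = \<zero>\<^bsub>K\<^esub>" by simp
    ultimately have nz: "?f x \<noteq> \<zero>\<^bsub>dual_module\<^esub>" using K.one_not_zero by metis
    have "i (?f x) \<noteq> \<zero>\<^bsub>D\<^esub>"
    proof
      assume "i (?f x) = \<zero>\<^bsub>D\<^esub>"
      then have "j (i (?f x)) = \<zero>\<^bsub>dual_module\<^esub>" using hom_zero[OF Dm right_module_dual ij(2)] by simp
      then show False using nz ij(3)[OF hom_closed[OF f xM]] by simp
    qed
    then show "\<exists>J\<in>mod_cat A. injective_module A J \<and> (\<exists>f\<in>module_hom A M J. \<exists>x\<in>H. f x \<noteq> \<zero>\<^bsub>J\<^esub>)"
      by (intro bexI[OF _ D(1)] conjI injD bexI[OF _ hom_comp[OF f ij(1)]] bexI[OF _ x(1)])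
  qed
qed


section \<open>Injective envelopes and minimal injective resolutions\<close>

text \<open>
  Embed \<open>M\<close> into an injective \<open>J\<close> and divide by a submodule \<open>W\<close> maximal among those that meet \<open>M\<close> only in
  zero. By maximality \<open>M\<close> is essential in \<open>Q = J/W\<close>. The embedding of \<open>M\<close> into \<open>J\<close> extends to \<open>g : Q \<rightarrow> J\<close>,
  and \<open>Q \<rightarrow> J \<rightarrow> Q\<close> is an automorphism because it is the identity on \<open>M\<close>. So \<open>Q\<close> is a retract of \<open>J\<close>.
\<close>

lemma ex_injective_envelope:
  assumes M: "fg_module A M"
  shows "\<exists>E\<in>mod_cat A. injective_module A E \<and>
    (\<exists>e\<in>module_hom A M E. inj_on e (carrier M) \<and> essential_submodule A E (e ` carrier M))"
proof -
  have Mm: "right_module A M" using M by (rule fg_right_module)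
  obtain J f where J: "J \<in> mod_cat A" "injective_module A J"
    and f: "f \<in> module_hom A M J" "inj_on f (carrier M)"
    using enough_injectives[OF M] by blast
  have Jm: "right_module A J" using J(1) by (simp add: mod_cat_def)
  have Jfg: "fg_module A J" using J(1) by (simp add: mod_cat_iff)
  define F where "F = {W. submodule W A J \<and> W \<inter> f ` carrier M = {\<zero>\<^bsub>J\<^esub>}}"
  have "\<exists>W\<in>F. \<forall>T\<in>F. W \<subseteq> T \<longrightarrow> T = W"
  proof (rule finite_rank_maximal[OF finite_rank_fg_module[OF Jfg]])
    have "\<zero>\<^bsub>J\<^esub> \<in> f ` carrier M"
      by (rule submodule_zero[OF submodule_image[OF Mm Jm f(1) submodule_carrier[OF Mm]]])
    then have "{\<zero>\<^bsub>J\<^esub>} \<in> F" using submodule_trivial[OF Jm] by (simp add: F_def)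
    then show "F \<noteq> {}" by blast
    show "\<forall>W\<in>F. submodule W A J" by (simp add: F_def)
  qed
  then obtain W where WF: "W \<in> F" and max: "\<And>T. T \<in> F \<Longrightarrow> W \<subseteq> T \<Longrightarrow> T = W" by blast
  have W: "submodule W A J" "W \<inter> f ` carrier M = {\<zero>\<^bsub>J\<^esub>}" using WF by (simp_all add: F_def)
  obtain Q q where Q: "Q \<in> mod_cat A" and q: "q \<in> module_hom A J Q" "q ` carrier J = carrier Q"
    "module_kernel J Q q = W"
    using ex_quotient[OF Jfg W(1)] by blast
  have Qm: "right_module A Q" using Q by (simp add: mod_cat_def)
  have Qfg: "fg_module A Q" using Q by (simp add: mod_cat_iff)
  let ?e = "\<lambda>x. q (f x)"
  have e: "?e \<in> module_hom A M Q" by (rule hom_comp[OF f(1) q(1)])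
  have q0: "y \<in> W" if "y \<in> carrier J" "q y = \<zero>\<^bsub>Q\<^esub>" for y
    using that q(3) by (auto simp: in_module_kernel)
  have f0: "f x = \<zero>\<^bsub>J\<^esub>" if "x \<in> carrier M" "?e x = \<zero>\<^bsub>Q\<^esub>" for x
    using q0[OF hom_closed[OF f(1) that(1)] that(2)] W(2) that(1) by blast
  have inj: "inj_on ?e (carrier M)"
  proof (rule hom_inj_onI[OF Mm Qm e])
    fix x assume x: "x \<in> carrier M" "?e x = \<zero>\<^bsub>Q\<^esub>"
    show "x = \<zero>\<^bsub>M\<^esub>" by (rule hom_inj_zero[OF Mm Jm f x(1) f0[OF x]])
  qed
  have ess: "essential_submodule A Q (?e ` carrier M)"
    unfolding essential_submodule_def
  proof (intro conjI allI impI)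
    show "submodule (?e ` carrier M) A Q" by (rule submodule_image[OF Mm Qm e submodule_carrier[OF Mm]])
    fix T assume T: "submodule T A Q" "?e ` carrier M \<inter> T = {\<zero>\<^bsub>Q\<^esub>}"
    define V where "V = {y \<in> carrier J. q y \<in> T}"
    have V: "submodule V A J" unfolding V_def by (rule submodule_vimage[OF Jm Qm q(1) T(1)])
    have "y = \<zero>\<^bsub>J\<^esub>" if y: "y \<in> V" "y \<in> f ` carrier M" for y
    proof -
      obtain x where x: "x \<in> carrier M" "y = f x" using y(2) by blast
      have "?e x \<in> T" using y(1) x(2) by (simp add: V_def)
      then have "?e x = \<zero>\<^bsub>Q\<^esub>" using T(2) x(1) by blast
      then show ?thesis using f0[OF x(1)] x(2) by simp
    qed
    moreover have "\<zero>\<^bsub>J\<^esub> \<in> f ` carrier M" using W(2) by blast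
    ultimately have "V \<inter> f ` carrier M = {\<zero>\<^bsub>J\<^esub>}" using submodule_zero[OF V] by blast
    then have VF: "V \<in> F" using V by (simp add: F_def)
    (* V meets M only in zero and contains W, so it equals W by maximality, and its image T is zero. *)
    have "W \<subseteq> V"
    proof
      fix y assume "y \<in> W"
      then have "y \<in> module_kernel J Q q" using q(3) by simp
      then show "y \<in> V" using submodule_zero[OF T(1)] by (simp add: V_def in_module_kernel)
    qed
    then have VW: "V = W" by (rule max[OF VF])
    have "t = \<zero>\<^bsub>Q\<^esub>" if t: "t \<in> T" for t
    proof -
      have "t \<in> q ` carrier J" using submodule_subset[OF T(1) t] q(2) by simp
      then obtain y where y: "y \<in> carrier J" "t = q y" by blast
      then have "y \<in> module_kernel J Q q" using t VW q(3) by (auto simp: V_def)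
      then show ?thesis using y(2) by (simp add: in_module_kernel)
    qed
    then show "T = {\<zero>\<^bsub>Q\<^esub>}" using submodule_zero[OF T(1)] by blast
  qed
  obtain g where g: "g \<in> module_hom A Q J" "\<And>x. x \<in> carrier M \<Longrightarrow> g (?e x) = f x"
    using injective_extend[OF J(2) M Qfg e inj f(1)] by blast
  (* The endomorphism t fixes the essential image of M, hence is injective, hence bijective. *)
  let ?t = "\<lambda>y. q (g y)"
  have t: "?t \<in> module_hom A Q Q" by (rule hom_comp[OF g(1) q(1)])
  have kt: "submodule (module_kernel Q Q ?t) A Q" by (rule submodule_kernel[OF Qm Qm t])
  have "y = \<zero>\<^bsub>Q\<^esub>" if "y \<in> ?e ` carrier M" "y \<in> module_kernel Q Q ?t" for y
    using that g(2) by (auto simp: in_module_kernel)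
  moreover have "\<zero>\<^bsub>Q\<^esub> \<in> ?e ` carrier M"
    by (rule submodule_zero[OF submodule_image[OF Mm Qm e submodule_carrier[OF Mm]]])
  ultimately have "?e ` carrier M \<inter> module_kernel Q Q ?t = {\<zero>\<^bsub>Q\<^esub>}" using submodule_zero[OF kt] by blast
  then have "module_kernel Q Q ?t = {\<zero>\<^bsub>Q\<^esub>}" using ess kt unfolding essential_submodule_def by blast
  then have tinj: "inj_on ?t (carrier Q)"
    by (intro hom_inj_onI[OF Qm Qm t]) (auto simp: module_kernel_def)
  have "?t ` carrier Q = carrier Q"
    by (rule finite_rank_surj_endo[OF Qm finite_rank_fg_module[OF Qfg] t tinj])
  then have "bij_betw ?t (carrier Q) (carrier Q)" using tinj by (simp add: bij_betw_def)
  note ti = inverse_homsD[OF inverse_homs_inv[OF Qm t this]]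
  have "injective_module A Q"
    by (rule injective_retract[OF J(2) g(1) hom_comp[OF q(1) ti(2)]]) (rule ti(3))
  then show ?thesis using Q e inj ess by (intro bexI[OF _ Q] conjI bexI[OF _ e])
qed

lemma ex_cosyzygy_envelope:
  assumes M: "fg_module A M" and H: "submodule H A M"
  shows "\<exists>E\<in>mod_cat A. injective_module A E \<and>
    (\<exists>d\<in>module_hom A M E. module_kernel M E d = H \<and> essential_submodule A E (d ` carrier M))"
proof -
  obtain Q q where Q: "Q \<in> mod_cat A" and q: "q \<in> module_hom A M Q" "q ` carrier M = carrier Q"
    "module_kernel M Q q = H"
    using ex_quotient[OF M H] by blast
  have Qm: "right_module A Q" using Q by (simp add: mod_cat_def)
  have Qfg: "fg_module A Q" using Q by (simp add: mod_cat_iff)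
  obtain E e where E: "E \<in> mod_cat A" "injective_module A E"
    and e: "e \<in> module_hom A Q E" "inj_on e (carrier Q)" "essential_submodule A E (e ` carrier Q)"
    using ex_injective_envelope[OF Qfg] by blast
  have Em: "right_module A E" using E(1) by (simp add: mod_cat_def)
  have d: "(\<lambda>x. e (q x)) \<in> module_hom A M E" by (rule hom_comp[OF q(1) e(1)])
  have "e (q x) = \<zero>\<^bsub>E\<^esub> \<longleftrightarrow> q x = \<zero>\<^bsub>Q\<^esub>" if "x \<in> carrier M" for x
    using hom_inj_zero[OF Qm Em e(1,2) hom_closed[OF q(1) that]] hom_zero[OF Qm Em e(1)] by auto
  then have "module_kernel M E (\<lambda>x. e (q x)) = H" unfolding q(3)[symmetric] module_kernel_def by auto
  moreover have "(\<lambda>x. e (q x)) ` carrier M = e ` carrier Q" unfolding q(2)[symmetric] by (simp add: image_image)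
  ultimately show ?thesis using E(2) e(3) by (intro bexI[OF _ E(1)] conjI bexI[OF _ d]) simp_all
qed

text \<open>
  The recursion carries the current term together with the image of the incoming map; the next map
  has this image as its kernel.
\<close>

lemma ex_minimal_injective_resolution:
  assumes M: "fg_module A M"
  shows "\<exists>I e d. minimal_injective_resolution A M I e d"
proof -
  obtain E0 e where E0: "E0 \<in> mod_cat A" "injective_module A E0" and e: "e \<in> module_hom A M E0"
    "inj_on e (carrier M)" "essential_submodule A E0 (e ` carrier M)"
    using ex_injective_envelope[OF M] by blast
  have "\<exists>E d. N \<in> mod_cat A \<and> submodule H A N \<longrightarrow>
      E \<in> mod_cat A \<and> injective_module A E \<and> d \<in> module_hom A N E \<and>
      module_kernel N E d = H \<and> essential_submodule A E (d ` carrier N)"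
    for N :: "('a, 'a list) module" and H
  proof (cases "N \<in> mod_cat A \<and> submodule H A N")
    case True
    then have "fg_module A N" by (simp add: mod_cat_iff)
    with True obtain E d where "E \<in> mod_cat A" "injective_module A E" "d \<in> module_hom A N E"
      "module_kernel N E d = H" "essential_submodule A E (d ` carrier N)"
      using ex_cosyzygy_envelope[of N H] by blast
    then show ?thesis by blast
  qed blast
  then obtain nx :: "('a, 'a list) module \<Rightarrow> 'a list set \<Rightarrow> ('a, 'a list) module"
    and dd :: "('a, 'a list) module \<Rightarrow> 'a list set \<Rightarrow> 'a list \<Rightarrow> 'a list"
    where step: "\<And>N H. N \<in> mod_cat A \<Longrightarrow> submodule H A N \<Longrightarrow>
      nx N H \<in> mod_cat A \<and> injective_module A (nx N H) \<and> dd N H \<in> module_hom A N (nx N H) \<and>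
      module_kernel N (nx N H) (dd N H) = H \<and> essential_submodule A (nx N H) (dd N H ` carrier N)"
    by metis
  define st where "st = rec_nat (E0, e ` carrier M)
    (\<lambda>_ (N, H). (nx N H, dd N H ` carrier N))"
  define I where "I i = fst (st i)" for i
  define H where "H i = snd (st i)" for i
  define d where "d i = dd (I i) (H i)" for i
  have I0: "I 0 = E0" "H 0 = e ` carrier M" by (simp_all add: I_def H_def st_def)
  have ISuc: "I (Suc i) = nx (I i) (H i)" "H (Suc i) = d i ` carrier (I i)" for i
    by (simp_all add: I_def H_def d_def st_def split_beta)
  have inv: "I i \<in> mod_cat A \<and> injective_module A (I i) \<and> essential_submodule A (I i) (H i)" for i
  proof (induction i)
    case 0
    then show ?case using E0 e(3) by (simp add: I0)
  next
    case (Suc i)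
    then show ?case using step[of "I i" "H i"] by (simp add: ISuc d_def essential_submodule_def)
  qed
  have dI: "d i \<in> module_hom A (I i) (I (Suc i)) \<and> module_kernel (I i) (I (Suc i)) (d i) = H i" for i
    using step[of "I i" "H i"] inv[of i] by (simp add: ISuc d_def essential_submodule_def)
  have "minimal_injective_resolution A M I e d"
    unfolding minimal_injective_resolution_def
  proof (intro conjI allI)
    fix i
    show "module_kernel (I (Suc i)) (I (Suc (Suc i))) (d (Suc i)) = d i ` carrier (I i)"
      using dI[of "Suc i"] by (simp add: ISuc(2))
    show "essential_submodule A (I (Suc i)) (d i ` carrier (I i))"
      using inv[of "Suc i"] by (simp add: ISuc(2))
    show "essential_submodule A (I 0) (e ` carrier M)" using inv[of 0] by (simp add: I0)
    show "module_kernel (I 0) (I 1) (d 0) = e ` carrier M" using dI[of 0] by (simp add: I0)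
  qed (use inv dI e in \<open>auto simp: I0\<close>)
  then show ?thesis by blast
qed

section \<open>Projective dimension at most one\<close>

definition short_projective_resolution :: "('a, 'm) module \<Rightarrow> bool" where
  "short_projective_resolution M \<longleftrightarrow> (\<exists>P\<in>mod_cat A. projective_module A P \<and>
     (\<exists>p\<in>module_hom A P M. p ` carrier P = carrier M \<and>
        projective_module A (submod P (module_kernel P M p))))"

text \<open>
  Frees the middle term from being an object of \<^const>\<open>mod_cat\<close>: in the main application it is a
  direct sum, whose elements are pairs.
\<close>

lemma short_projective_resolutionI:
  assumes P: "fg_module A P" "projective_module A P" and M: "right_module A M"
    and p: "p \<in> module_hom A P M" "p ` carrier P = carrier M"
    and K: "projective_module A (submod P (module_kernel P M p))"
  shows "short_projective_resolution M"
proof -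
  have Pm: "right_module A P" using P(1) by (rule fg_right_module)
  obtain Q i j where Q: "Q \<in> mod_cat A" "inverse_homs A P Q i j" using fg_ex_iso[OF P(1)] by blast
  note ij = inverse_homsD[OF Q(2)]
  have Qm: "right_module A Q" using Q(1) by (simp add: mod_cat_def)
  let ?r = "\<lambda>y. p (j y)"
  have r: "?r \<in> module_hom A Q M" by (rule hom_comp[OF ij(2) p(1)])
  have surj: "?r ` carrier Q = carrier M"
  proof
    show "?r ` carrier Q \<subseteq> carrier M" using hom_closed[OF r] by blast
    show "carrier M \<subseteq> ?r ` carrier Q"
    proof
      fix y assume "y \<in> carrier M"
      then obtain x where x: "x \<in> carrier P" "y = p x" using p(2) by blast
      then show "y \<in> ?r ` carrier Q"
        using hom_closed[OF ij(1) x(1)] ij(3)[OF x(1)] by (intro image_eqI[of _ _ "i x"]) simp_all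
    qed
  qed
  let ?K = "module_kernel P M p" and ?L = "module_kernel Q M ?r"
  have subK: "submodule ?K A P" by (rule submodule_kernel[OF Pm M p(1)])
  have subL: "submodule ?L A Q" by (rule submodule_kernel[OF Qm M r])
  have "j \<in> module_hom A (submod Q ?L) (submod P ?K)"
    by (rule hom_corestrict[OF hom_restrict[OF ij(2) subL]])
      (simp add: in_module_kernel hom_closed[OF ij(2)])
  moreover have "i \<in> module_hom A (submod P ?K) (submod Q ?L)"
    by (rule hom_corestrict[OF hom_restrict[OF ij(1) subK]])
      (simp add: in_module_kernel hom_closed[OF ij(1)] ij(3))
  ultimately have "projective_module A (submod Q ?L)"
    by (rule projective_retract[OF K]) (simp add: in_module_kernel ij(4))
  moreover have "projective_module A Q" by (rule projective_retract[OF P(2) ij(2,1)]) (rule ij(4))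
  ultimately show ?thesis unfolding short_projective_resolution_def
    using surj by (intro bexI[OF _ Q(1)] conjI bexI[OF _ r])
qed

lemma proj_dim_le_1_iff:
  assumes M: "right_module A M"
  shows "proj_dim A M \<le> 1 \<longleftrightarrow> short_projective_resolution M"
proof
  assume "proj_dim A M \<le> 1"
  then have "proj_dim A M \<le> enat 1" by (simp add: one_enat_def)
  then obtain P e d where res: "projective_resolution A M P e d"
    and zero: "\<forall>i>1. carrier (P i) = {\<zero>\<^bsub>P i\<^esub>}" by (rule finite_projective_resolution)
  have P: "P i \<in> mod_cat A" "projective_module A (P i)" for i
    using res by (simp_all add: projective_resolution_def)
  have Pm: "right_module A (P i)" for i using P(1)[of i] by (simp add: mod_cat_def)
  have e: "e \<in> module_hom A (P 0) M" "e ` carrier (P 0) = carrier M"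
    "module_kernel (P 0) M e = d 0 ` carrier (P 1)" and d: "d 0 \<in> module_hom A (P 1) (P 0)"
    using res by (simp_all add: projective_resolution_def)
  have "inj_on (d 0) (carrier (P 1))" using resolution_monic[OF res, of 0] zero by simp
  then have "projective_module A (submod (P 0) (module_kernel (P 0) M e))"
    unfolding e(3) by (rule projective_image_of_monic[OF Pm P(2) Pm d])
  then show "short_projective_resolution M"
    unfolding short_projective_resolution_def using P e by blast
next
  assume "short_projective_resolution M"
  then obtain P p where P: "P \<in> mod_cat A" "projective_module A P" and p: "p \<in> module_hom A P M"
    "p ` carrier P = carrier M" and K: "projective_module A (submod P (module_kernel P M p))"
    unfolding short_projective_resolution_def by blast
  have Pm: "right_module A P" using P(1) by (simp add: mod_cat_def)
  let ?K = "module_kernel P M p" and ?Z = "submod P {\<zero>\<^bsub>P\<^esub>}"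
  have subK: "submodule ?K A P" by (rule submodule_kernel[OF Pm M p(1)])
  have subZ: "submodule {\<zero>\<^bsub>P\<^esub>} A P" by (rule submodule_trivial[OF Pm])
  have Km: "right_module A (submod P ?K)" and Zm: "right_module A ?Z"
    by (intro right_module_submod Pm subK subZ)+
  have KZ: "submod P ?K \<in> mod_cat A" "?Z \<in> mod_cat A"
    using fg_submod[OF _ subK] fg_submod[OF _ subZ] P(1) by (simp_all add: mod_cat_iff)
  have Z: "projective_module A ?Z" by (rule projective_zero_submodule[OF Pm P(2)])
  (* The short exact sequence, continued by zero modules. *)
  define PP where "PP i = (if i = 0 then P else if i = 1 then submod P ?K else ?Z)" for i :: nat
  define d where "d i = (if i = 0 then (\<lambda>x. x) else (\<lambda>x. \<zero>\<^bsub>P\<^esub>))" for i :: nat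
  have PP: "PP 0 = P" "PP (Suc 0) = submod P ?K" "PP (Suc (Suc i)) = ?Z" for i by (simp_all add: PP_def)
  have dd: "d 0 = (\<lambda>x. x)" "d (Suc i) = (\<lambda>x. \<zero>\<^bsub>P\<^esub>)" for i by (simp_all add: d_def)
  have "projective_resolution A M PP p d"
    unfolding projective_resolution_def
  proof (intro conjI allI)
    fix i
    show "PP i \<in> mod_cat A" "projective_module A (PP i)" using P KZ K Z by (simp_all add: PP_def)
    show "p \<in> module_hom A (PP 0) M" "p ` carrier (PP 0) = carrier M" using p by (simp_all add: PP)
    show "module_kernel (PP 0) M p = d 0 ` carrier (PP 1)" by (simp add: PP dd)
    show "d i \<in> module_hom A (PP (Suc i)) (PP i)"
    proof (cases i)
      case 0
      then show ?thesis using hom_submod_incl[OF subK] by (simp add: PP dd)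
    next
      case (Suc k)
      have "right_module A (PP i)" "\<zero>\<^bsub>PP i\<^esub> = \<zero>\<^bsub>P\<^esub>" using Pm Km Zm by (simp_all add: PP_def)
      then show ?thesis using hom_const_zero[of A "PP i" "PP (Suc i)"] Suc by (simp add: dd)
    qed
    show "module_kernel (PP (Suc i)) (PP i) (d i) = d (Suc i) ` carrier (PP (Suc (Suc i)))"
    proof (cases i)
      case 0
      then show ?thesis using submodule_zero[OF subK] by (auto simp: PP dd module_kernel_def)
    next
      case (Suc k)
      have "\<zero>\<^bsub>PP i\<^esub> = \<zero>\<^bsub>P\<^esub>" by (simp add: PP_def)
      then show ?thesis using Suc by (auto simp: PP dd module_kernel_def)
    qed
  qed
  moreover have "\<forall>i>1. carrier (PP i) = {\<zero>\<^bsub>PP i\<^esub>}" by (simp add: PP_def)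
  ultimately have "proj_dim A M \<le> enat 1" unfolding proj_dim_def by (intro Inf_lower) blast
  then show "proj_dim A M \<le> 1" by (simp add: one_enat_def)
qed


text \<open>
  Let \<open>0 \<rightarrow> K \<rightarrow> P \<rightarrow> C \<rightarrow> 0\<close> have projective \<open>K\<close> and \<open>P\<close>, let \<open>Q = C/T\<close>, let \<open>\<pi> : P \<rightarrow> Q\<close> be the composite,
  and let \<open>0 \<rightarrow> Y2 \<rightarrow> Y1 \<rightarrow> Y0 \<rightarrow> Q \<rightarrow> 0\<close> be a projective resolution with maps \<open>d1\<close>, \<open>d0\<close>, \<open>e\<close>. The kernel of
  \<open>\<pi>\<close> is the preimage of \<open>T\<close> in \<open>P\<close>, and by Schanuel's lemma its projective dimension is at most one.
  In explicit form: choose \<open>a : P \<rightarrow> Y0\<close> and \<open>b : Y0 \<rightarrow> P\<close> over \<open>Q\<close>. Then \<open>(u, x) \<mapsto> b (d0 u) + (x - b (a x))\<close> maps \<open>Y1 \<oplus> P\<close> onto the kernel of \<open>\<pi>\<close>;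
  its own kernel \<open>L'\<close> is mapped onto \<open>Y0\<close> by \<open>(u, x) \<mapsto> a x - d0 u\<close>, with kernel \<open>Y2\<close>, and is therefore
  projective. Composing with \<open>P \<rightarrow> C\<close> maps \<open>Y1 \<oplus> P\<close> onto \<open>T\<close>, and the kernel \<open>L\<close> of this map is an extension
  of \<open>K\<close> by \<open>L'\<close>.
\<close>

lemma short_projective_resolution_submod:
  assumes gl: "gl_dim A \<le> 2" and C: "fg_module A C" "short_projective_resolution C"
    and T: "submodule T A C"
  shows "short_projective_resolution (submod C T)"
proof -
  have Cm: "right_module A C" using C(1) by (rule fg_right_module)
  obtain P p where P: "P \<in> mod_cat A" "projective_module A P" and p: "p \<in> module_hom A P C"
    "p ` carrier P = carrier C" and K: "projective_module A (submod P (module_kernel P C p))"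
    using C(2) unfolding short_projective_resolution_def by blast
  have Pm: "right_module A P" and Pfg: "fg_module A P" using P(1) by (simp_all add: mod_cat_def fg_module_def)
  obtain Q q where Q: "Q \<in> mod_cat A" and q: "q \<in> module_hom A C Q" "q ` carrier C = carrier Q"
    "module_kernel C Q q = T"
    using ex_quotient[OF C(1) T] by blast
  have Qm: "right_module A Q" using Q by (simp add: mod_cat_def)
  obtain Y0 Y1 Y2 e d0 d1 where Y0: "Y0 \<in> mod_cat A" "projective_module A Y0"
    and Y1: "Y1 \<in> mod_cat A" "projective_module A Y1"
    and Y2: "Y2 \<in> mod_cat A" "projective_module A Y2"
    and e: "e \<in> module_hom A Y0 Q" "e ` carrier Y0 = carrier Q" "module_kernel Y0 Q e = d0 ` carrier Y1"
    and d0: "d0 \<in> module_hom A Y1 Y0" "module_kernel Y1 Y0 d0 = d1 ` carrier Y2"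
    and d1: "d1 \<in> module_hom A Y2 Y1" "inj_on d1 (carrier Y2)"
    using gl_dim_le_2_resolution[OF gl Q] by metis
  have Y0m: "right_module A Y0" and Y0fg: "fg_module A Y0" using Y0(1) by (simp_all add: mod_cat_def fg_module_def)
  have Y1m: "right_module A Y1" and Y1fg: "fg_module A Y1" using Y1(1) by (simp_all add: mod_cat_def fg_module_def)
  have Y2m: "right_module A Y2" using Y2(1) by (simp add: mod_cat_def)
  let ?pi = "\<lambda>x. q (p x)"
  have pi: "?pi \<in> module_hom A P Q" by (rule hom_comp[OF p(1) q(1)])
  have pi_surj: "?pi ` carrier P = carrier Q" using p(2) q(2) by (simp flip: image_image)
  obtain a where a: "a \<in> module_hom A P Y0" "\<And>x. x \<in> carrier P \<Longrightarrow> e (a x) = ?pi x"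
    using projective_lift[OF P(2) Y0fg Qm e(1,2) pi] by blast
  obtain b where b: "b \<in> module_hom A Y0 P" "\<And>x. x \<in> carrier Y0 \<Longrightarrow> ?pi (b x) = e x"
    using projective_lift[OF Y0(2) Pfg Qm pi pi_surj e(1)] by blast
  interpret P: right_module A P by (rule Pm)
  interpret Q: right_module A Q by (rule Qm)
  interpret Y0: right_module A Y0 by (rule Y0m)
  let ?D = "direct_sum Y1 P"
  have Dfg: "fg_module A ?D" and Dm: "right_module A ?D"
    by (intro fg_direct_sum right_module_direct_sum Y1fg Pfg Y1m Pm)+
  have Dproj: "projective_module A ?D" by (rule projective_direct_sum[OF Y1m Pm Y1(2) P(2)])
  have ba: "(\<lambda>x. b (a x)) \<in> module_hom A P P" by (rule hom_comp[OF a(1) b(1)])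
  have bd: "(\<lambda>u. b (d0 u)) \<in> module_hom A Y1 P" by (rule hom_comp[OF d0(1) b(1)])
  note cl = hom_closed[OF a(1)] hom_closed[OF b(1)] hom_closed[OF d0(1)] hom_closed[OF ba] hom_closed[OF bd]
  let ?N = "\<lambda>z. b (d0 (fst z)) \<oplus>\<^bsub>P\<^esub> (snd z \<ominus>\<^bsub>P\<^esub> b (a (snd z)))"
  have N: "?N \<in> module_hom A ?D P"
    by (rule hom_copair[OF Pm bd hom_sub[OF Pm Pm hom_id ba]])
  have piN: "?pi (?N z) = \<zero>\<^bsub>Q\<^esub>" if z: "z \<in> carrier ?D" for z
  proof -
    have uz: "fst z \<in> carrier Y1" "snd z \<in> carrier P" using z by auto
    have "d0 (fst z) \<in> module_kernel Y0 Q e" unfolding e(3) using uz(1) by blast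
    then have "?pi (b (d0 (fst z))) = \<zero>\<^bsub>Q\<^esub>" using b(2)[OF hom_closed[OF d0(1) uz(1)]] by (simp add: in_module_kernel)
    moreover have "?pi (snd z \<ominus>\<^bsub>P\<^esub> b (a (snd z))) = \<zero>\<^bsub>Q\<^esub>"
      using hom_diff[OF Pm Qm pi uz(2) cl(4)[OF uz(2)]] b(2)[OF cl(1)[OF uz(2)]] a(2)[OF uz(2)]
        hom_closed[OF pi uz(2)] by simp
    ultimately show ?thesis
      using hom_add[OF pi cl(5)[OF uz(1)] P.minus_closed[OF uz(2) cl(4)[OF uz(2)]]] by simp
  qed
  have Nsurj: "n \<in> ?N ` carrier ?D" if n: "n \<in> carrier P" "?pi n = \<zero>\<^bsub>Q\<^esub>" for n
  proof -
    have "a n \<in> module_kernel Y0 Q e" using a(2)[OF n(1)] n(2) cl(1)[OF n(1)] by (simp add: in_module_kernel)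
    then obtain u where u: "u \<in> carrier Y1" "a n = d0 u" unfolding e(3) by blast
    have "?N (u, n) = n" using P.add_diff_cancel[OF n(1) cl(4)[OF n(1)]] u(2) by simp
    then show ?thesis using u(1) n(1) by (intro image_eqI[of _ _ "(u, n)"]) simp_all
  qed
  have pT: "p x \<in> T \<longleftrightarrow> ?pi x = \<zero>\<^bsub>Q\<^esub>" if "x \<in> carrier P" for x
    using hom_closed[OF p(1) that] by (simp add: q(3)[symmetric] in_module_kernel)
  let ?f = "\<lambda>z. p (?N z)"
  have f: "?f \<in> module_hom A ?D (submod C T)"
  proof (rule hom_corestrict[OF hom_comp[OF N p(1)]])
    fix z assume "z \<in> carrier ?D"
    then show "?f z \<in> T" using pT[OF hom_closed[OF N]] piN by simp
  qed
  have fsurj: "?f ` carrier ?D = carrier (submod C T)"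
  proof
    show "?f ` carrier ?D \<subseteq> carrier (submod C T)" using hom_closed[OF f] by blast
    show "carrier (submod C T) \<subseteq> ?f ` carrier ?D"
    proof
      fix t assume "t \<in> carrier (submod C T)"
      then have t: "t \<in> T" by simp
      then have "t \<in> p ` carrier P" using submodule_subset[OF T] p(2) by blast
      then obtain n where n: "n \<in> carrier P" "t = p n" by blast
      then have "n \<in> ?N ` carrier ?D" using Nsurj[OF n(1)] pT[OF n(1)] t by simp
      then show "t \<in> ?f ` carrier ?D" using n(2) by blast
    qed
  qed
  let ?L = "module_kernel ?D (submod C T) ?f" and ?K = "module_kernel P C p"
  have Tm: "right_module A (submod C T)" by (rule right_module_submod[OF Cm T])
  have subL: "submodule ?L A ?D" by (rule submodule_kernel[OF Dm Tm f])
  have subK: "submodule ?K A P" by (rule submodule_kernel[OF Pm Cm p(1)])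
  have Lm: "right_module A (submod ?D ?L)" by (rule right_module_submod[OF Dm subL])
  have Lfg: "fg_module A (submod ?D ?L)" by (rule fg_submod[OF Dfg subL])
  have Km: "right_module A (submod P ?K)" by (rule right_module_submod[OF Pm subK])
  have inL: "z \<in> ?L \<longleftrightarrow> z \<in> carrier ?D \<and> ?N z \<in> ?K" for z
    using hom_closed[OF N, of z] by (auto simp: in_module_kernel)
  have NL: "?N \<in> module_hom A (submod ?D ?L) (submod P ?K)"
  proof (rule hom_corestrict[OF hom_restrict[OF N subL]])
    fix z assume "z \<in> carrier (submod ?D ?L)"
    then show "?N z \<in> ?K" using inL[of z] by simp
  qed
  have NLsurj: "?N ` carrier (submod ?D ?L) = carrier (submod P ?K)"
  proof
    show "?N ` carrier (submod ?D ?L) \<subseteq> carrier (submod P ?K)" using hom_closed[OF NL] by blast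
    show "carrier (submod P ?K) \<subseteq> ?N ` carrier (submod ?D ?L)"
    proof
      fix n assume "n \<in> carrier (submod P ?K)"
      then have n: "n \<in> ?K" by simp
      then have nP: "n \<in> carrier P" "?pi n = \<zero>\<^bsub>Q\<^esub>"
        using hom_zero[OF Cm Qm q(1)] by (simp_all add: in_module_kernel)
      obtain z where z: "z \<in> carrier ?D" "n = ?N z" using Nsurj[OF nP] by blast
      then have "z \<in> ?L" using inL[of z] n by simp
      then show "n \<in> ?N ` carrier (submod ?D ?L)" using z(2) by auto
    qed
  qed
  let ?L' = "module_kernel (submod ?D ?L) (submod P ?K) ?N"
  have inL': "z \<in> ?L' \<longleftrightarrow> z \<in> carrier ?D \<and> ?N z = \<zero>\<^bsub>P\<^esub>" for z
  proof -
    have 1: "z \<in> ?L' \<longleftrightarrow> z \<in> ?L \<and> ?N z = \<zero>\<^bsub>P\<^esub>"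
      unfolding in_module_kernel[of z "submod ?D ?L"] by simp
    show ?thesis
    proof
      assume "z \<in> ?L'"
      then have "z \<in> ?L" "?N z = \<zero>\<^bsub>P\<^esub>" using 1 by blast+
      then show "z \<in> carrier ?D \<and> ?N z = \<zero>\<^bsub>P\<^esub>" using inL[of z] by blast
    next
      assume z: "z \<in> carrier ?D \<and> ?N z = \<zero>\<^bsub>P\<^esub>"
      have "?N z \<in> ?K" unfolding conjunct2[OF z] by (rule submodule_zero[OF subK])
      then show "z \<in> ?L'" using 1 z inL[of z] by blast
    qed
  qed
  have subL': "submodule ?L' A (submod ?D ?L)" by (rule submodule_kernel[OF Lm Km NL])
  have L'fg: "fg_module A (submod (submod ?D ?L) ?L')" by (rule fg_submod[OF Lfg subL'])
  have L'sub: "submodule ?L' A ?D" using subL' by (simp add: submodule_of_submod[OF Dm subL])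
  let ?c = "\<lambda>z. a (snd z) \<ominus>\<^bsub>Y0\<^esub> d0 (fst z)"
  have cD: "?c \<in> module_hom A ?D Y0"
    by (rule hom_sub[OF Dm Y0m hom_comp[OF hom_snd a(1)] hom_comp[OF hom_fst d0(1)]])
  have c: "?c \<in> module_hom A (submod (submod ?D ?L) ?L') Y0"
    using hom_restrict[OF cD L'sub] by simp
  have csurj: "?c ` carrier (submod (submod ?D ?L) ?L') = carrier Y0"
  proof
    show "?c ` carrier (submod (submod ?D ?L) ?L') \<subseteq> carrier Y0" using hom_closed[OF c] by blast
    show "carrier Y0 \<subseteq> ?c ` carrier (submod (submod ?D ?L) ?L')"
    proof
      fix y assume y: "y \<in> carrier Y0"
      (* Set x = b y; then a x - y dies in Q, so it is d0 u for some u, and (u, x) is the preimage. *)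
      let ?x = "b y"
      have x: "?x \<in> carrier P" by (rule cl(2)[OF y])
      have ax: "a ?x \<in> carrier Y0" by (rule cl(1)[OF x])
      let ?v = "a ?x \<ominus>\<^bsub>Y0\<^esub> y"
      have v: "?v \<in> carrier Y0" by (rule Y0.minus_closed[OF ax y])
      have "e ?v = \<zero>\<^bsub>Q\<^esub>"
        using hom_diff[OF Y0m Qm e(1) ax y] a(2)[OF x] b(2)[OF y] hom_closed[OF e(1) y] by simp
      then have "?v \<in> module_kernel Y0 Q e" using v by (simp add: in_module_kernel)
      then obtain u where u: "u \<in> carrier Y1" "?v = d0 u" unfolding e(3) by blast
      have "b ?v = b (a ?x) \<ominus>\<^bsub>P\<^esub> ?x" by (rule hom_diff[OF Y0m Pm b(1) ax y])
      then have "?N (u, ?x) = \<zero>\<^bsub>P\<^esub>"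
        using x cl(4)[OF x] by (simp flip: u(2)) (simp add: P.minus_eq P.a_assoc P.r_neg1 P.r_neg2 P.r_neg P.l_neg)
      then have "(u, ?x) \<in> ?L'" using u(1) x by (simp add: inL')
      moreover have "?c (u, ?x) = y"
        using ax y by (simp flip: u(2)) (simp add: Y0.minus_eq Y0.minus_add Y0.r_neg Y0.r_neg1 Y0.r_neg2 Y0.a_ac)
      ultimately show "y \<in> ?c ` carrier (submod (submod ?D ?L) ?L')"
        by (intro image_eqI[of _ _ "(u, ?x)"]) simp_all
    qed
  qed
  let ?i = "\<lambda>v. (d1 v, \<zero>\<^bsub>P\<^esub>)"
  have i: "?i \<in> module_hom A Y2 ?D" by (rule hom_pair[OF d1(1) hom_const_zero[OF Pm]])
  have iinj: "inj_on ?i (carrier Y2)" using d1(2) by (auto simp: inj_on_def)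
  let ?G = "module_kernel (submod (submod ?D ?L) ?L') Y0 ?c"
  have a0: "a \<zero>\<^bsub>P\<^esub> = \<zero>\<^bsub>Y0\<^esub>" and b0: "b \<zero>\<^bsub>Y0\<^esub> = \<zero>\<^bsub>P\<^esub>"
    by (rule hom_zero[OF Pm Y0m a(1)] hom_zero[OF Y0m Pm b(1)])+
  have G: "z \<in> ?G \<longleftrightarrow> z \<in> ?L' \<and> ?c z = \<zero>\<^bsub>Y0\<^esub>" for z
    unfolding in_module_kernel[of z "submod (submod ?D ?L) ?L'"] by simp
  have inG: "z \<in> ?G \<longleftrightarrow> z \<in> ?i ` carrier Y2" for z
  proof
    assume "z \<in> ?G"
    then have z: "z \<in> carrier ?D" "?N z = \<zero>\<^bsub>P\<^esub>" "?c z = \<zero>\<^bsub>Y0\<^esub>"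
      using inL'[of z] G[of z] by blast+
    have uz: "fst z \<in> carrier Y1" "snd z \<in> carrier P" using z(1) by auto
    have "a (snd z) = d0 (fst z)" using z(3) cl(1)[OF uz(2)] cl(3)[OF uz(1)] by simp
    then have x0: "snd z = \<zero>\<^bsub>P\<^esub>" using z(2) P.add_diff_cancel[OF uz(2) cl(4)[OF uz(2)]] by simp
    then have "d0 (fst z) = \<zero>\<^bsub>Y0\<^esub>" using \<open>a (snd z) = d0 (fst z)\<close> a0 by simp
    then have "fst z \<in> module_kernel Y1 Y0 d0" using uz(1) by (simp add: in_module_kernel)
    then have "fst z \<in> d1 ` carrier Y2" unfolding d0(2) .
    then obtain v where v: "v \<in> carrier Y2" "fst z = d1 v" by blast
    then have "z = ?i v" using x0 by (simp add: prod_eq_iff)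
    then show "z \<in> ?i ` carrier Y2" using v(1) by blast
  next
    assume "z \<in> ?i ` carrier Y2"
    then obtain v where v: "v \<in> carrier Y2" "z = ?i v" by blast
    have "d1 v \<in> module_kernel Y1 Y0 d0" unfolding d0(2) using v(1) by blast
    then have dv: "d1 v \<in> carrier Y1" "d0 (d1 v) = \<zero>\<^bsub>Y0\<^esub>" by (simp_all add: in_module_kernel)
    have "z \<in> carrier ?D" "?N z = \<zero>\<^bsub>P\<^esub>" "?c z = \<zero>\<^bsub>Y0\<^esub>"
      using dv by (simp_all add: v(2) a0 b0)
    then show "z \<in> ?G" using inL'[of z] G[of z] by blast
  qed
  then have Geq: "?G = ?i ` carrier Y2" by blast
  have "projective_module A (submod ?D (?i ` carrier Y2))"
    by (rule projective_image_of_monic[OF Y2m Y2(2) Dm i iinj])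
  then have "projective_module A (submod (submod (submod ?D ?L) ?L') ?G)" unfolding Geq by simp
  then have "projective_module A (submod (submod ?D ?L) ?L')"
    by (rule projective_extension[OF L'fg Y0m Y0(2) c csurj])
  then have "projective_module A (submod ?D ?L)"
    by (rule projective_extension[OF Lfg Km K NL NLsurj])
  then show ?thesis by (rule short_projective_resolutionI[OF Dfg Dproj Tm f fsurj])
qed

end

section \<open>Socles\<close>

lemma socle_submod: "socle R M = submod M (carrier (socle R M))"
  by (simp add: socle_def)

lemma submodule_socle:
  assumes "right_module R M" shows "submodule (carrier (socle R M)) R M"
proof -
  have "\<Union>{S. simple_submodule R M S} \<subseteq> carrier M"
  proof
    fix x assume "x \<in> \<Union>{S. simple_submodule R M S}"
    then obtain S where "simple_submodule R M S" "x \<in> S" by blast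
    then show "x \<in> carrier M" using submodule_subset[of S R M x] by (simp add: simple_submodule_def)
  qed
  then show ?thesis using span_submodule[OF assms] by (simp add: socle_def)
qed

lemma socle_subset_essential:
  assumes M: "right_module R M" and H: "essential_submodule R M H"
  shows "carrier (socle R M) \<subseteq> H"
proof -
  have sub: "submodule H R M" using H by (simp add: essential_submodule_def)
  have "S \<subseteq> H" if S: "simple_submodule R M S" for S
  proof -
    have S': "submodule S R M" "S \<noteq> {\<zero>\<^bsub>M\<^esub>}"
      "\<And>T. submodule T R M \<Longrightarrow> T \<subseteq> S \<Longrightarrow> T = {\<zero>\<^bsub>M\<^esub>} \<or> T = S"
      using S unfolding simple_submodule_def by blast+
    have "H \<inter> S \<noteq> {\<zero>\<^bsub>M\<^esub>}" using H S'(1,2) unfolding essential_submodule_def by blast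
    then have "H \<inter> S = S" using S'(3)[OF submodule_inter[OF M sub S'(1)]] by blast
    then show ?thesis by blast
  qed
  then have "\<Union>{S. simple_submodule R M S} \<subseteq> H" by blast
  then show ?thesis using span_least[OF sub] by (simp add: socle_def)
qed

lemma socle_meets_submodule:
  assumes M: "right_module R M" and rk: "finite_rank R M"
    and H: "submodule H R M" "H \<noteq> {\<zero>\<^bsub>M\<^esub>}"
  shows "H \<inter> carrier (socle R M) \<noteq> {\<zero>\<^bsub>M\<^esub>}"
proof -
  obtain S where S: "simple_submodule R M S" "S \<subseteq> H" using finite_rank_ex_simple[OF M rk H] by blast
  have "S \<subseteq> carrier (socle R M)"
    using span_incl[of "\<Union>{S. simple_submodule R M S}" R M] S(1) by (auto simp: socle_def)
  moreover have "S \<noteq> {\<zero>\<^bsub>M\<^esub>}" "\<zero>\<^bsub>M\<^esub> \<in> S"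
    using S(1) submodule_zero[of S R M] by (simp_all add: simple_submodule_def)
  ultimately show ?thesis using S(2) by blast
qed

context finite_dimensional_algebra
begin

section \<open>Maps into a projective-injective copresentation\<close>

lemma short_projective_resolution_projective:
  assumes "fg_module A P" "projective_module A P"
  shows "short_projective_resolution P"
proof -
  have Pm: "right_module A P" using assms(1) by (rule fg_right_module)
  have "\<zero>\<^bsub>P\<^esub> \<in> carrier P" by (rule submodule_zero[OF submodule_carrier[OF Pm]])
  then have "module_kernel P P (\<lambda>x. x) = {\<zero>\<^bsub>P\<^esub>}" by (auto simp: module_kernel_def)
  then show ?thesis
    using projective_zero_submodule[OF Pm assms(2)]
    by (intro short_projective_resolutionI[OF assms Pm hom_id]) simp_all
qed

text \<open>
  The reason is that \<open>V\<close> would otherwise satisfy \<open>Hom(V, A) = 0\<close> and \<open>Ext\<^sup>1(V, A) = 0\<close>. Take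
  \<open>0 \<rightarrow> K0 \<rightarrow> P \<rightarrow> T \<rightarrow> 0\<close> with projective \<open>K0\<close> and \<open>P\<close>, and let \<open>N\<close> be the preimage of \<open>V\<close> in \<open>P\<close>. If all maps
  from \<open>T\<close> to \<open>E0\<close> and \<open>E1\<close> vanish on \<open>V\<close>, then by injectivity so do all maps from \<open>V\<close>. Consequently every map
  \<open>K0 \<rightarrow> A\<close> extends to \<open>N\<close> (this is \<open>Ext\<^sup>1(V, A) = 0\<close>), the same holds with any
  finitely generated projective module in place of \<open>A\<close>, and the identity of \<open>K0\<close> extends to a retraction \<open>N \<rightarrow> K0\<close>. Its complement is a copy of \<open>V\<close> inside \<open>P\<close>. But \<open>Hom(V, A) = 0\<close>
  because \<open>A\<close> embeds into \<open>E0\<close>, so \<open>Hom(V, P) = 0\<close>: a contradiction.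
\<close>

lemma hom_into_copresentation:
  assumes T: "fg_module A T" "short_projective_resolution T"
    and V: "submodule V A T" "V \<noteq> {\<zero>\<^bsub>T\<^esub>}"
    and E0: "E0 \<in> mod_cat A" "injective_module A E0" and E1: "E1 \<in> mod_cat A" "injective_module A E1"
    and e: "e \<in> module_hom A (regular_module A) E0" "inj_on e (carrier A)"
    and d: "d \<in> module_hom A E0 E1" "module_kernel E0 E1 d = e ` carrier A"
  shows "\<exists>x\<in>V. (\<exists>f\<in>module_hom A T E0. f x \<noteq> \<zero>\<^bsub>E0\<^esub>) \<or> (\<exists>f\<in>module_hom A T E1. f x \<noteq> \<zero>\<^bsub>E1\<^esub>)"
proof (rule ccontr)
  assume none: "\<not> ?thesis"
  let ?V = "submod T V"
  have Tm: "right_module A T" using T(1) by (rule fg_right_module)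
  have Vm: "right_module A ?V" by (rule right_module_submod[OF Tm V(1)])
  have Vfg: "fg_module A ?V" by (rule fg_submod[OF T(1) V(1)])
  note Rm = right_module_regular[OF ring_A]
  have E0m: "right_module A E0" and E1m: "right_module A E1" using E0(1) E1(1) by (simp_all add: mod_cat_def)
  have incl: "(\<lambda>x. x) \<in> module_hom A ?V T" "inj_on (\<lambda>x. x) (carrier ?V)"
    using hom_submod_incl[OF V(1)] by auto
  (* Maps from V into the injectives extend to T, so by assumption they vanish. *)
  have V0: "u x = \<zero>\<^bsub>E0\<^esub>" if u: "u \<in> module_hom A ?V E0" and x: "x \<in> V" for u x
  proof -
    obtain f where f: "f \<in> module_hom A T E0" "\<And>x. x \<in> carrier ?V \<Longrightarrow> f x = u x"
      using injective_extend[OF E0(2) Vfg T(1) incl u] by blast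
    then show ?thesis using none x by fastforce
  qed
  have V1: "u x = \<zero>\<^bsub>E1\<^esub>" if u: "u \<in> module_hom A ?V E1" and x: "x \<in> V" for u x
  proof -
    obtain f where f: "f \<in> module_hom A T E1" "\<And>x. x \<in> carrier ?V \<Longrightarrow> f x = u x"
      using injective_extend[OF E1(2) Vfg T(1) incl u] by blast
    then show ?thesis using none x by fastforce
  qed
  obtain P p where P: "P \<in> mod_cat A" "projective_module A P" and p: "p \<in> module_hom A P T"
    "p ` carrier P = carrier T" and K: "projective_module A (submod P (module_kernel P T p))"
    using T(2) unfolding short_projective_resolution_def by blast
  have Pm: "right_module A P" and Pfg: "fg_module A P" using P(1) by (simp_all add: mod_cat_def fg_module_def)
  define K0 where "K0 = module_kernel P T p"
  define N where "N = {y \<in> carrier P. p y \<in> V}"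
  let ?K = "submod P K0" and ?N = "submod P N"
  have subK: "submodule K0 A P" unfolding K0_def by (rule submodule_kernel[OF Pm Tm p(1)])
  have subN: "submodule N A P" unfolding N_def by (rule submodule_vimage[OF Pm Tm p(1) V(1)])
  have Nm: "right_module A ?N" by (rule right_module_submod[OF Pm subN])
  have Kfg: "fg_module A ?K" by (rule fg_submod[OF Pfg subK])
  have Kc: "?K \<in> mod_cat A" using Kfg by (simp add: mod_cat_iff)
  have KP: "x \<in> carrier P" "p x = \<zero>\<^bsub>T\<^esub>" if "x \<in> K0" for x using that by (simp_all add: K0_def in_module_kernel)
  have NP: "x \<in> carrier P" "p x \<in> V" if "x \<in> N" for x using that by (simp_all add: N_def)
  have NK: "x \<in> K0" if "x \<in> N" "p x = \<zero>\<^bsub>T\<^esub>" for x using that by (simp add: K0_def N_def in_module_kernel)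
  have pN: "p \<in> module_hom A ?N ?V"
    by (rule hom_corestrict[OF hom_restrict[OF p(1) subN]]) (simp add: NP)
  have pNsurj: "p ` carrier ?N = carrier ?V"
  proof
    show "p ` carrier ?N \<subseteq> carrier ?V" using NP by auto
    show "carrier ?V \<subseteq> p ` carrier ?N"
    proof
      fix x assume "x \<in> carrier ?V"
      then have x: "x \<in> V" by simp
      then have "x \<in> p ` carrier P" using submodule_subset[OF V(1)] p(2) by blast
      then show "x \<in> p ` carrier ?N" using x by (auto simp: N_def)
    qed
  qed
  have factor: "\<exists>u\<in>module_hom A ?V L. \<forall>n\<in>N. u (p n) = f n"
    if L: "right_module A L" and f: "f \<in> module_hom A ?N L" and z: "\<And>n. n \<in> K0 \<Longrightarrow> f n = \<zero>\<^bsub>L\<^esub>"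
    for L :: "('a, 'a list) module" and f
  proof -
    have "f x = \<zero>\<^bsub>L\<^esub>" if "x \<in> carrier ?N" "p x = \<zero>\<^bsub>?V\<^esub>" for x
      using z NK that by simp
    then obtain u where "u \<in> module_hom A ?V L" "\<And>x. x \<in> carrier ?N \<Longrightarrow> u (p x) = f x"
      using hom_factor[OF Nm Vm L pN pNsurj f] by blast
    then show ?thesis by (intro bexI[of _ u]) simp_all
  qed
  (* A map from the kernel to A extends to N: its extension P -> E0 composed with d factors
     through V, hence vanishes on N, so on N it takes values in A. *)
  have "\<forall>f\<in>module_hom A ?K ?K. \<exists>g\<in>module_hom A ?N ?K. \<forall>x\<in>K0. g x = f x"
  proof (rule projective_induct[where \<Phi> = "\<lambda>Y. \<forall>f\<in>module_hom A ?K Y. \<exists>g\<in>module_hom A ?N Y. \<forall>x\<in>K0. g x = f x",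
      OF Kc K[folded K0_def] finite_rank_fg_module[OF Kfg]])
    fix Y i j assume Y: "Y \<in> mod_cat A" "inverse_homs A (regular_module A) Y i j"
    note ij = inverse_homsD[OF Y(2)]
    show "\<forall>f\<in>module_hom A ?K Y. \<exists>g\<in>module_hom A ?N Y. \<forall>x\<in>K0. g x = f x"
    proof
      fix f assume f: "f \<in> module_hom A ?K Y"
      have jf: "j (f x) \<in> carrier A" if "x \<in> K0" for x
        using hom_closed[OF hom_comp[OF f ij(2)], of x] that by simp
      have ejf: "(\<lambda>x. e (j (f x))) \<in> module_hom A ?K E0"
        by (rule hom_comp[OF hom_comp[OF f ij(2)] e(1)])
      have "inj_on (\<lambda>x. x) (carrier ?K)" by simp
      then obtain h where h: "h \<in> module_hom A P E0" "\<And>x. x \<in> carrier ?K \<Longrightarrow> h x = e (j (f x))"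
        using injective_extend[OF E0(2) Kfg Pfg hom_submod_incl[OF subK] _ ejf] by blast
      have hN: "h \<in> module_hom A ?N E0" by (rule hom_restrict[OF h(1) subN])
      have dK: "d (h n) = \<zero>\<^bsub>E1\<^esub>" if n: "n \<in> K0" for n
      proof -
        have "h n \<in> module_kernel E0 E1 d" unfolding d(2) using h(2)[of n] n jf[OF n] by simp
        then show ?thesis by (simp add: in_module_kernel)
      qed
      obtain u where u: "u \<in> module_hom A ?V E1" "\<forall>n\<in>N. u (p n) = d (h n)"
        using factor[OF E1m hom_comp[OF hN d(1)] dK] by blast
      have hA: "h n \<in> e ` carrier A" if n: "n \<in> N" for n
      proof -
        have "d (h n) = \<zero>\<^bsub>E1\<^esub>" using u(2) n V1[OF u(1) NP(2)[OF n]] by simp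
        then show ?thesis using hom_closed[OF h(1) NP(1)[OF n]] by (simp add: d(2)[symmetric] in_module_kernel)
      qed
      let ?E = "submod E0 (e ` carrier A)"
      have "e \<in> module_hom A (regular_module A) ?E" by (rule hom_corestrict[OF e(1)]) simp
      moreover have "bij_betw e (carrier (regular_module A)) (carrier ?E)" using e(2) by (simp add: bij_betw_def)
      ultimately obtain e' where e': "inverse_homs A (regular_module A) ?E e e'"
        using inverse_homs_inv[OF Rm] by blast
      note ee' = inverse_homsD[OF e']
      have "h \<in> module_hom A ?N ?E" by (rule hom_corestrict[OF hN]) (simp add: hA)
      then have g: "(\<lambda>n. i (e' (h n))) \<in> module_hom A ?N Y"
        using hom_comp[OF hom_comp[OF _ ee'(2)] ij(1)] by blast
      have "i (e' (h x)) = f x" if x: "x \<in> K0" for x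
        using h(2)[of x] ee'(3)[of "j (f x)"] jf[OF x] ij(4)[of "f x"] hom_closed[OF f, of x] x by simp
      then show "\<exists>g\<in>module_hom A ?N Y. \<forall>x\<in>K0. g x = f x" by (intro bexI[OF _ g] ballI)
    qed
  next
    fix Y Z L i j
    assume *: "Y \<in> mod_cat A" "Z \<in> mod_cat A" "L \<in> mod_cat A" "inverse_homs A (direct_sum Y Z) L i j"
      and Y: "\<forall>f\<in>module_hom A ?K Y. \<exists>g\<in>module_hom A ?N Y. \<forall>x\<in>K0. g x = f x"
      and Z: "\<forall>f\<in>module_hom A ?K Z. \<exists>g\<in>module_hom A ?N Z. \<forall>x\<in>K0. g x = f x"
    note ij = inverse_homsD[OF *(4)]
    show "\<forall>f\<in>module_hom A ?K L. \<exists>g\<in>module_hom A ?N L. \<forall>x\<in>K0. g x = f x"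
    proof
      fix f assume f: "f \<in> module_hom A ?K L"
      have jf: "(\<lambda>x. j (f x)) \<in> module_hom A ?K (direct_sum Y Z)" by (rule hom_comp[OF f ij(2)])
      obtain g where g: "g \<in> module_hom A ?N Y" "\<forall>x\<in>K0. g x = fst (j (f x))"
        using Y[rule_format, OF hom_comp[OF jf hom_fst]] by blast
      obtain h where h: "h \<in> module_hom A ?N Z" "\<forall>x\<in>K0. h x = snd (j (f x))"
        using Z[rule_format, OF hom_comp[OF jf hom_snd]] by blast
      have "i (g x, h x) = f x" if x: "x \<in> K0" for x
        using g(2) h(2) x ij(4)[of "f x"] hom_closed[OF f, of x] by simp
      then show "\<exists>g\<in>module_hom A ?N L. \<forall>x\<in>K0. g x = f x"
        by (intro bexI[OF _ hom_comp[OF hom_pair[OF g(1) h(1)] ij(1)]] ballI)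
    qed
  next
    fix Y Z s r
    assume *: "s \<in> module_hom A Z Y" "r \<in> module_hom A Y Z" "\<And>z. z \<in> carrier Z \<Longrightarrow> r (s z) = z"
      and Y: "\<forall>f\<in>module_hom A ?K Y. \<exists>g\<in>module_hom A ?N Y. \<forall>x\<in>K0. g x = f x"
    show "\<forall>f\<in>module_hom A ?K Z. \<exists>g\<in>module_hom A ?N Z. \<forall>x\<in>K0. g x = f x"
    proof
      fix f assume f: "f \<in> module_hom A ?K Z"
      obtain g where g: "g \<in> module_hom A ?N Y" "\<forall>x\<in>K0. g x = s (f x)"
        using Y[rule_format, OF hom_comp[OF f *(1)]] by blast
      have "r (g x) = f x" if x: "x \<in> K0" for x
        using g(2) x *(3)[of "f x"] hom_closed[OF f, of x] by simp
      then show "\<exists>g\<in>module_hom A ?N Z. \<forall>x\<in>K0. g x = f x"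
        by (intro bexI[OF _ hom_comp[OF g(1) *(2)]] ballI)
    qed
  qed
  (* Specialise to the identity of the kernel. *)
  then have "\<exists>r\<in>module_hom A ?N ?K. \<forall>x\<in>K0. r x = x" by (rule bspec[OF _ hom_id])
  then obtain r where r: "r \<in> module_hom A ?N ?K" "\<forall>x\<in>K0. r x = x" by blast
  have rN: "r n \<in> K0" if "n \<in> N" for n using hom_closed[OF r(1), of n] that by simp
  have rP: "r \<in> module_hom A ?N P" by (rule hom_comp[OF r(1) hom_submod_incl[OF subK]])
  (* The complement of the retraction r factors through V and embeds V into P. *)
  have c: "(\<lambda>n. n \<ominus>\<^bsub>P\<^esub> r n) \<in> module_hom A ?N P"
    by (rule hom_sub[OF Nm Pm hom_submod_incl[OF subN] rP])
  have "n \<ominus>\<^bsub>P\<^esub> r n = \<zero>\<^bsub>P\<^esub>" if n: "n \<in> K0" for n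
    using r(2) n right_module.diff_eq_zero[OF Pm KP(1)[OF n] KP(1)[OF n]] by simp
  then obtain u where u: "u \<in> module_hom A ?V P" "\<forall>n\<in>N. u (p n) = n \<ominus>\<^bsub>P\<^esub> r n"
    using factor[OF Pm c] by blast
  (* A map from V to A becomes zero in E0, into which A embeds; this passes to all projectives. *)
  have "\<forall>u\<in>module_hom A ?V P. \<forall>x\<in>V. u x = \<zero>\<^bsub>P\<^esub>"
  proof (rule projective_induct[where \<Phi> = "\<lambda>Y. \<forall>u\<in>module_hom A ?V Y. \<forall>x\<in>V. u x = \<zero>\<^bsub>Y\<^esub>",
      OF P finite_rank_fg_module[OF Pfg]])
    fix Y i j assume Y: "Y \<in> mod_cat A" "inverse_homs A (regular_module A) Y i j"
    note ij = inverse_homsD[OF Y(2)]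
    have Ym: "right_module A Y" using Y(1) by (simp add: mod_cat_def)
    show "\<forall>u\<in>module_hom A ?V Y. \<forall>x\<in>V. u x = \<zero>\<^bsub>Y\<^esub>"
    proof (intro ballI)
      fix u x assume u: "u \<in> module_hom A ?V Y" and x: "x \<in> V"
      have ux: "u x \<in> carrier Y" using hom_closed[OF u, of x] x by simp
      have "e (j (u x)) = \<zero>\<^bsub>E0\<^esub>" by (rule V0[OF hom_comp[OF hom_comp[OF u ij(2)] e(1)] x])
      then have "j (u x) = \<zero>\<^bsub>regular_module A\<^esub>"
        using hom_inj_zero[OF Rm E0m e(1), of "j (u x)"] e(2) hom_closed[OF ij(2) ux] by simp
      then show "u x = \<zero>\<^bsub>Y\<^esub>" using ij(4)[OF ux] hom_zero[OF Rm Ym ij(1)] by metis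
    qed
  next
    fix Y Z L i j
    assume *: "Y \<in> mod_cat A" "Z \<in> mod_cat A" "L \<in> mod_cat A" "inverse_homs A (direct_sum Y Z) L i j"
      and Y: "\<forall>u\<in>module_hom A ?V Y. \<forall>x\<in>V. u x = \<zero>\<^bsub>Y\<^esub>"
      and Z: "\<forall>u\<in>module_hom A ?V Z. \<forall>x\<in>V. u x = \<zero>\<^bsub>Z\<^esub>"
    note ij = inverse_homsD[OF *(4)]
    have m: "right_module A Y" "right_module A Z" "right_module A L" using *(1-3) by (simp_all add: mod_cat_def)
    show "\<forall>u\<in>module_hom A ?V L. \<forall>x\<in>V. u x = \<zero>\<^bsub>L\<^esub>"
    proof (intro ballI)
      fix u x assume u: "u \<in> module_hom A ?V L" and x: "x \<in> V"
      have ux: "u x \<in> carrier L" using hom_closed[OF u, of x] x by simp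
      have ju: "(\<lambda>x. j (u x)) \<in> module_hom A ?V (direct_sum Y Z)" by (rule hom_comp[OF u ij(2)])
      have "fst (j (u x)) = \<zero>\<^bsub>Y\<^esub>" "snd (j (u x)) = \<zero>\<^bsub>Z\<^esub>"
        using Y[rule_format, OF hom_comp[OF ju hom_fst] x] Z[rule_format, OF hom_comp[OF ju hom_snd] x] by simp_all
      then have "j (u x) = \<zero>\<^bsub>direct_sum Y Z\<^esub>" by (simp add: prod_eq_iff)
      then show "u x = \<zero>\<^bsub>L\<^esub>"
        using ij(4)[OF ux] hom_zero[OF right_module_direct_sum[OF m(1,2)] m(3) ij(1)] by metis
    qed
  next
    fix Y Z s r
    assume *: "Y \<in> mod_cat A" "Z \<in> mod_cat A" "s \<in> module_hom A Z Y" "r \<in> module_hom A Y Z"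
      "\<And>z. z \<in> carrier Z \<Longrightarrow> r (s z) = z"
      and Y: "\<forall>u\<in>module_hom A ?V Y. \<forall>x\<in>V. u x = \<zero>\<^bsub>Y\<^esub>"
    have m: "right_module A Y" "right_module A Z" using *(1,2) by (simp_all add: mod_cat_def)
    show "\<forall>u\<in>module_hom A ?V Z. \<forall>x\<in>V. u x = \<zero>\<^bsub>Z\<^esub>"
    proof (intro ballI)
      fix u x assume u: "u \<in> module_hom A ?V Z" and x: "x \<in> V"
      have ux: "u x \<in> carrier Z" using hom_closed[OF u, of x] x by simp
      have "s (u x) = \<zero>\<^bsub>Y\<^esub>" using Y[rule_format, OF hom_comp[OF u *(3)] x] .
      then show "u x = \<zero>\<^bsub>Z\<^esub>" using *(5)[OF ux] hom_zero[OF m *(4)] by metis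
    qed
  qed
  then have uz: "u x = \<zero>\<^bsub>P\<^esub>" if "x \<in> V" for x using u(1) that by blast
  obtain x where x: "x \<in> V" "x \<noteq> \<zero>\<^bsub>T\<^esub>" using V(2) submodule_zero[OF V(1)] by blast
  then obtain n where n: "n \<in> N" "x = p n" using pNsurj by auto
  have "n \<ominus>\<^bsub>P\<^esub> r n = \<zero>\<^bsub>P\<^esub>" using u(2) n uz[OF x(1)] by simp
  then have "n = r n" using right_module.diff_eq_zero[OF Pm NP(1)[OF n(1)] KP(1)[OF rN[OF n(1)]]] by simp
  then have "n \<in> K0" using rN[OF n(1)] by simp
  then show False using KP(2) n(2) x(2) by simp
qed

text \<open>
  Every nonzero submodule of \<open>J\<close> meets the socle, where the previous lemma detects it; the detecting
  map extends from the socle to \<open>J\<close>.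
\<close>

lemma injective_with_short_socle_projective:
  assumes E0: "E0 \<in> mod_cat A" "injective_module A E0" "projective_module A E0"
    and E1: "E1 \<in> mod_cat A" "injective_module A E1" "projective_module A E1"
    and e: "e \<in> module_hom A (regular_module A) E0" "inj_on e (carrier A)"
    and d: "d \<in> module_hom A E0 E1" "module_kernel E0 E1 d = e ` carrier A"
    and J: "J \<in> mod_cat A" "injective_module A J" "short_projective_resolution (socle A J)"
  shows "projective_module A J"
proof -
  have Jm: "right_module A J" and Jfg: "fg_module A J" using J(1) by (simp_all add: mod_cat_def fg_module_def)
  let ?S = "carrier (socle A J)"
  have subS: "submodule ?S A J" by (rule submodule_socle[OF Jm])
  have Sfg: "fg_module A (submod J ?S)" by (rule fg_submod[OF Jfg subS])
  have S: "short_projective_resolution (submod J ?S)" using J(3) socle_submod[of A J] by simp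
  have rk: "finite_rank A J" by (rule finite_rank_fg_module[OF Jfg])
  have "\<exists>Q\<in>mod_cat A. (projective_module A Q \<and> injective_module A Q) \<and>
      (\<exists>f\<in>module_hom A J Q. inj_on f (carrier J))"
  proof (rule embed_by_cogeneration[where \<Phi> = "\<lambda>Q. projective_module A Q \<and> injective_module A Q",
        OF Jm rk _ E0(1) conjI[OF E0(3,2)]])
    fix Y Z L :: "('a, 'a list) module" and i j
    assume *: "Y \<in> mod_cat A" "Z \<in> mod_cat A" "projective_module A Y \<and> injective_module A Y"
      "projective_module A Z \<and> injective_module A Z" "inverse_homs A (direct_sum Y Z) L i j"
    have m: "right_module A Y" "right_module A Z" using *(1,2) by (simp_all add: mod_cat_def)
    have pi: "projective_module A (direct_sum Y Z)" "injective_module A (direct_sum Y Z)"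
      using *(3,4) by (auto intro: projective_direct_sum[OF m] injective_direct_sum)
    note ij = inverse_homsD[OF *(5)]
    have "projective_module A L" by (rule projective_retract[OF pi(1) ij(2,1)]) (rule ij(4))
    moreover have "injective_module A L" by (rule injective_retract[OF pi(2) ij(2,1)]) (rule ij(4))
    ultimately show "projective_module A L \<and> injective_module A L" ..
  next
    fix H assume H: "submodule H A J" "H \<noteq> {\<zero>\<^bsub>J\<^esub>}"
    let ?V = "H \<inter> ?S"
    have V: "submodule ?V A (submod J ?S)" "?V \<noteq> {\<zero>\<^bsub>submod J ?S\<^esub>}"
      using submodule_inter[OF Jm H(1) subS] socle_meets_submodule[OF Jm rk H]
      by (simp_all add: submodule_of_submod[OF Jm subS])
    have ext: "\<exists>Q\<in>mod_cat A. (projective_module A Q \<and> injective_module A Q) \<and>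
        (\<exists>f\<in>module_hom A J Q. \<exists>x\<in>H. f x \<noteq> \<zero>\<^bsub>Q\<^esub>)"
      if E: "E \<in> mod_cat A" "injective_module A E" "projective_module A E"
        and f: "f \<in> module_hom A (submod J ?S) E" and x: "x \<in> ?V" "f x \<noteq> \<zero>\<^bsub>E\<^esub>" for E f x
    proof -
      have "inj_on (\<lambda>x. x) (carrier (submod J ?S))" by simp
      then obtain g where g: "g \<in> module_hom A J E" "\<And>x. x \<in> carrier (submod J ?S) \<Longrightarrow> g x = f x"
        using injective_extend[OF E(2) Sfg Jfg hom_submod_incl[OF subS] _ f] by blast
      have xH: "x \<in> H" using x(1) by simp
      have "g x \<noteq> \<zero>\<^bsub>E\<^esub>" using g(2)[of x] x by simp
      then show ?thesis using E by (intro bexI[OF _ E(1)] conjI bexI[OF _ g(1)] bexI[OF _ xH])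
    qed
    obtain x where x: "x \<in> ?V" and f: "(\<exists>f\<in>module_hom A (submod J ?S) E0. f x \<noteq> \<zero>\<^bsub>E0\<^esub>) \<or>
        (\<exists>f\<in>module_hom A (submod J ?S) E1. f x \<noteq> \<zero>\<^bsub>E1\<^esub>)"
      using hom_into_copresentation[OF Sfg S V E0(1,2) E1(1,2) e d] by blast
    from f show "\<exists>Q\<in>mod_cat A. (projective_module A Q \<and> injective_module A Q) \<and>
        (\<exists>f\<in>module_hom A J Q. \<exists>x\<in>H. f x \<noteq> \<zero>\<^bsub>Q\<^esub>)"
    proof (elim disjE bexE)
      fix f assume "f \<in> module_hom A (submod J ?S) E0" "f x \<noteq> \<zero>\<^bsub>E0\<^esub>"
      then show ?thesis using x by (intro ext[OF E0])
    next
      fix f assume "f \<in> module_hom A (submod J ?S) E1" "f x \<noteq> \<zero>\<^bsub>E1\<^esub>"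
      then show ?thesis using x by (intro ext[OF E1])
    qed
  qed
  then obtain Q f where Q: "Q \<in> mod_cat A" "projective_module A Q" and f: "f \<in> module_hom A J Q" "inj_on f (carrier J)"
    by blast
  have Qfg: "fg_module A Q" using Q(1) by (simp add: mod_cat_iff)
  obtain r where r: "r \<in> module_hom A Q J" "\<And>x. x \<in> carrier J \<Longrightarrow> r (f x) = x"
    using injective_split[OF J(2) Jfg Qfg f] by blast
  show ?thesis by (rule projective_retract[OF Q(2) f(1) r(1)]) (rule r(2))
qed

section \<open>The characterisation of Auslander algebras\<close>

text \<open>
  Applied with \<open>C = J\<close> for projective \<open>J\<close>, and with the image of the incoming map as \<open>C\<close> for the first two
  terms of a minimal injective resolution.
\<close>

lemma socle_proj_dim_le_1:
  assumes gl: "gl_dim A \<le> 2" and J: "J \<in> mod_cat A"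
    and C: "submodule C A J" "carrier (socle A J) \<subseteq> C" "short_projective_resolution (submod J C)"
  shows "proj_dim A (socle A J) \<le> 1"
proof -
  let ?S = "carrier (socle A J)"
  have Jm: "right_module A J" and Jfg: "fg_module A J" using J by (simp_all add: mod_cat_def fg_module_def)
  have subS: "submodule ?S A J" by (rule submodule_socle[OF Jm])
  then have "submodule ?S A (submod J C)" using C(2) by (simp add: submodule_of_submod[OF Jm C(1)])
  then have "short_projective_resolution (submod (submod J C) ?S)"
    by (rule short_projective_resolution_submod[OF gl fg_submod[OF Jfg C(1)] C(3)])
  then have short: "short_projective_resolution (socle A J)" using socle_submod[of A J] by simp
  have "right_module A (socle A J)"
    using right_module_submod[OF Jm subS] socle_submod[of A J] by simp
  then show ?thesis using short by (rule proj_dim_le_1_iff[THEN iffD2])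
qed

lemma dom_dim_ge_2E:
  assumes "dom_dim A \<ge> 2"
  obtains I e d where "minimal_injective_resolution A (regular_module A) I e d"
    "projective_module A (I 0)" "projective_module A (I 1)"
proof -
  let ?S = "{enat n | n. \<exists>I e d. minimal_injective_resolution A (regular_module A) I e d \<and>
     (\<forall>i<n. projective_module A (I i))}"
  have "1 < (2::enat)" by (simp add: one_enat_def numeral_eq_enat)
  then have "1 < Sup ?S" using assms unfolding dom_dim_def by (rule less_le_trans)
  then obtain s where s: "s \<in> ?S" "1 < s" unfolding less_Sup_iff by blast
  then obtain n I e d where n: "s = enat n" "minimal_injective_resolution A (regular_module A) I e d"
    "\<forall>i<n. projective_module A (I i)" by blast
  then have "1 < n" using s(2) by (simp add: one_enat_def)
  then show ?thesis using that[OF n(2)] n(3) by simp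
qed

theorem auslander_algebra_iff:
  "auslander_algebra A \<longleftrightarrow> gl_dim A \<le> 2 \<and>
    proj_inj_modules A = {I \<in> mod_cat A. injective_module A I \<and> proj_dim A (socle A I) \<le> 1}"
proof (cases "gl_dim A \<le> 2")
  case False
  then show ?thesis by (simp add: auslander_algebra_def)
next
  case gl: True
  note Rm = right_module_regular[OF ring_A] and Rfg = fg_regular[OF ring_A]
  have mod: "right_module A J" "fg_module A J" if "J \<in> mod_cat A" for J :: "('a, 'a list) module"
    using that by (simp_all add: mod_cat_def fg_module_def)
  have socm: "right_module A (socle A J)" if J: "J \<in> mod_cat A" for J
    using right_module_submod[OF mod(1)[OF J] submodule_socle[OF mod(1)[OF J]]] socle_submod[of A J] by simp
  have sub: "proj_dim A (socle A J) \<le> 1" if J: "J \<in> mod_cat A" "projective_module A J" for J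
  proof (rule socle_proj_dim_le_1[OF gl J(1) submodule_carrier[OF mod(1)[OF J(1)]]])
    show "carrier (socle A J) \<subseteq> carrier J" using submodule_subset[OF submodule_socle[OF mod(1)[OF J(1)]]] by blast
    show "short_projective_resolution (submod J (carrier J))"
      using short_projective_resolution_projective[OF mod(2)[OF J(1)] J(2)] by simp
  qed
  have "dom_dim A \<ge> 2 \<longleftrightarrow>
    proj_inj_modules A = {I \<in> mod_cat A. injective_module A I \<and> proj_dim A (socle A I) \<le> 1}"
  proof
    assume "dom_dim A \<ge> 2"
    then obtain I e d where res: "minimal_injective_resolution A (regular_module A) I e d"
      and proj: "projective_module A (I 0)" "projective_module A (I 1)" by (rule dom_dim_ge_2E)
    have I: "I i \<in> mod_cat A" "injective_module A (I i)" for i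
      using res by (simp_all add: minimal_injective_resolution_def)
    have e: "e \<in> module_hom A (regular_module A) (I 0)" "inj_on e (carrier A)"
      and d: "d 0 \<in> module_hom A (I 0) (I 1)" "module_kernel (I 0) (I 1) (d 0) = e ` carrier A"
      using res by (simp_all add: minimal_injective_resolution_def)
    have "projective_module A J"
      if "J \<in> mod_cat A" "injective_module A J" "proj_dim A (socle A J) \<le> 1" for J
    proof (rule injective_with_short_socle_projective[OF I proj(1) I proj(2) e d that(1,2)])
      show "short_projective_resolution (socle A J)" using that(3) proj_dim_le_1_iff[OF socm[OF that(1)]] by simp
    qed
    then show "proj_inj_modules A = {I \<in> mod_cat A. injective_module A I \<and> proj_dim A (socle A I) \<le> 1}"
      unfolding proj_inj_modules_def using sub by blast
  next
    assume eq: "proj_inj_modules A = {I \<in> mod_cat A. injective_module A I \<and> proj_dim A (socle A I) \<le> 1}"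
    have proj: "projective_module A J"
      if "J \<in> mod_cat A" "injective_module A J" "proj_dim A (socle A J) \<le> 1" for J
    proof -
      have "J \<in> proj_inj_modules A" unfolding eq using that by simp
      then show ?thesis by (simp add: proj_inj_modules_def)
    qed
    obtain I e d where res: "minimal_injective_resolution A (regular_module A) I e d"
      using ex_minimal_injective_resolution[OF Rfg] by blast
    have I: "I i \<in> mod_cat A" "injective_module A (I i)" for i
      using res by (simp_all add: minimal_injective_resolution_def)
    have e: "e \<in> module_hom A (regular_module A) (I 0)" "inj_on e (carrier A)"
      and d: "d 0 \<in> module_hom A (I 0) (I 1)" "module_kernel (I 0) (I 1) (d 0) = e ` carrier A"
      and ess: "essential_submodule A (I 0) (e ` carrier A)"
        "essential_submodule A (I 1) (d 0 ` carrier (I 0))"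
      using res by (simp_all add: minimal_injective_resolution_def)
    have A0: "projective_module A (submod (I 0) (e ` carrier A))"
      using projective_image_of_monic[OF Rm projective_regular[OF ring_A] mod(1)[OF I(1)] e(1)] e(2) by simp
    have sub0: "submodule (e ` carrier A) A (I 0)" and sub1: "submodule (d 0 ` carrier (I 0)) A (I 1)"
      using ess by (simp_all add: essential_submodule_def)
    have "proj_dim A (socle A (I 0)) \<le> 1"
      by (rule socle_proj_dim_le_1[OF gl I(1) sub0 socle_subset_essential[OF mod(1)[OF I(1)] ess(1)]
            short_projective_resolution_projective[OF fg_submod[OF mod(2)[OF I(1)] sub0] A0]])
    then have p0: "projective_module A (I 0)" by (rule proj[OF I])
    let ?C = "submod (I 1) (d 0 ` carrier (I 0))"
    have "short_projective_resolution ?C"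
    proof (rule short_projective_resolutionI[OF mod(2)[OF I(1)] p0 right_module_submod[OF mod(1)[OF I(1)] sub1]])
      show "d 0 \<in> module_hom A (I 0) ?C" by (rule hom_corestrict[OF d(1)]) blast
      show "d 0 ` carrier (I 0) = carrier ?C" by simp
      have "module_kernel (I 0) ?C (d 0) = e ` carrier A" unfolding d(2)[symmetric] by (simp add: module_kernel_def)
      then show "projective_module A (submod (I 0) (module_kernel (I 0) ?C (d 0)))" using A0 by simp
    qed
    then have "proj_dim A (socle A (I 1)) \<le> 1"
      by (rule socle_proj_dim_le_1[OF gl I(1) sub1 socle_subset_essential[OF mod(1)[OF I(1)] ess(2)]])
    then have p1: "projective_module A (I 1)" by (rule proj[OF I])
    have "\<forall>i<2. projective_module A (I i)" using p0 p1 by (auto simp: less_2_cases_iff)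
    then have "enat 2 \<le> dom_dim A" unfolding dom_dim_def using res by (intro Sup_upper) blast
    then show "dom_dim A \<ge> 2" by (simp add: numeral_eq_enat)
  qed
  then show ?thesis using gl by (simp add: auslander_algebra_def)
qed

end

theorem theoremC:
  fixes K :: "'k ring" and A :: "('k, 'a) module"
  assumes "algebraically_closed K"
    and "finite_dimensional_algebra K A"
    and "basic_algebra A"
  shows "auslander_algebra A \<longleftrightarrow>
    gl_dim A \<le> 2 \<and>
    proj_inj_modules A =
      {I \<in> mod_cat A. injective_module A I \<and> proj_dim A (socle A I) \<le> 1}"
  using finite_dimensional_algebra.auslander_algebra_iff[OF assms(2)] .

end
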